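(* Let $r_0>0$, $\varepsilon_0>0$, and let $e_{(\cdot)}:[0,\varepsilon_0]\to \mathscr{E}^2$, $m\mapsto e_m$, be a continuous curve which is differentiable at $m=0$ and satisfies $e_0=0$. On the manifold with boundary $M=\mathbb{R}^3\setminus B_{r_0}$ consider the one-parameter family of metrics \[ g^{m,e_m}_{ij}(x)=\Big(1+\frac{m}{2|x|}\Big)^4\delta_{ij}+(e_m(x))_{ij},\qquad m\in[0,\varepsilon_0]. \] Then there exists $\bar c\geq r_0$ such that it is NOT possible to find simultaneously: (i) a continuous curve $\Omega_{(\cdot)}:[0,\varepsilon_0]\to \mathscr{C}^2_b(S^1\times\mathbb{R})$, $m\mapsto\Omega_m$, differentiable at $m=0$, with $\Omega_0=0$, and such that for each $m\in[0,\varepsilon_0]$ one has $\Omega_m(u,v)\to 0$ as $v\to\pm\infty$; (ii) sequences $m_i\downarrow 0$ with $0<m_i<\varepsilon_0$ and $c_i\geq \bar c$, such that for every $i$ the perturbed catenoidal immersion $F^{\Omega_{m_i}}_{c_i}:S^1\times\mathbb{R}\to M$ is a minimal immersion (i.e. has identically vanishing mean curvature) in $(M,g^{m_i,e_{m_i}})$.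
   Context: For $r_0>0$, $\mathscr{E}^k$ denotes the Banach space of maps $e:\mathbb{R}^3\setminus B_{r_0}\to\{\text{symmetric real }3\times 3\text{ matrices}\}$ of class $C^k$ with finite norm $\|e\|_{\mathscr{E}^k}=\sum_{i,j=1}^3\sum_{|\alpha|\le k}\sup_{|x|\ge r_0}|\partial^\alpha e_{ij}(x)|\,|x|^{2+|\alpha|}$. $\mathscr{C}^k_b(S^1\times\mathbb{R})$ denotes the Banach space of $C^k$ functions $f$ on $S^1\times\mathbb{R}$ (coordinates $(u,v)$) with finite norm $\sum_{|\alpha|\le k}\sup_{S^1\times\mathbb{R}}|\nabla^\alpha f|$. For $c>0$, the catenoid of neck $c$ with vertical axis is parametrized by $F_c(u,v)=(c\cosh v\cos u,\,c\cosh v\sin u,\,cv)$, with unit normal $\mathbf{n}_{F_c}(u,v)=\cosh^{-1}(v)(\cos u,\sin u,-\sinh v)$. For a function $\Omega$ on $S^1\times\mathbb{R}$, the normal graph over this catenoid with defining function $\Omega$ is $F^\Omega_c=F_c+\Omega\,\mathbf{n}_{F_c}$, i.e. \[F^\Omega_c(u,v)=\Big(\big(c\cosh v+\tfrac{\Omega(u,v)}{\cosh v}\big)\cos u,\ \big(c\cosh v+\tfrac{\Omega(u,v)}{\cosh v}\big)\sin u,\ cv-\tanh(v)\,\Omega(u,v)\Big).\] *)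

theory Defs
  imports "HOL-Analysis.Analysis"
begin

text \<open>Partial derivative of f in direction of the i-th coordinate axis, taken within S
  (one-sided at boundary points of S).\<close>
definition pd :: "(real^'n) set \<Rightarrow> 'n \<Rightarrow> (real^'n \<Rightarrow> real) \<Rightarrow> real^'n \<Rightarrow> real" where
  "pd S i f x = vector_derivative (\<lambda>t. f (x + t *\<^sub>R axis i 1))
                   (at 0 within {t. x + t *\<^sub>R axis i 1 \<in> S})"

definition pd_exists :: "(real^'n) set \<Rightarrow> 'n \<Rightarrow> (real^'n \<Rightarrow> real) \<Rightarrow> real^'n \<Rightarrow> bool" where
  "pd_exists S i f x \<longleftrightarrow> (\<lambda>t. f (x + t *\<^sub>R axis i 1)) differentiable
                   (at 0 within {t. x + t *\<^sub>R axis i 1 \<in> S})"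

fun Ck :: "nat \<Rightarrow> (real^'n) set \<Rightarrow> (real^'n \<Rightarrow> real) \<Rightarrow> bool" where
  "Ck 0 S f = continuous_on S f"
| "Ck (Suc k) S f = (continuous_on S f \<and> (\<forall>i. \<forall>x\<in>S. pd_exists S i f x)
                      \<and> (\<forall>i. Ck k S (pd S i f)))"

definition dalpha3 :: "(real^3) set \<Rightarrow> (3 \<Rightarrow> nat) \<Rightarrow> (real^3 \<Rightarrow> real) \<Rightarrow> real^3 \<Rightarrow> real" where
  "dalpha3 S \<alpha> f = ((pd S 1) ^^ (\<alpha> 1)) (((pd S 2) ^^ (\<alpha> 2)) (((pd S 3) ^^ (\<alpha> 3)) f))"

definition dalpha2 :: "(2 \<Rightarrow> nat) \<Rightarrow> (real^2 \<Rightarrow> real) \<Rightarrow> real^2 \<Rightarrow> real" where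
  "dalpha2 \<alpha> f = ((pd UNIV 1) ^^ (\<alpha> 1)) (((pd UNIV 2) ^^ (\<alpha> 2)) f)"

definition Mset :: "real \<Rightarrow> (real^3) set" where
  "Mset r0 = {x. norm x \<ge> r0}"

definition in_E :: "real \<Rightarrow> nat \<Rightarrow> (real^3 \<Rightarrow> real^3^3) \<Rightarrow> bool" where
  "in_E r0 k e \<longleftrightarrow>
     (\<forall>x\<in>Mset r0. \<forall>i j. e x $ i $ j = e x $ j $ i)
   \<and> (\<forall>i j. Ck k (Mset r0) (\<lambda>x. e x $ i $ j))
   \<and> (\<forall>i j \<alpha>. sum \<alpha> UNIV \<le> k \<longrightarrow>
        bdd_above ((\<lambda>x. \<bar>dalpha3 (Mset r0) \<alpha> (\<lambda>y. e y $ i $ j) x\<bar> * norm x ^ (2 + sum \<alpha> UNIV))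
                   ` Mset r0))"

definition Enorm :: "real \<Rightarrow> nat \<Rightarrow> (real^3 \<Rightarrow> real^3^3) \<Rightarrow> real" where
  "Enorm r0 k e = (\<Sum>i\<in>UNIV. \<Sum>j\<in>UNIV. \<Sum>\<alpha>\<in>{\<alpha>::3\<Rightarrow>nat. sum \<alpha> UNIV \<le> k}.
      (SUP x\<in>Mset r0. \<bar>dalpha3 (Mset r0) \<alpha> (\<lambda>y. e y $ i $ j) x\<bar> * norm x ^ (2 + sum \<alpha> UNIV)))"

text \<open>Functions on S^1 x R are represented as 2\<pi>-periodic functions of p = (u,v) \<in> R^2,
  u = p$1, v = p$2.\<close>
definition in_Cb :: "nat \<Rightarrow> (real^2 \<Rightarrow> real) \<Rightarrow> bool" where
  "in_Cb k f \<longleftrightarrow>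
     (\<forall>p. f (p + (2*pi) *\<^sub>R axis 1 1) = f p)
   \<and> Ck k UNIV f
   \<and> (\<forall>\<alpha>. sum \<alpha> UNIV \<le> k \<longrightarrow> bdd_above (range (\<lambda>p. \<bar>dalpha2 \<alpha> f p\<bar>)))"

definition Cbnorm :: "nat \<Rightarrow> (real^2 \<Rightarrow> real) \<Rightarrow> real" where
  "Cbnorm k f = (\<Sum>\<alpha>\<in>{\<alpha>::2\<Rightarrow>nat. sum \<alpha> UNIV \<le> k}. (SUP p. \<bar>dalpha2 \<alpha> f p\<bar>))"

text \<open>A curve [0,eps0] \<rightarrow> X, m \<mapsto> \<gamma> m, continuous w.r.t. the norm N of X (membership P).\<close>
definition curve_cont :: "(('a \<Rightarrow> 'b::real_normed_vector) \<Rightarrow> real) \<Rightarrow> (('a \<Rightarrow> 'b) \<Rightarrow> bool)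
    \<Rightarrow> real \<Rightarrow> (real \<Rightarrow> 'a \<Rightarrow> 'b) \<Rightarrow> bool" where
  "curve_cont N P eps0 \<gamma> \<longleftrightarrow>
     (\<forall>m\<in>{0..eps0}. P (\<gamma> m))
   \<and> (\<forall>m0\<in>{0..eps0}. ((\<lambda>m. N (\<lambda>x. \<gamma> m x - \<gamma> m0 x)) \<longlongrightarrow> 0) (at m0 within {0..eps0}))"

definition curve_diff_at0 :: "(('a \<Rightarrow> 'b::real_normed_vector) \<Rightarrow> real) \<Rightarrow> (('a \<Rightarrow> 'b) \<Rightarrow> bool)
    \<Rightarrow> real \<Rightarrow> (real \<Rightarrow> 'a \<Rightarrow> 'b) \<Rightarrow> bool" where
  "curve_diff_at0 N P eps0 \<gamma> \<longleftrightarrow>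
     (\<exists>\<delta>. P \<delta> \<and> ((\<lambda>m. N (\<lambda>x. (1/m) *\<^sub>R (\<gamma> m x - \<gamma> 0 x) - \<delta> x)) \<longlongrightarrow> 0)
                  (at 0 within {0..eps0}))"

definition gmet :: "real \<Rightarrow> (real^3 \<Rightarrow> real^3^3) \<Rightarrow> real^3 \<Rightarrow> real^3^3" where
  "gmet m e x = (1 + m / (2 * norm x)) ^ 4 *\<^sub>R mat 1 + e x"

definition Fcat :: "real \<Rightarrow> (real^2 \<Rightarrow> real) \<Rightarrow> real^2 \<Rightarrow> real^3" where
  "Fcat c \<Omega> p = (let u = p $ 1; v = p $ 2; \<rho> = c * cosh v + \<Omega> p / cosh v in
     (\<chi> k. if k = 1 then \<rho> * cos u else if k = 2 then \<rho> * sin u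
           else c * v - tanh v * \<Omega> p))"

definition gform :: "(real^3 \<Rightarrow> real^3^3) \<Rightarrow> real^3 \<Rightarrow> real^3 \<Rightarrow> real^3 \<Rightarrow> real" where
  "gform G x v w = (\<Sum>i\<in>UNIV. \<Sum>j\<in>UNIV. G x $ i $ j * v $ i * w $ j)"

definition christ :: "(real^3) set \<Rightarrow> (real^3 \<Rightarrow> real^3^3) \<Rightarrow> real^3 \<Rightarrow> 3 \<Rightarrow> 3 \<Rightarrow> 3 \<Rightarrow> real" where
  "christ S G x l i j = (pd S i (\<lambda>y. G y $ j $ l) x + pd S j (\<lambda>y. G y $ i $ l) x
                          - pd S l (\<lambda>y. G y $ i $ j) x) / 2"

definition dF :: "(real^2 \<Rightarrow> real^3) \<Rightarrow> 2 \<Rightarrow> real^2 \<Rightarrow> real^3" where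
  "dF F a p = (\<chi> k. pd UNIV a (\<lambda>q. F q $ k) p)"

definition ddF :: "(real^2 \<Rightarrow> real^3) \<Rightarrow> 2 \<Rightarrow> 2 \<Rightarrow> real^2 \<Rightarrow> real^3" where
  "ddF F a b p = (\<chi> k. pd UNIV a (pd UNIV b (\<lambda>q. F q $ k)) p)"

text \<open>Induced metric h_ab and second fundamental form II_ab(nu) = g(nabla_a d_b F, nu).\<close>
definition hind :: "(real^3 \<Rightarrow> real^3^3) \<Rightarrow> (real^2 \<Rightarrow> real^3) \<Rightarrow> 2 \<Rightarrow> 2 \<Rightarrow> real^2 \<Rightarrow> real" where
  "hind G F a b p = gform G (F p) (dF F a p) (dF F b p)"

definition sff :: "(real^3) set \<Rightarrow> (real^3 \<Rightarrow> real^3^3) \<Rightarrow> (real^2 \<Rightarrow> real^3) \<Rightarrow> real^3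
    \<Rightarrow> 2 \<Rightarrow> 2 \<Rightarrow> real^2 \<Rightarrow> real" where
  "sff S G F \<nu> a b p = gform G (F p) (ddF F a b p) \<nu>
      + (\<Sum>l\<in>UNIV. \<Sum>i\<in>UNIV. \<Sum>j\<in>UNIV.
           christ S G (F p) l i j * dF F a p $ i * dF F b p $ j * \<nu> $ l)"

text \<open>Mean curvature H = h^{ab} II_ab(nu) w.r.t. the normal nu.\<close>
definition meancurv :: "(real^3) set \<Rightarrow> (real^3 \<Rightarrow> real^3^3) \<Rightarrow> (real^2 \<Rightarrow> real^3) \<Rightarrow> real^3
    \<Rightarrow> real^2 \<Rightarrow> real" where
  "meancurv S G F \<nu> p =
     (hind G F 2 2 p * sff S G F \<nu> 1 1 p - hind G F 1 2 p * sff S G F \<nu> 2 1 p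
      - hind G F 2 1 p * sff S G F \<nu> 1 2 p + hind G F 1 1 p * sff S G F \<nu> 2 2 p)
     / (hind G F 1 1 p * hind G F 2 2 p - hind G F 1 2 p * hind G F 2 1 p)"

definition minimal_immersion :: "(real^3) set \<Rightarrow> (real^3 \<Rightarrow> real^3^3) \<Rightarrow> (real^2 \<Rightarrow> real^3) \<Rightarrow> bool" where
  "minimal_immersion S G F \<longleftrightarrow>
     (\<forall>k. Ck 2 UNIV (\<lambda>q. F q $ k))
   \<and> (\<forall>p. F p \<in> S)
   \<and> (\<forall>p. \<forall>s t. s *\<^sub>R dF F 1 p + t *\<^sub>R dF F 2 p = 0 \<longrightarrow> s = 0 \<and> t = 0)
   \<and> (\<forall>p. \<forall>w. w \<noteq> 0 \<longrightarrow> gform G (F p) w w > 0)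
   \<and> (\<forall>p \<nu>. gform G (F p) \<nu> \<nu> = 1 \<and> gform G (F p) (dF F 1 p) \<nu> = 0
              \<and> gform G (F p) (dF F 2 p) \<nu> = 0 \<longrightarrow> meancurv S G F \<nu> p = 0)"

end

theory Submission
  imports Defs
begin

text \<open>
  Write \<open>L = \<partial>\<^sub>u\<^sup>2 + \<partial>\<^sub>v\<^sup>2 + 2 / cosh\<^sup>2 v\<close> for the rescaled Jacobi operator of the catenoid and
  \<open>R = c cosh v\<close> for its conformal factor. Rescaled by \<open>R\<close>, the vanishing of the mean curvature of the normal graph reads
  \<open>L \<Omega> + 2 m D(v) = O(\<parallel>e\<parallel> + \<parallel>\<Omega>\<parallel>\<^sup>2 + m \<parallel>\<Omega>\<parallel> + m\<^sup>2) / R\<close>, uniformly in \<open>c \<ge> 1\<close>. Here the source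
  \<open>D(v) = cosh\<^sup>2 v (1 - v tanh v) / (cosh\<^sup>2 v + v\<^sup>2)\<^bsup>3/2\<^esup>\<close> is the contribution of the Schwarzschild factor, whereas
  \<open>e\<close>, which is \<open>O(m)\<close>, enters with an additional factor \<open>1 / c\<close>.

  The Jacobi function \<open>1 - v tanh v\<close> generated by dilations has a sign-definite pairing with \<open>D\<close>. Averaging
  over \<open>u\<close> and pairing with it turns the left-hand side into a boundary term, which vanishes since the average
  of \<open>\<Omega>\<close> tends to \<open>0\<close> and hence has an exponentially decaying derivative. What remains is
  \<open>m \<le> C (m / c + m\<^sup>2)\<close>, which is false once \<open>c\<close> is large and \<open>m\<close> is small.
\<close>

text \<open>The pairing is sign-definite for a geometric reason. The Schwarzschild factor is radial,
  so its gradient is parallel to the position vector and acts on the surface through the normal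
  component of that vector. This component is also the Jacobi function of dilations; hence the
  source is that Jacobi function times a positive weight.

  The different fate of \<open>e\<close> is a matter of scaling. In units of \<open>R\<close> the
  gradient of the Schwarzschild factor has size m / R, while \<open>e\<close> and its Christoffel
  symbols have size m / R^2. After multiplication by \<open>R\<close> the former is independent of
  \<open>c\<close>, the latter is not.

  The order of the quantifiers shapes the estimates: \<open>cbar\<close> is fixed before the curve
  of graphs is known, so it may depend only on the linear bound for \<open>e\<close>. Every term
  with the bound for the graphs has to be beaten by small m instead, which works because
  differentiability at 0 makes those terms quadratic in m.

  The powers of ten are coarse ceilings; what matters is that they do not depend on
  \<open>c\<close>, m or the graph.\<close>

section \<open>Partial derivatives and the weighted norms\<close>

text \<open>
  At a point from which no axis-parallel segment stays in \<open>S\<close>, the filter in the definition of \<^const>\<open>pd\<close> is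
  trivial and \<^const>\<open>pd\<close> is an arbitrary value.
\<close>

definition axis_accessible :: "(real^'n) set \<Rightarrow> bool" where
  "axis_accessible S \<longleftrightarrow> (\<forall>x\<in>S. \<forall>i. at 0 within {t. x + t *\<^sub>R axis i 1 \<in> S} \<noteq> bot)"

lemma axis_accessible_UNIV: "axis_accessible (UNIV :: (real^'n) set)"
  by (simp add: axis_accessible_def)

text \<open>Moving along an axis in the direction that does not decrease the absolute value of that
  coordinate cannot decrease the norm, so at least a half-line of parameters stays in the exterior
  domain.\<close>

lemma axis_accessible_Mset: "axis_accessible (Mset r0)"
  unfolding axis_accessible_def
proof (intro ballI allI)
  fix x :: "real^3" and i assume x: "x \<in> Mset r0"
  have mem: "x + t *\<^sub>R axis i 1 \<in> Mset r0" if "t * x $ i \<ge> 0" for t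
  proof -
    have "(norm (x + t *\<^sub>R axis i 1))\<^sup>2 = (norm x)\<^sup>2 + 2 * (t * x $ i) + t * t"
      unfolding power2_norm_eq_inner inner_add_left inner_add_right inner_scaleR_left
        inner_scaleR_right inner_axis inner_axis' inner_axis_axis by (simp add: axis_def algebra_simps)
    then have "(norm x)\<^sup>2 \<le> (norm (x + t *\<^sub>R axis i 1))\<^sup>2"
      using that zero_le_square[of t] by linarith
    then have "norm x \<le> norm (x + t *\<^sub>R axis i 1)"
      by (rule power2_le_imp_le) simp
    with x show ?thesis by (simp add: Mset_def)
  qed
  show "at 0 within {t. x + t *\<^sub>R axis i 1 \<in> Mset r0} \<noteq> bot"
  proof (cases "x $ i \<ge> 0")
    case True
    then have "{0..} \<subseteq> {t. x + t *\<^sub>R axis i 1 \<in> Mset r0}" by (auto intro!: mem)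
    then have "at (0::real) within {0..} \<le> at 0 within {t. x + t *\<^sub>R axis i 1 \<in> Mset r0}"
      by (rule at_le)
    moreover have "at (0::real) within {0..} \<noteq> bot"
      unfolding at_within_Ici_at_right by (rule trivial_limit_at_right_real)
    ultimately show ?thesis by (auto dest: bot.extremum_uniqueI)
  next
    case False
    then have "{..0} \<subseteq> {t. x + t *\<^sub>R axis i 1 \<in> Mset r0}"
      by (auto intro!: mem mult_nonpos_nonpos)
    then have "at (0::real) within {..0} \<le> at 0 within {t. x + t *\<^sub>R axis i 1 \<in> Mset r0}"
      by (rule at_le)
    moreover have "at (0::real) within {..0} \<noteq> bot"
      unfolding at_within_Iic_at_left by (rule trivial_limit_at_left_real)
    ultimately show ?thesis by (auto dest: bot.extremum_uniqueI)
  qed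
qed

lemma has_derivative_pd:
  assumes "pd_exists S i f x"
  shows "((\<lambda>t. f (x + t *\<^sub>R axis i 1)) has_real_derivative pd S i f x)
           (at 0 within {t. x + t *\<^sub>R axis i 1 \<in> S})"
  using assms unfolding pd_exists_def pd_def has_real_derivative_iff_has_vector_derivative
  by (simp add: vector_derivative_works)

lemma pd_eqI:
  assumes "axis_accessible S" "x \<in> S"
    and "((\<lambda>t. f (x + t *\<^sub>R axis i 1)) has_real_derivative d)
           (at 0 within {t. x + t *\<^sub>R axis i 1 \<in> S})"
  shows "pd S i f x = d" and "pd_exists S i f x"
proof -
  show "pd S i f x = d"
    unfolding pd_def using assms
    by (auto intro!: vector_derivative_within
        simp: axis_accessible_def has_real_derivative_iff_has_vector_derivative)
  show "pd_exists S i f x"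
    unfolding pd_exists_def using assms(3)
    by (auto simp: has_field_derivative_def intro: differentiableI)
qed

lemma has_derivative_along_axis_cong:
  assumes "x \<in> S" "\<And>y. y \<in> S \<Longrightarrow> f y = g y"
    and "((\<lambda>t. f (x + t *\<^sub>R axis i 1)) has_derivative D) (at 0 within {t. x + t *\<^sub>R axis i 1 \<in> S})"
  shows "((\<lambda>t. g (x + t *\<^sub>R axis i 1)) has_derivative D) (at 0 within {t. x + t *\<^sub>R axis i 1 \<in> S})"
  by (rule has_derivative_transform[OF _ _ assms(3)]) (use assms in auto)

lemma pd_cong:
  assumes "x \<in> S" "\<And>y. y \<in> S \<Longrightarrow> f y = g y"
  shows "pd S i f x = pd S i g x" and "pd_exists S i f x \<longleftrightarrow> pd_exists S i g x"
proof -
  \<comment> \<open>The equivalence for every \<open>D\<close> makes the choice terms behind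
    \<open>vector_derivative\<close> identical, so the two values of \<open>pd\<close> agree even at
    points without a derivative.\<close>
  have "((\<lambda>t. f (x + t *\<^sub>R axis i 1)) has_derivative D) (at 0 within {t. x + t *\<^sub>R axis i 1 \<in> S}) \<longleftrightarrow>
        ((\<lambda>t. g (x + t *\<^sub>R axis i 1)) has_derivative D) (at 0 within {t. x + t *\<^sub>R axis i 1 \<in> S})" for D
    using has_derivative_along_axis_cong[of x S f g i D] has_derivative_along_axis_cong[of x S g f i D] assms
    by auto
  then show "pd S i f x = pd S i g x" "pd_exists S i f x \<longleftrightarrow> pd_exists S i g x"
    by (simp_all add: pd_def pd_exists_def vector_derivative_def has_vector_derivative_def
        differentiable_def)
qed

lemma pd_lincomb:
  assumes "axis_accessible S" "x \<in> S" "pd_exists S i f x" "pd_exists S i g x"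
  shows "pd S i (\<lambda>x. a * f x + b * g x) x = a * pd S i f x + b * pd S i g x"
    and "pd_exists S i (\<lambda>x. a * f x + b * g x) x"
proof -
  have "((\<lambda>t. a * f (x + t *\<^sub>R axis i 1) + b * g (x + t *\<^sub>R axis i 1)) has_real_derivative
          a * pd S i f x + b * pd S i g x) (at 0 within {t. x + t *\<^sub>R axis i 1 \<in> S})"
    by (intro DERIV_add DERIV_cmult has_derivative_pd assms)
  from pd_eqI[where f = "\<lambda>x. a * f x + b * g x", OF assms(1,2) this]
  show "pd S i (\<lambda>x. a * f x + b * g x) x = a * pd S i f x + b * pd S i g x"
    and "pd_exists S i (\<lambda>x. a * f x + b * g x) x" by auto
qed

text \<open>Iterated derivatives along a word of directions. Both multi-index derivatives are
  instances with a sorted word, so congruence and linearity are proved by one list induction for all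
  of them.\<close>

fun pdl :: "(real^'n) set \<Rightarrow> 'n list \<Rightarrow> (real^'n \<Rightarrow> real) \<Rightarrow> real^'n \<Rightarrow> real" where
  "pdl S [] f = f"
| "pdl S (i # is) f = pd S i (pdl S is f)"

lemma pdl_append: "pdl S (is @ js) f = pdl S is (pdl S js f)"
  by (induction "is") auto

lemma pdl_replicate: "pdl S (replicate n i) f = (pd S i ^^ n) f"
  by (induction n) auto

lemma pdl_cong:
  assumes "\<And>y. y \<in> S \<Longrightarrow> f y = g y" "x \<in> S"
  shows "pdl S is f x = pdl S is g x"
  using assms(2) by (induction "is" arbitrary: x) (auto intro: assms(1) pd_cong(1))

lemma Ck_pdl: "Ck k S f \<Longrightarrow> length is \<le> k \<Longrightarrow> Ck (k - length is) S (pdl S is f)"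
proof (induction "is")
  case (Cons i "is")
  then have "Ck (Suc (k - Suc (length is))) S (pdl S is f)"
    by (metis Suc_diff_Suc Suc_le_lessD Suc_leD length_Cons)
  then show ?case by simp
qed simp

lemma pdl_lincomb:
  assumes "axis_accessible S" "Ck k S f" "Ck k S g"
  shows "length is \<le> k \<Longrightarrow> x \<in> S \<Longrightarrow>
    pdl S is (\<lambda>x. a * f x + b * g x) x = a * pdl S is f x + b * pdl S is g x"
proof (induction "is" arbitrary: x)
  case (Cons i "is")
  have ex: "pd_exists S i (pdl S is h) x" if "Ck k S h" for h
  proof -
    have "Ck (Suc (k - Suc (length is))) S (pdl S is h)"
      using Ck_pdl[OF that, of "is"] Cons.prems
      by (metis Suc_diff_Suc Suc_le_lessD Suc_leD length_Cons)
    then show ?thesis using Cons.prems by simp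
  qed
  have "pdl S (i # is) (\<lambda>x. a * f x + b * g x) x
      = pd S i (\<lambda>x. a * pdl S is f x + b * pdl S is g x) x"
    using Cons by (auto intro!: pd_cong(1))
  also have "\<dots> = a * pd S i (pdl S is f) x + b * pd S i (pdl S is g) x"
    by (rule pd_lincomb[OF assms(1) Cons.prems(2) ex[OF assms(2)] ex[OF assms(3)]])
  finally show ?case by simp
qed simp

lemma dalpha3_eq_pdl:
  "dalpha3 S \<alpha> f = pdl S (replicate (\<alpha> 1) 1 @ replicate (\<alpha> 2) 2 @ replicate (\<alpha> 3) 3) f"
  by (simp add: dalpha3_def pdl_append pdl_replicate)

lemma dalpha2_eq_pdl:
  "dalpha2 \<alpha> f = pdl UNIV (replicate (\<alpha> 1) 1 @ replicate (\<alpha> 2) 2) f"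
  by (simp add: dalpha2_def pdl_append pdl_replicate)

lemma finite_multi_indices: "finite {\<alpha> :: 'n::finite \<Rightarrow> nat. sum \<alpha> UNIV \<le> k}"
proof (rule finite_subset)
  show "{\<alpha> :: 'n \<Rightarrow> nat. sum \<alpha> UNIV \<le> k} \<subseteq> Pi\<^sub>E UNIV (\<lambda>_. {..k})"
  proof
    fix \<alpha> :: "'n \<Rightarrow> nat" assume "\<alpha> \<in> {\<alpha>. sum \<alpha> UNIV \<le> k}"
    moreover have "\<alpha> i \<le> sum \<alpha> UNIV" for i by (rule member_le_sum) auto
    ultimately show "\<alpha> \<in> Pi\<^sub>E UNIV (\<lambda>_. {..k})" by (auto intro: order_trans)
  qed
qed (auto intro: finite_PiE)

section \<open>Pointwise bounds extracted from sums of suprema\<close>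

lemma le_sum_Sup:
  fixes h :: "'a \<Rightarrow> 'b \<Rightarrow> real"
  assumes "finite A" "\<alpha> \<in> A" "x \<in> X"
    and "\<And>\<alpha>. \<alpha> \<in> A \<Longrightarrow> bdd_above (h \<alpha> ` X)" "\<And>\<alpha> x. \<alpha> \<in> A \<Longrightarrow> x \<in> X \<Longrightarrow> 0 \<le> h \<alpha> x"
  shows "h \<alpha> x \<le> (\<Sum>\<alpha>\<in>A. SUP x\<in>X. h \<alpha> x)" and "0 \<le> (\<Sum>\<alpha>\<in>A. SUP x\<in>X. h \<alpha> x)"
proof -
  have nn: "0 \<le> (SUP x\<in>X. h \<beta> x)" if "\<beta> \<in> A" for \<beta>
    using cSUP_upper[OF assms(3) assms(4)[OF that]] assms(5)[OF that assms(3)] by linarith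
  have "h \<alpha> x \<le> (SUP x\<in>X. h \<alpha> x)" by (rule cSUP_upper[OF assms(3) assms(4)[OF assms(2)]])
  also have "\<dots> \<le> (\<Sum>\<alpha>\<in>A. SUP x\<in>X. h \<alpha> x)"
    by (rule member_le_sum) (use assms nn in auto)
  finally show "h \<alpha> x \<le> (\<Sum>\<alpha>\<in>A. SUP x\<in>X. h \<alpha> x)" .
  show "0 \<le> (\<Sum>\<alpha>\<in>A. SUP x\<in>X. h \<alpha> x)" by (rule sum_nonneg) (rule nn)
qed

lemma dalpha3_le_Enorm:
  assumes bdd: "\<And>i j \<alpha>. sum \<alpha> UNIV \<le> k \<Longrightarrow> bdd_above ((\<lambda>x. \<bar>dalpha3 (Mset r0) \<alpha> (\<lambda>y. e y $ i $ j) x\<bar>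
            * norm x ^ (2 + sum \<alpha> UNIV)) ` Mset r0)"
    and "x \<in> Mset r0" "sum \<alpha> UNIV \<le> k"
  shows "\<bar>dalpha3 (Mset r0) \<alpha> (\<lambda>y. e y $ i $ j) x\<bar> * norm x ^ (2 + sum \<alpha> UNIV) \<le> Enorm r0 k e"
proof -
  define h where "h i j = (\<lambda>\<alpha> x. \<bar>dalpha3 (Mset r0) \<alpha> (\<lambda>y. e y $ i $ j) x\<bar> * norm x ^ (2 + sum \<alpha> UNIV))"
    for i j
  define T where "T i j = (\<Sum>\<alpha>\<in>{\<alpha>. sum \<alpha> UNIV \<le> k}. SUP x\<in>Mset r0. h i j \<alpha> x)" for i j
  have *: "h i j \<alpha> x \<le> T i j" "0 \<le> T i j" for i j
    unfolding T_def
    using le_sum_Sup[where h = "h i j" and A = "{\<alpha>. sum \<alpha> UNIV \<le> k}" and X = "Mset r0",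
        OF finite_multi_indices _ assms(2)] bdd assms(3)
    by (auto simp: h_def)
  have "h i j \<alpha> x \<le> T i j" by (rule *)
  also have "\<dots> \<le> (\<Sum>j\<in>UNIV. T i j)" by (rule member_le_sum) (auto intro: *)
  also have "\<dots> \<le> (\<Sum>i\<in>UNIV. \<Sum>j\<in>UNIV. T i j)"
    by (rule member_le_sum[where f = "\<lambda>i. \<Sum>j\<in>UNIV. T i j"]) (auto intro!: * sum_nonneg)
  finally show ?thesis by (simp add: h_def T_def Enorm_def)
qed

lemma dalpha2_le_Cbnorm:
  assumes bdd: "\<And>\<alpha>. sum \<alpha> UNIV \<le> k \<Longrightarrow> bdd_above (range (\<lambda>p. \<bar>dalpha2 \<alpha> f p\<bar>))"
    and "sum \<alpha> UNIV \<le> k"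
  shows "\<bar>dalpha2 \<alpha> f p\<bar> \<le> Cbnorm k f"
  unfolding Cbnorm_def
  using le_sum_Sup(1)[where h = "\<lambda>\<alpha> p. \<bar>dalpha2 \<alpha> f p\<bar>" and A = "{\<alpha>. sum \<alpha> UNIV \<le> k}" and X = UNIV,
      OF finite_multi_indices _ UNIV_I] bdd assms(2)
  by simp

text \<open>The combination is prescribed on \<open>Mset r0\<close> only, because that is where
  \<open>e 0\<close> is known to vanish when the difference quotient is simplified.\<close>

lemma dalpha3_lincomb:
  assumes "Ck k (Mset r0) f" "Ck k (Mset r0) g" "sum \<alpha> UNIV \<le> k" "x \<in> Mset r0"
    and "\<And>y. y \<in> Mset r0 \<Longrightarrow> h y = a * f y + b * g y"
  shows "dalpha3 (Mset r0) \<alpha> h x = a * dalpha3 (Mset r0) \<alpha> f x + b * dalpha3 (Mset r0) \<alpha> g x"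
proof -
  have len: "length (replicate (\<alpha> 1) (1::3) @ replicate (\<alpha> 2) 2 @ replicate (\<alpha> 3) 3) \<le> k"
    using assms(3) by (simp add: sum_3)
  show ?thesis
    unfolding dalpha3_eq_pdl pdl_lincomb[OF axis_accessible_Mset assms(1,2) len assms(4), symmetric]
    by (rule pdl_cong) (use assms in auto)
qed

lemma dalpha2_lincomb:
  assumes "Ck k UNIV f" "Ck k UNIV g" "sum \<alpha> UNIV \<le> k"
  shows "dalpha2 \<alpha> (\<lambda>x. a * f x + b * g x) x = a * dalpha2 \<alpha> f x + b * dalpha2 \<alpha> g x"
  unfolding dalpha2_eq_pdl
  by (rule pdl_lincomb[OF axis_accessible_UNIV assms(1,2)]) (use assms(3) in \<open>simp_all add: sum_2\<close>)

text \<open>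
  The supremum of an unbounded set of reals is arbitrary, so a small norm of the difference quotient carries
  information only once the difference quotient is known to be bounded.
\<close>

lemma bdd_above_lincomb:
  fixes f g w :: "'a \<Rightarrow> real"
  assumes "bdd_above ((\<lambda>x. \<bar>f x\<bar> * w x) ` X)" "bdd_above ((\<lambda>x. \<bar>g x\<bar> * w x) ` X)"
    and "\<And>x. x \<in> X \<Longrightarrow> 0 \<le> w x" "\<And>x. x \<in> X \<Longrightarrow> h x = a * f x + b * g x"
  shows "bdd_above ((\<lambda>x. \<bar>h x\<bar> * w x) ` X)"
proof -
  from assms(1,2) obtain A B where A: "\<And>x. x \<in> X \<Longrightarrow> \<bar>f x\<bar> * w x \<le> A"
    and B: "\<And>x. x \<in> X \<Longrightarrow> \<bar>g x\<bar> * w x \<le> B"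
    unfolding bdd_above_def by fastforce
  show ?thesis
  proof (rule bdd_aboveI2)
    fix x assume x: "x \<in> X"
    have "\<bar>h x\<bar> * w x \<le> (\<bar>a\<bar> * \<bar>f x\<bar> + \<bar>b\<bar> * \<bar>g x\<bar>) * w x"
      using assms(3)[OF x] unfolding assms(4)[OF x]
      by (intro mult_right_mono) (auto simp: abs_mult[symmetric])
    also have "\<dots> = \<bar>a\<bar> * (\<bar>f x\<bar> * w x) + \<bar>b\<bar> * (\<bar>g x\<bar> * w x)" by (simp add: algebra_simps)
    also have "\<dots> \<le> \<bar>a\<bar> * A + \<bar>b\<bar> * B"
      using A[OF x] B[OF x] by (intro add_mono mult_left_mono) auto
    finally show "\<bar>h x\<bar> * w x \<le> \<bar>a\<bar> * A + \<bar>b\<bar> * B" .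
  qed
qed

lemma abs_le_of_difference_quotient:
  fixes m :: real
  assumes "0 < m" "0 \<le> w" "\<bar>(1 / m) * f + (-1) * d\<bar> * w \<le> 1" "\<bar>d\<bar> * w \<le> K"
  shows "\<bar>f\<bar> * w \<le> m * (1 + K)"
proof -
  have "\<bar>f\<bar> = m * \<bar>((1 / m) * f + (-1) * d) + d\<bar>"
    using assms(1) by (simp add: abs_mult)
  also have "\<dots> \<le> m * (\<bar>(1 / m) * f + (-1) * d\<bar> + \<bar>d\<bar>)"
    using assms(1) by (intro mult_left_mono abs_triangle_ineq) auto
  finally have "\<bar>f\<bar> * w \<le> m * (\<bar>(1 / m) * f + (-1) * d\<bar> + \<bar>d\<bar>) * w"
    using assms(2) by (rule mult_right_mono)
  also have "\<dots> = m * (\<bar>(1 / m) * f + (-1) * d\<bar> * w + \<bar>d\<bar> * w)" by (simp add: algebra_simps)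
  also have "\<dots> \<le> m * (1 + K)" using assms by (intro mult_left_mono add_mono) auto
  finally show ?thesis .
qed

text \<open>For small m the quotient of \<open>e m\<close> by m lies within distance 1 of the
  derivative at 0, so \<open>e m\<close> is linear in m together with its weighted derivatives. The
  conclusion is pointwise, which is the form needed at a point of the surface.\<close>

lemma metric_curve_linear_bound:
  assumes "0 < eps0" "curve_cont (Enorm r0 2) (in_E r0 2) eps0 e"
    and "curve_diff_at0 (Enorm r0 2) (in_E r0 2) eps0 e" "\<forall>x\<in>Mset r0. e 0 x = 0"
  obtains K d where "0 \<le> K" "0 < d"
    "\<And>m i j \<alpha> x. 0 < m \<Longrightarrow> m < d \<Longrightarrow> m \<le> eps0 \<Longrightarrow> x \<in> Mset r0 \<Longrightarrow> sum \<alpha> UNIV \<le> 2 \<Longrightarrow>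
       \<bar>dalpha3 (Mset r0) \<alpha> (\<lambda>y. e m y $ i $ j) x\<bar> * norm x ^ (2 + sum \<alpha> UNIV) \<le> K * m"
proof -
  from assms(3) obtain \<delta> where \<delta>: "in_E r0 2 \<delta>"
    and lim: "((\<lambda>m. Enorm r0 2 (\<lambda>x. (1/m) *\<^sub>R (e m x - e 0 x) - \<delta> x)) \<longlongrightarrow> 0) (at 0 within {0..eps0})"
    unfolding curve_diff_at0_def by blast
  from tendstoD[OF lim, of 1] obtain d where d: "0 < d"
    "\<And>m. m \<in> {0..eps0} \<Longrightarrow> m \<noteq> 0 \<Longrightarrow> dist m 0 < d \<Longrightarrow>
        \<bar>Enorm r0 2 (\<lambda>x. (1/m) *\<^sub>R (e m x - e 0 x) - \<delta> x)\<bar> < 1"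
    unfolding eventually_at by auto
  \<comment> \<open>The absolute value gives nonnegativity without an argument about the norm
    itself.\<close>
  define K where "K = \<bar>Enorm r0 2 \<delta>\<bar>"
  have "\<bar>dalpha3 (Mset r0) \<alpha> (\<lambda>y. e m y $ i $ j) x\<bar> * norm x ^ (2 + sum \<alpha> UNIV) \<le> (1 + K) * m"
    if m: "0 < m" "m < d" "m \<le> eps0" and x: "x \<in> Mset r0" and \<alpha>: "sum \<alpha> UNIV \<le> 2" for m i j \<alpha> x
  proof -
    have em: "in_E r0 2 (e m)" using assms(2) m by (auto simp: curve_cont_def)
    have eq: "dalpha3 (Mset r0) \<beta> (\<lambda>y. ((1/m) *\<^sub>R (e m y - e 0 y) - \<delta> y) $ i $ j) y =
        (1/m) * dalpha3 (Mset r0) \<beta> (\<lambda>y. e m y $ i $ j) y + (-1) * dalpha3 (Mset r0) \<beta> (\<lambda>y. \<delta> y $ i $ j) y"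
      if "sum \<beta> UNIV \<le> 2" "y \<in> Mset r0" for \<beta> y i j
      by (rule dalpha3_lincomb[where k = 2]) (use em \<delta> that assms(4) in \<open>auto simp: in_E_def\<close>)
    have bdd: "bdd_above ((\<lambda>x. \<bar>dalpha3 (Mset r0) \<beta> (\<lambda>y. ((1/m) *\<^sub>R (e m y - e 0 y) - \<delta> y) $ i $ j) x\<bar>
            * norm x ^ (2 + sum \<beta> UNIV)) ` Mset r0)" if "sum \<beta> UNIV \<le> 2" for \<beta> i j
    proof (rule bdd_above_lincomb[OF _ _ _ eq[OF that]])
      show "bdd_above ((\<lambda>x. \<bar>dalpha3 (Mset r0) \<beta> (\<lambda>y. e m y $ i $ j) x\<bar> * norm x ^ (2 + sum \<beta> UNIV)) ` Mset r0)"
        using em that by (simp add: in_E_def)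
      show "bdd_above ((\<lambda>x. \<bar>dalpha3 (Mset r0) \<beta> (\<lambda>y. \<delta> y $ i $ j) x\<bar> * norm x ^ (2 + sum \<beta> UNIV)) ` Mset r0)"
        using \<delta> that by (simp add: in_E_def)
    qed auto
    have "\<bar>dalpha3 (Mset r0) \<alpha> (\<lambda>y. ((1/m) *\<^sub>R (e m y - e 0 y) - \<delta> y) $ i $ j) x\<bar> * norm x ^ (2 + sum \<alpha> UNIV)
        \<le> Enorm r0 2 (\<lambda>x. (1/m) *\<^sub>R (e m x - e 0 x) - \<delta> x)"
      by (rule dalpha3_le_Enorm[OF bdd x \<alpha>])
    also have "\<dots> \<le> 1" using d(2)[of m] m by (simp add: dist_real_def)
    finally have 1: "\<bar>(1/m) * dalpha3 (Mset r0) \<alpha> (\<lambda>y. e m y $ i $ j) x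
          + (-1) * dalpha3 (Mset r0) \<alpha> (\<lambda>y. \<delta> y $ i $ j) x\<bar> * norm x ^ (2 + sum \<alpha> UNIV) \<le> 1"
      unfolding eq[OF \<alpha> x] .
    have "\<bar>dalpha3 (Mset r0) \<alpha> (\<lambda>y. \<delta> y $ i $ j) x\<bar> * norm x ^ (2 + sum \<alpha> UNIV) \<le> Enorm r0 2 \<delta>"
      by (rule dalpha3_le_Enorm[OF _ x \<alpha>]) (use \<delta> in \<open>auto simp: in_E_def\<close>)
    then have 2: "\<bar>dalpha3 (Mset r0) \<alpha> (\<lambda>y. \<delta> y $ i $ j) x\<bar> * norm x ^ (2 + sum \<alpha> UNIV) \<le> K"
      unfolding K_def by linarith
    show ?thesis using abs_le_of_difference_quotient[OF m(1) _ 1 2] by (simp add: mult.commute)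
  qed
  moreover have "0 \<le> 1 + K" by (simp add: K_def)
  ultimately show ?thesis using that d(1) by blast
qed

lemma graph_curve_linear_bound:
  assumes "0 < eps0" "curve_cont (Cbnorm 2) (in_Cb 2) eps0 \<Omega>"
    and "curve_diff_at0 (Cbnorm 2) (in_Cb 2) eps0 \<Omega>" "\<forall>p. \<Omega> 0 p = 0"
  obtains K d where "0 \<le> K" "0 < d"
    "\<And>m \<alpha> p. 0 < m \<Longrightarrow> m < d \<Longrightarrow> m \<le> eps0 \<Longrightarrow> sum \<alpha> UNIV \<le> 2 \<Longrightarrow> \<bar>dalpha2 \<alpha> (\<Omega> m) p\<bar> \<le> K * m"
proof -
  from assms(3) obtain \<delta> where \<delta>: "in_Cb 2 \<delta>"
    and lim: "((\<lambda>m. Cbnorm 2 (\<lambda>x. (1/m) *\<^sub>R (\<Omega> m x - \<Omega> 0 x) - \<delta> x)) \<longlongrightarrow> 0) (at 0 within {0..eps0})"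
    unfolding curve_diff_at0_def by blast
  have lim': "((\<lambda>m. Cbnorm 2 (\<lambda>x. (1/m) * \<Omega> m x + (-1) * \<delta> x)) \<longlongrightarrow> 0) (at 0 within {0..eps0})"
    using lim assms(4) by simp
  from tendstoD[OF lim', of 1] obtain d where d: "0 < d"
    "\<And>m. m \<in> {0..eps0} \<Longrightarrow> m \<noteq> 0 \<Longrightarrow> dist m 0 < d \<Longrightarrow>
        \<bar>Cbnorm 2 (\<lambda>x. (1/m) * \<Omega> m x + (-1) * \<delta> x)\<bar> < 1"
    unfolding eventually_at by auto
  define K where "K = \<bar>Cbnorm 2 \<delta>\<bar>"
  have "\<bar>dalpha2 \<alpha> (\<Omega> m) p\<bar> \<le> (1 + K) * m"
    if m: "0 < m" "m < d" "m \<le> eps0" and \<alpha>: "sum \<alpha> UNIV \<le> 2" for m \<alpha> p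
  proof -
    have Om: "in_Cb 2 (\<Omega> m)" using assms(2) m by (auto simp: curve_cont_def)
    have eq: "dalpha2 \<beta> (\<lambda>x. (1/m) * \<Omega> m x + (-1) * \<delta> x) y =
        (1/m) * dalpha2 \<beta> (\<Omega> m) y + (-1) * dalpha2 \<beta> \<delta> y" if "sum \<beta> UNIV \<le> 2" for \<beta> y
      by (rule dalpha2_lincomb[where k = 2]) (use Om \<delta> that in \<open>auto simp: in_Cb_def\<close>)
    have bdd: "bdd_above (range (\<lambda>p. \<bar>dalpha2 \<beta> (\<lambda>x. (1/m) * \<Omega> m x + (-1) * \<delta> x) p\<bar>))"
      if "sum \<beta> UNIV \<le> 2" for \<beta>
      using bdd_above_lincomb[of "dalpha2 \<beta> (\<Omega> m)" "\<lambda>_. 1" UNIV "dalpha2 \<beta> \<delta>", OF _ _ _ eq[OF that]]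
        Om \<delta> that unfolding in_Cb_def by auto
    have "\<bar>dalpha2 \<alpha> (\<lambda>x. (1/m) * \<Omega> m x + (-1) * \<delta> x) p\<bar> \<le> Cbnorm 2 (\<lambda>x. (1/m) * \<Omega> m x + (-1) * \<delta> x)"
      by (rule dalpha2_le_Cbnorm[OF bdd \<alpha>])
    also have "\<dots> \<le> 1" using d(2)[of m] m by (simp add: dist_real_def)
    finally have 1: "\<bar>(1/m) * dalpha2 \<alpha> (\<Omega> m) p + (-1) * dalpha2 \<alpha> \<delta> p\<bar> * 1 \<le> 1"
      unfolding eq[OF \<alpha>] by simp
    have "\<bar>dalpha2 \<alpha> \<delta> p\<bar> \<le> Cbnorm 2 \<delta>"
      by (rule dalpha2_le_Cbnorm[OF _ \<alpha>]) (use \<delta> in \<open>auto simp: in_Cb_def\<close>)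
    then have 2: "\<bar>dalpha2 \<alpha> \<delta> p\<bar> * 1 \<le> K" unfolding K_def by linarith
    show ?thesis using abs_le_of_difference_quotient[OF m(1) _ 1 2] by (simp add: mult.commute)
  qed
  moreover have "0 \<le> 1 + K" by (simp add: K_def)
  ultimately show ?thesis using that d(1) by blast
qed

section \<open>Expansion of the Euclidean mean curvature\<close>

text \<open>A first-order expansion in the small parameter \<eta>: zeroth-order part, first-order
  part, quadratic remainder. One constant \<open>A\<close> serves all three, so constants simply add
  under sums and multiply, up to a factor, under products.\<close>

definition jet :: "real \<Rightarrow> real \<Rightarrow> real \<Rightarrow> real \<Rightarrow> real \<Rightarrow> bool" where
  "jet A \<eta> x x0 x1 \<longleftrightarrow> \<bar>x0\<bar> \<le> A \<and> \<bar>x1\<bar> \<le> A * \<eta> \<and> \<bar>x - x0 - x1\<bar> \<le> A * \<eta>\<^sup>2"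

lemma jetI:
  assumes "x = x0 + x1" "\<bar>x0\<bar> \<le> A" "\<bar>x1\<bar> \<le> A * \<eta>"
  shows "jet A \<eta> x x0 x1"
proof -
  have "0 \<le> A * \<eta>\<^sup>2" using assms(2) by (intro mult_nonneg_nonneg) auto
  then show ?thesis using assms by (simp add: jet_def)
qed

lemma jet_add:
  assumes "jet A \<eta> x x0 x1" "jet B \<eta> y y0 y1"
  shows "jet (A + B) \<eta> (x + y) (x0 + y0) (x1 + y1)"
  using assms unfolding jet_def by (auto simp: distrib_right)

lemma jet_minus:
  assumes "jet A \<eta> x x0 x1"
  shows "jet A \<eta> (- x) (- x0) (- x1)"
  using assms unfolding jet_def by auto

lemma jet_diff:
  assumes "jet A \<eta> x x0 x1" "jet B \<eta> y y0 y1"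
  shows "jet (A + B) \<eta> (x - y) (x0 - y0) (x1 - y1)"
  using jet_add[OF assms(1) jet_minus[OF assms(2)]] by simp

lemma abs_mult_le:
  fixes x y :: real
  assumes "\<bar>x\<bar> \<le> A" "\<bar>y\<bar> \<le> B"
  shows "\<bar>x * y\<bar> \<le> A * B"
  unfolding abs_mult using assms by (intro mult_mono) auto

text \<open>The factor 6 counts the products of total order at least two; those of order three and
  four are absorbed since \<eta> is at most 1.\<close>

lemma jet_mult:
  assumes "0 \<le> \<eta> \<and> \<eta> \<le> 1" "jet A \<eta> x x0 x1" "jet B \<eta> y y0 y1"
  shows "jet (6 * (A * B)) \<eta> (x * y) (x0 * y0) (x0 * y1 + x1 * y0)"
proof -
  define x2 y2 where "x2 = x - x0 - x1" and "y2 = y - y0 - y1"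
  have x: "\<bar>x0\<bar> \<le> A" "\<bar>x1\<bar> \<le> A * \<eta>" "\<bar>x2\<bar> \<le> A * \<eta>\<^sup>2"
    and y: "\<bar>y0\<bar> \<le> B" "\<bar>y1\<bar> \<le> B * \<eta>" "\<bar>y2\<bar> \<le> B * \<eta>\<^sup>2"
    using assms by (auto simp: jet_def x2_def y2_def)
  have A: "0 \<le> A" and B: "0 \<le> B" using x(1) y(1) by linarith+
  have AB: "0 \<le> A * B" using A B by simp
  have pow: "A * B * \<eta> ^ 3 \<le> A * B * \<eta>\<^sup>2" "A * B * \<eta> ^ 4 \<le> A * B * \<eta>\<^sup>2"
    using AB assms(1) by (auto intro!: mult_left_mono power_decreasing)
  have "\<bar>x0 * y0\<bar> \<le> A * B" by (rule abs_mult_le[OF x(1) y(1)])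
  then have 0: "\<bar>x0 * y0\<bar> \<le> 6 * (A * B)" using AB by linarith
  have l: "\<bar>x0 * y1\<bar> \<le> A * B * \<eta>" "\<bar>x1 * y0\<bar> \<le> A * B * \<eta>"
    using abs_mult_le[OF x(1) y(2)] abs_mult_le[OF x(2) y(1)] by (simp_all add: algebra_simps)
  have "0 \<le> A * B * \<eta>" using AB assms(1) by simp
  then have 1: "\<bar>x0 * y1 + x1 * y0\<bar> \<le> 6 * (A * B) * \<eta>"
    using l by linarith
  have q: "\<bar>x0 * y2\<bar> \<le> A * B * \<eta>\<^sup>2" "\<bar>x1 * y1\<bar> \<le> A * B * \<eta>\<^sup>2" "\<bar>x2 * y0\<bar> \<le> A * B * \<eta>\<^sup>2"
    "\<bar>x1 * y2\<bar> \<le> A * B * \<eta> ^ 3" "\<bar>x2 * y1\<bar> \<le> A * B * \<eta> ^ 3" "\<bar>x2 * y2\<bar> \<le> A * B * \<eta> ^ 4"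
    using abs_mult_le[OF x(1) y(3)] abs_mult_le[OF x(2) y(2)] abs_mult_le[OF x(3) y(1)]
      abs_mult_le[OF x(2) y(3)] abs_mult_le[OF x(3) y(2)] abs_mult_le[OF x(3) y(3)]
    by (simp_all add: algebra_simps power2_eq_square power3_eq_cube power4_eq_xxxx)
  have "x * y - x0 * y0 - (x0 * y1 + x1 * y0) = x0 * y2 + x1 * y1 + x2 * y0 + x1 * y2 + x2 * y1 + x2 * y2"
    by (simp add: x2_def y2_def algebra_simps)
  then have 2: "\<bar>x * y - x0 * y0 - (x0 * y1 + x1 * y0)\<bar> \<le> 6 * (A * B) * \<eta>\<^sup>2"
    using q pow by linarith
  from 0 1 2 show ?thesis by (simp add: jet_def)
qed

lemma jet_near_zeroth:
  assumes "0 \<le> \<eta> \<and> \<eta> \<le> 1" "jet A \<eta> x x0 x1"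
  shows "\<bar>x - x0\<bar> \<le> 2 * A * \<eta>"
proof -
  have A: "0 \<le> A" using assms(2) unfolding jet_def by linarith
  have "A * \<eta>\<^sup>2 \<le> A * \<eta>" using assms(1) A by (intro mult_left_mono) (auto simp: power2_eq_square mult_left_le)
  then show ?thesis using assms(2) unfolding jet_def by linarith
qed

text \<open>Components, in the frame (radial, angular, vertical) and divided by the conformal factor
  \<open>c cosh v\<close>, of the derivatives of the normal graph over the catenoid: \<open>s = 1 / cosh v\<close>,
  \<open>t = tanh v\<close>, and \<open>w, wu, wv, \<dots>\<close> are the correspondingly rescaled derivatives of the
  defining function.\<close>

locale graph_jet =
  fixes s t w wu wv wuu wuv wvv \<eta> :: real
  assumes st: "s\<^sup>2 + t\<^sup>2 = 1" and \<eta>: "0 \<le> \<eta> \<and> \<eta> \<le> 1"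
    and w: "\<bar>w\<bar> \<le> \<eta>" "\<bar>wu\<bar> \<le> \<eta>" "\<bar>wv\<bar> \<le> \<eta>" "\<bar>wuu\<bar> \<le> \<eta>" "\<bar>wuv\<bar> \<le> \<eta>" "\<bar>wvv\<bar> \<le> \<eta>"
begin

definition "r = 1 + s * w"
definition "ru = s * wu"
definition "rv = t + s * wv - s * t * w"
definition "zu = - t * wu"
definition "zv = s - s\<^sup>2 * w - t * wv"
definition "ruu = s * wuu"
definition "ruv = s * wuv - s * t * wu"
definition "rvv = 1 + s * wvv - 2 * s * t * wv + (s * t\<^sup>2 - s ^ 3) * w"
definition "zuu = - t * wuu"
definition "zuv = - s\<^sup>2 * wu - t * wuv"
definition "zvv = 2 * s\<^sup>2 * t * w - 2 * s\<^sup>2 * wv - t * wvv"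

text \<open>Components of the cross product of the tangent vectors (ru, r, zu) and (rv, 0, zv). It
  is left unnormalised so that everything stays polynomial in the jet variables.\<close>

definition "n1 = r * zv"
definition "n2 = zu * rv - ru * zv"
definition "n3 = - (r * rv)"

text \<open>The numerator h22 b11 - 2 h12 b12 + h11 b22 of the Euclidean mean curvature. Squares and
  doubled terms are written as products and sums, so that the expression is assembled exactly by the
  jet rules.\<close>

definition "euclid_numerator =
  (rv * rv + zv * zv) * ((ruu - r) * n1 + (ru + ru) * n2 + zuu * n3)
  - (ru * rv + zu * zv + (ru * rv + zu * zv)) * (ruv * n1 + rv * n2 + zuv * n3)
  + (ru * ru + r * r + zu * zu) * (rvv * n1 + zvv * n3)"

lemma s_le: "\<bar>s\<bar> \<le> 1" and t_le: "\<bar>t\<bar> \<le> 1"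
proof -
  have "s\<^sup>2 \<le> 1\<^sup>2" "t\<^sup>2 \<le> 1\<^sup>2" using st zero_le_power2[of s] zero_le_power2[of t]
    unfolding one_power2 by linarith+
  then show "\<bar>s\<bar> \<le> 1" "\<bar>t\<bar> \<le> 1" unfolding abs_le_square_iff[symmetric] by simp_all
qed

lemma mult_le_eta: "\<bar>a\<bar> \<le> 1 \<Longrightarrow> \<bar>x\<bar> \<le> \<eta> \<Longrightarrow> \<bar>a * x\<bar> \<le> \<eta>"
  using abs_mult_le[of a 1 x \<eta>] by simp

lemma coeff_le:
  "\<bar>s * t\<bar> \<le> 1" "\<bar>s\<^sup>2\<bar> \<le> 1" "\<bar>s * t\<^sup>2\<bar> \<le> 1" "\<bar>s ^ 3\<bar> \<le> 1" "\<bar>s\<^sup>2 * t\<bar> \<le> 1"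
  using abs_mult_le[OF s_le t_le] abs_mult_le[OF s_le s_le]
    abs_mult_le[OF s_le abs_mult_le[OF t_le t_le]] abs_mult_le[OF s_le abs_mult_le[OF s_le s_le]]
    abs_mult_le[OF s_le abs_mult_le[OF s_le t_le]]
  by (simp_all add: power2_eq_square power3_eq_cube mult.assoc)

text \<open>The zeroth-order parts are those of the catenoid itself. The constant 5 is forced by
  \<open>rvv\<close> and \<open>zvv\<close>, whose first-order coefficients add up to 1 + 2 + 1 + 1
  and 2 + 2 + 1.\<close>

lemma base_jets:
  "jet 5 \<eta> r 1 (s * w)"
  "jet 5 \<eta> ru 0 (s * wu)"
  "jet 5 \<eta> rv t (s * wv - s * t * w)"
  "jet 5 \<eta> zu 0 (- t * wu)"
  "jet 5 \<eta> zv s (- s\<^sup>2 * w - t * wv)"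
  "jet 5 \<eta> ruu 0 (s * wuu)"
  "jet 5 \<eta> ruv 0 (s * wuv - s * t * wu)"
  "jet 5 \<eta> rvv 1 (s * wvv - 2 * (s * t * wv) + (s * t\<^sup>2 * w - s ^ 3 * w))"
  "jet 5 \<eta> zuu 0 (- t * wuu)"
  "jet 5 \<eta> zuv 0 (- s\<^sup>2 * wu - t * wuv)"
  "jet 5 \<eta> zvv 0 (2 * (s\<^sup>2 * t * w) - 2 * (s\<^sup>2 * wv) - t * wvv)"
proof -
  show "jet 5 \<eta> r 1 (s * w)" by (rule jetI) (simp add: r_def, simp, use \<eta> mult_le_eta[OF s_le w(1)] in linarith)
  show "jet 5 \<eta> ru 0 (s * wu)" by (rule jetI) (simp add: ru_def, simp, use \<eta> mult_le_eta[OF s_le w(2)] in linarith)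
  show "jet 5 \<eta> rv t (s * wv - s * t * w)"
    by (rule jetI) (simp add: rv_def, use t_le in linarith, use \<eta> mult_le_eta[OF s_le w(3)] mult_le_eta[OF coeff_le(1) w(1)] in linarith)
  show "jet 5 \<eta> zu 0 (- t * wu)" by (rule jetI) (simp add: zu_def, simp, use \<eta> mult_le_eta[OF t_le w(2)] in \<open>simp only: mult_minus_left; linarith\<close>)
  show "jet 5 \<eta> zv s (- s\<^sup>2 * w - t * wv)"
    by (rule jetI) (simp add: zv_def, use s_le in linarith, use \<eta> mult_le_eta[OF coeff_le(2) w(1)] mult_le_eta[OF t_le w(3)] in \<open>simp only: mult_minus_left; linarith\<close>)
  show "jet 5 \<eta> ruu 0 (s * wuu)" by (rule jetI) (simp add: ruu_def, simp, use \<eta> mult_le_eta[OF s_le w(4)] in linarith)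
  show "jet 5 \<eta> ruv 0 (s * wuv - s * t * wu)"
    by (rule jetI) (simp add: ruv_def, simp, use \<eta> mult_le_eta[OF s_le w(5)] mult_le_eta[OF coeff_le(1) w(2)] in linarith)
  show "jet 5 \<eta> rvv 1 (s * wvv - 2 * (s * t * wv) + (s * t\<^sup>2 * w - s ^ 3 * w))"
    by (rule jetI) (simp add: rvv_def algebra_simps, simp, use \<eta> mult_le_eta[OF s_le w(6)] mult_le_eta[OF coeff_le(1) w(3)] mult_le_eta[OF coeff_le(3) w(1)] mult_le_eta[OF coeff_le(4) w(1)] in linarith)
  show "jet 5 \<eta> zuu 0 (- t * wuu)" by (rule jetI) (simp add: zuu_def, simp, use \<eta> mult_le_eta[OF t_le w(4)] in \<open>simp only: mult_minus_left; linarith\<close>)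
  show "jet 5 \<eta> zuv 0 (- s\<^sup>2 * wu - t * wuv)"
    by (rule jetI) (simp add: zuv_def, simp, use \<eta> mult_le_eta[OF coeff_le(2) w(2)] mult_le_eta[OF t_le w(5)] in \<open>simp only: mult_minus_left; linarith\<close>)
  show "jet 5 \<eta> zvv 0 (2 * (s\<^sup>2 * t * w) - 2 * (s\<^sup>2 * wv) - t * wvv)"
    by (rule jetI) (simp add: zvv_def algebra_simps, simp, use \<eta> mult_le_eta[OF coeff_le(5) w(1)] mult_le_eta[OF coeff_le(2) w(3)] mult_le_eta[OF t_le w(6)] in linarith)
qed

text \<open>These supply the bounds by 8 for tangent vectors and second derivatives required in
  \<open>perturbed_normal\<close> and \<open>numerator_bound\<close>.\<close>

lemma component_bounds:
  assumes "\<eta> \<le> 1 / 2"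
  shows "\<bar>r\<bar> \<le> 3 / 2" "\<bar>ru\<bar> \<le> 1 / 2" "\<bar>zu\<bar> \<le> 1 / 2" "\<bar>rv\<bar> \<le> 2" "\<bar>zv\<bar> \<le> 2" "\<bar>ruu\<bar> \<le> 1 / 2"
    "\<bar>zuu\<bar> \<le> 1 / 2" "\<bar>ruv\<bar> \<le> 1" "\<bar>zuv\<bar> \<le> 1" "\<bar>rvv\<bar> \<le> 7 / 2" "\<bar>zvv\<bar> \<le> 5 / 2"
proof -
  note b = mult_le_eta
  show "\<bar>r\<bar> \<le> 3 / 2" unfolding r_def using assms b[OF s_le w(1)] by linarith
  show "\<bar>ru\<bar> \<le> 1 / 2" unfolding ru_def using assms b[OF s_le w(2)] by linarith
  show "\<bar>zu\<bar> \<le> 1 / 2" unfolding zu_def mult_minus_left using assms b[OF t_le w(2)] by linarith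
  show "\<bar>rv\<bar> \<le> 2" unfolding rv_def using assms t_le b[OF s_le w(3)] b[OF coeff_le(1) w(1)] by linarith
  show "\<bar>zv\<bar> \<le> 2" unfolding zv_def using assms s_le b[OF coeff_le(2) w(1)] b[OF t_le w(3)] by linarith
  show "\<bar>ruu\<bar> \<le> 1 / 2" unfolding ruu_def using assms b[OF s_le w(4)] by linarith
  show "\<bar>zuu\<bar> \<le> 1 / 2" unfolding zuu_def mult_minus_left using assms b[OF t_le w(4)] by linarith
  show "\<bar>ruv\<bar> \<le> 1" unfolding ruv_def using assms b[OF s_le w(5)] b[OF coeff_le(1) w(2)] by linarith
  show "\<bar>zuv\<bar> \<le> 1" unfolding zuv_def mult_minus_left
    using assms b[OF coeff_le(2) w(2)] b[OF t_le w(5)] by linarith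
  have "rvv = 1 + s * wvv - 2 * (s * t * wv) + (s * t\<^sup>2 * w - s ^ 3 * w)"
    by (simp add: rvv_def algebra_simps)
  then show "\<bar>rvv\<bar> \<le> 7 / 2"
    using assms b[OF s_le w(6)] b[OF coeff_le(1) w(3)] b[OF coeff_le(3) w(1)] b[OF coeff_le(4) w(1)] by linarith
  have "zvv = 2 * (s\<^sup>2 * t * w) - 2 * (s\<^sup>2 * wv) - t * wvv"
    by (simp add: zvv_def algebra_simps)
  then show "\<bar>zvv\<bar> \<le> 5 / 2"
    using assms b[OF coeff_le(5) w(1)] b[OF coeff_le(2) w(3)] b[OF t_le w(6)] by linarith
qed

lemmas normal_jets =
  jet_mult[OF \<eta> base_jets(1,5), folded n1_def]
  jet_diff[OF jet_mult[OF \<eta> base_jets(4,3)] jet_mult[OF \<eta> base_jets(2,5)], folded n2_def]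
  jet_minus[OF jet_mult[OF \<eta> base_jets(1,3)], folded n3_def]

text \<open>The zeroth-order part vanishes because the catenoid is minimal, and the first-order part
  is the linearised mean curvature, that is, the Jacobi operator. The remainder is quadratic by the
  jet calculus.\<close>

lemma abs_euclid_numerator_minus_Jacobi_le:
  "\<bar>euclid_numerator - (wuu + wvv + 2 * s\<^sup>2 * w)\<bar> \<le> 10 ^ 20 * \<eta>\<^sup>2"
proof -
  note h22 = jet_add[OF jet_mult[OF \<eta> base_jets(3,3)] jet_mult[OF \<eta> base_jets(5,5)]]
  note h12 = jet_add[OF jet_mult[OF \<eta> base_jets(2,3)] jet_mult[OF \<eta> base_jets(4,5)]]
  note h11 = jet_add[OF jet_add[OF jet_mult[OF \<eta> base_jets(2,2)] jet_mult[OF \<eta> base_jets(1,1)]]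
      jet_mult[OF \<eta> base_jets(4,4)]]
  note b11 = jet_add[OF jet_add[OF jet_mult[OF \<eta> jet_diff[OF base_jets(6,1)] normal_jets(1)]
      jet_mult[OF \<eta> jet_add[OF base_jets(2,2)] normal_jets(2)]]
      jet_mult[OF \<eta> base_jets(9) normal_jets(3)]]
  note b12 = jet_add[OF jet_add[OF jet_mult[OF \<eta> base_jets(7) normal_jets(1)]
      jet_mult[OF \<eta> base_jets(3) normal_jets(2)]]
      jet_mult[OF \<eta> base_jets(10) normal_jets(3)]]
  note b22 = jet_add[OF jet_mult[OF \<eta> base_jets(8) normal_jets(1)]
      jet_mult[OF \<eta> base_jets(11) normal_jets(3)]]
  note Q = jet_add[OF jet_diff[OF jet_mult[OF \<eta> h22 b11] jet_mult[OF \<eta> jet_add[OF h12 h12] b12]]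
      jet_mult[OF \<eta> h11 b22], folded euclid_numerator_def]
  \<comment> \<open>The jet rules produce large expressions for the two parts and the constant.
    Unification inserts them, and modulo \<open>st\<close> the parts reduce to polynomial
    identities.\<close>
  obtain q0 q1 A where J: "jet A \<eta> euclid_numerator q0 q1" and q0: "q0 = 0"
    and q1: "q1 = wuu + wvv + 2 * s\<^sup>2 * w" and A: "A \<le> 10 ^ 20"
  proof (rule that[OF Q], goal_cases)
    case 1
    show ?case using st by (simp add: power2_eq_square add.commute)
  next
    case 2
    show ?case using st by algebra
  next
    case 3
    show ?case by simp
  qed
  have "\<bar>euclid_numerator - (wuu + wvv + 2 * s\<^sup>2 * w)\<bar> \<le> A * \<eta>\<^sup>2"
    using J by (simp add: jet_def q0 q1)
  also have "\<dots> \<le> 10 ^ 20 * \<eta>\<^sup>2" using A by (rule mult_right_mono) simp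
  finally show ?thesis .
qed

text \<open>By Lagrange's identity this is also the determinant of the induced Euclidean metric,
  which is how it enters the numerator.\<close>

definition "normal_sq = n1 * n1 + n2 * n2 + n3 * n3"

text \<open>With X = (r, 0, s v - t w) the rescaled position and N the normal, the first expression
  is (X . N) |N|^2 / (\<phi> |X|^3). On the catenoid N = (s, 0, -t) is a unit vector, which gives
  the second one.\<close>

lemma Schwarzschild_term_close:
  assumes v: "\<bar>s * v\<bar> \<le> 1" and \<eta>_half: "\<eta> \<le> 1 / 2" and \<phi>: "1 \<le> \<phi>"
  shows "\<bar>(r * n1 + (s * v - t * w) * n3) * normal_sq / (\<phi> * sqrt (r\<^sup>2 + (s * v - t * w)\<^sup>2) ^ 3)
      - s * (1 - v * t) / sqrt (1 + (s * v)\<^sup>2) ^ 3\<bar> \<le> 10 ^ 20 * \<eta> + 2 * (\<phi> - 1)"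
proof -
  define z where "z = s * v - t * w"
  define g where "g = (r * n1 + z * n3) * normal_sq"
  define g0 where "g0 = s * (1 - v * t)"
  define f where "f = sqrt (r\<^sup>2 + z\<^sup>2)"
  define f0 where "f0 = sqrt (1 + (s * v)\<^sup>2)"
  have z: "jet 5 \<eta> z (s * v) (- t * w)"
    by (rule jetI) (simp add: z_def, use v in linarith,
        use \<eta> mult_le_eta[OF t_le w(1)] in \<open>simp only: mult_minus_left; linarith\<close>)
  note J = jet_mult[OF \<eta> jet_add[OF jet_mult[OF \<eta> base_jets(1) normal_jets(1)]
        jet_mult[OF \<eta> z normal_jets(3)]]
      jet_add[OF jet_add[OF jet_mult[OF \<eta> normal_jets(1,1)] jet_mult[OF \<eta> normal_jets(2,2)]]
        jet_mult[OF \<eta> normal_jets(3,3)]], folded normal_sq_def, folded g_def]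
  have "\<bar>g - g0\<bar> \<le> 10 ^ 18 * \<eta>"
  proof -
    obtain x0 x1 A where JA: "jet A \<eta> g x0 x1" and x0: "x0 = g0" and A: "A \<le> 10 ^ 17"
    proof (rule that[OF J], goal_cases)
      case 1
      show ?case using st unfolding g0_def by algebra
    next
      case 2
      show ?case by simp
    qed
    have "\<bar>g - g0\<bar> \<le> 2 * A * \<eta>" using jet_near_zeroth[OF \<eta> JA] by (simp add: x0)
    also have "\<dots> \<le> 10 ^ 18 * \<eta>" using A \<eta> by (intro mult_right_mono) auto
    finally show ?thesis .
  qed
  have g0: "\<bar>g0\<bar> \<le> 2"
  proof -
    have "g0 = s - s * v * t" by (simp add: g0_def algebra_simps)
    then show ?thesis using s_le abs_mult_le[OF v t_le] by linarith
  qed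
  have f0: "1 \<le> f0" by (simp add: f0_def)
  \<comment> \<open>Both roots are norms of positions that differ by \<open>w\<close> times the unit
    vector (s, -t), so the reverse triangle inequality bounds their difference by the absolute value
    of \<open>w\<close>.\<close>
  have "f = norm (r, z)" "f0 = norm (1::real, s * v)" by (simp_all add: f_def f0_def norm_Pair)
  then have "\<bar>f - f0\<bar> \<le> norm ((r, z) - (1, s * v))" using norm_triangle_ineq3 by metis
  also have "\<dots> = sqrt (w\<^sup>2 * (s\<^sup>2 + t\<^sup>2))"
    by (simp add: norm_Pair r_def z_def power_mult_distrib algebra_simps)
  also have "\<dots> = \<bar>w\<bar>" by (simp add: st)
  finally have ff0: "\<bar>f - f0\<bar> \<le> \<eta>" using w(1) by linarith
  then have f: "1 / 2 \<le> f" using f0 \<eta>_half by linarith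
  define x y where "x = 1 / f" and "y = 1 / f0"
  have x: "0 \<le> x" "x \<le> 2" using f by (simp_all add: x_def field_simps)
  have y: "0 \<le> y" "y \<le> 1" using f0 by (simp_all add: y_def field_simps)
  have "x - y = (f0 - f) * (x * y)" using f f0 by (simp add: x_def y_def field_simps)
  then have "x ^ 3 - y ^ 3 = (f0 - f) * ((x * y) * (x * x + x * y + y * y))" by algebra
  moreover have "\<bar>(f0 - f) * ((x * y) * (x * x + x * y + y * y))\<bar> \<le> \<eta> * ((2 * 1) * (2 * 2 + 2 * 1 + 1 * 1))"
  proof (rule abs_mult_le)
    have "x * y \<le> 2 * 1" "x * x \<le> 2 * 2" "y * y \<le> 1 * 1" using x y by (intro mult_mono; simp)+
    then have "(x * y) * (x * x + x * y + y * y) \<le> (2 * 1) * (2 * 2 + 2 * 1 + 1 * 1)"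
      using x y by (intro mult_mono add_mono) auto
    then show "\<bar>(x * y) * (x * x + x * y + y * y)\<bar> \<le> (2 * 1) * (2 * 2 + 2 * 1 + 1 * 1)"
      using x y by simp
  qed (use ff0 in linarith)
  ultimately have xy: "\<bar>x ^ 3 - y ^ 3\<bar> \<le> 14 * \<eta>" by simp
  have p: "0 \<le> 1 / \<phi>" "1 / \<phi> \<le> 1" "\<bar>1 / \<phi> - 1\<bar> \<le> \<phi> - 1"
  proof -
    show "0 \<le> 1 / \<phi>" "1 / \<phi> \<le> 1" using \<phi> by simp_all
    have "1 / \<phi> - 1 = - ((\<phi> - 1) * (1 / \<phi>))" using \<phi> by (simp add: field_simps)
    moreover have "\<bar>(\<phi> - 1) * (1 / \<phi>)\<bar> \<le> (\<phi> - 1) * 1" by (rule abs_mult_le) (use \<phi> in auto)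
    ultimately show "\<bar>1 / \<phi> - 1\<bar> \<le> \<phi> - 1" by simp
  qed
  have x3: "\<bar>x ^ 3\<bar> \<le> 8" using power_mono[OF x(2,1), of 3] x(1) by simp
  have y3: "\<bar>y ^ 3\<bar> \<le> 1" using power_mono[OF y(2,1), of 3] y(1) by simp
  have 1: "\<bar>(g - g0) * ((1 / \<phi>) * x ^ 3)\<bar> \<le> 10 ^ 18 * \<eta> * (1 * 8)"
    by (intro abs_mult_le x3 \<open>\<bar>g - g0\<bar> \<le> 10 ^ 18 * \<eta>\<close>) (use p in auto)
  have 2: "\<bar>g0 * ((1 / \<phi>) * (x ^ 3 - y ^ 3))\<bar> \<le> 2 * (1 * (14 * \<eta>))"
    by (intro abs_mult_le xy g0) (use p in auto)
  have 3: "\<bar>g0 * (y ^ 3 * (1 / \<phi> - 1))\<bar> \<le> 2 * (1 * (\<phi> - 1))"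
    by (intro abs_mult_le y3 g0 p)
  have "g / (\<phi> * f ^ 3) - g0 / f0 ^ 3 = g * ((1 / \<phi>) * x ^ 3) - g0 * y ^ 3"
    by (simp add: x_def y_def power_divide)
  \<comment> \<open>A telescope that replaces \<open>g\<close>, the distance and \<phi> one at a
    time.\<close>
  also have "\<dots> = (g - g0) * ((1 / \<phi>) * x ^ 3) + g0 * ((1 / \<phi>) * (x ^ 3 - y ^ 3)) + g0 * (y ^ 3 * (1 / \<phi> - 1))"
    by (simp only: algebra_simps)
  finally have eq: "g / (\<phi> * f ^ 3) - g0 / f0 ^ 3 = (g - g0) * ((1 / \<phi>) * x ^ 3)
      + g0 * ((1 / \<phi>) * (x ^ 3 - y ^ 3)) + g0 * (y ^ 3 * (1 / \<phi> - 1))" .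
  have "\<bar>g / (\<phi> * f ^ 3) - g0 / f0 ^ 3\<bar> \<le> 10 ^ 18 * \<eta> * (1 * 8) + 2 * (1 * (14 * \<eta>)) + 2 * (1 * (\<phi> - 1))"
    unfolding eq by (intro order_trans[OF abs_triangle_ineq] add_mono 1 2 3)
  then have "\<bar>g / (\<phi> * f ^ 3) - g0 / f0 ^ 3\<bar> \<le> 10 ^ 20 * \<eta> + 2 * (\<phi> - 1)"
    using conjunct1[OF \<eta>] by simp
  then show ?thesis by (simp only: g_def g0_def f_def f0_def z_def)
qed

end

section \<open>Effect of the metric perturbation\<close>

lemma abs_matrix_form_le:
  fixes A :: "real^3^3"
  assumes "\<And>i j. \<bar>A $ i $ j\<bar> \<le> k"
  shows "\<bar>x \<bullet> (A *v y)\<bar> \<le> 9 * k * (norm x * norm y)"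
proof -
  have "x \<bullet> (A *v y) = (\<Sum>i\<in>UNIV. \<Sum>j\<in>UNIV. A $ i $ j * (x $ i * y $ j))"
    by (simp add: inner_vec_def matrix_vector_mult_def sum_distrib_left algebra_simps)
  also have "\<bar>\<dots>\<bar> \<le> (\<Sum>i\<in>(UNIV::3 set). \<Sum>j\<in>(UNIV::3 set). k * (norm x * norm y))"
    by (intro order_trans[OF sum_abs] sum_mono abs_mult_le assms component_le_norm_cart)
  finally show ?thesis by simp
qed

text \<open>The bilinear bound with \<open>A *v y\<close> as first argument, after cancelling one
  factor of its norm.\<close>

lemma norm_matrix_vector_le:
  fixes A :: "real^3^3"
  assumes "\<And>i j. \<bar>A $ i $ j\<bar> \<le> k"
  shows "norm (A *v y) \<le> 9 * k * norm y"
proof (cases "norm (A *v y) = 0")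
  case True
  moreover have "0 \<le> k" using assms[of 1 1] by linarith
  ultimately show ?thesis by simp
next
  case False
  have "norm (A *v y) * norm (A *v y) \<le> norm (A *v y) * (9 * k * norm y)"
    using abs_matrix_form_le[of A k "A *v y" y, OF assms]
    by (simp add: power2_norm_eq_inner[symmetric] power2_eq_square algebra_simps)
  then show ?thesis using False by (simp add: mult_le_cancel_left)
qed

lemma abs_trilinear_le:
  fixes x y z :: "real^3"
  assumes "\<And>l i j. \<bar>\<Gamma> l i j\<bar> \<le> k"
  shows "\<bar>\<Sum>l\<in>UNIV. \<Sum>i\<in>UNIV. \<Sum>j\<in>UNIV. \<Gamma> l i j * x $ i * y $ j * z $ l\<bar>
    \<le> 27 * (k * norm x * norm y * norm z)"
proof -
  have "\<bar>\<Sum>l\<in>UNIV. \<Sum>i\<in>UNIV. \<Sum>j\<in>UNIV. \<Gamma> l i j * x $ i * y $ j * z $ l\<bar>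
    \<le> (\<Sum>l\<in>(UNIV::3 set). \<Sum>i\<in>(UNIV::3 set). \<Sum>j\<in>(UNIV::3 set). k * norm x * norm y * norm z)"
    by (intro order_trans[OF sum_abs] sum_mono abs_mult_le assms component_le_norm_cart)
  then show ?thesis by simp
qed

lemma abs_inner_le:
  fixes x y :: "real^3"
  assumes "norm x \<le> A" "norm y \<le> B"
  shows "\<bar>x \<bullet> y\<bar> \<le> A * B"
proof -
  have "norm x * norm y \<le> A * B" using assms by (intro mult_mono) (auto intro: order_trans[OF norm_ge_zero])
  then show ?thesis using Cauchy_Schwarz_ineq2[of x y] by linarith
qed

text \<open>
  The ambient metric is \<open>\<psi> \<delta> + e\<close>, with \<open>q\<close> the gradient of \<open>\<psi>\<close> and \<open>\<Gamma>\<close> the Christoffel symbols of \<open>e\<close>; \<open>a, b\<close> are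
  the tangent vectors, \<open>N\<close> a Euclidean normal and \<open>\<nu>\<close> the vector dual to \<open>N\<close>. All lengths are measured in units
  of \<open>c cosh v\<close>.
\<close>

locale perturbed_normal =
  fixes a b N \<nu> q :: "real^3" and e :: "real^3^3" and \<Gamma> :: "3 \<Rightarrow> 3 \<Rightarrow> 3 \<Rightarrow> real" and \<psi> \<kappa> :: real
  assumes \<kappa>: "0 \<le> \<kappa>" "\<kappa> \<le> 1 / 18" and \<psi>: "1 \<le> \<psi>"
    and e: "\<And>i j. \<bar>e $ i $ j\<bar> \<le> \<kappa>" and \<Gamma>: "\<And>l i j. \<bar>\<Gamma> l i j\<bar> \<le> 2 * \<kappa>"
    and norms: "norm a \<le> 8" "norm b \<le> 8" "norm N \<le> 64" "norm q \<le> 64"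
    and aN: "a \<bullet> N = 0" and bN: "b \<bullet> N = 0" and \<nu>: "\<psi> *\<^sub>R \<nu> + e *v \<nu> = N"
begin

definition "metric_entry x y = \<psi> * (x \<bullet> y) + x \<bullet> (e *v y)"

text \<open>Since \<nu> is dual to \<open>N\<close>, the metric product of \<open>P\<close> with
  \<nu> is exactly \<open>P \<bullet> N\<close>. The quotient by 2 is the Christoffel contribution
  of the conformal part.\<close>

definition "sff_entry P x y = P \<bullet> N + ((q \<bullet> x) * (y \<bullet> \<nu>) + (q \<bullet> y) * (x \<bullet> \<nu>) - (q \<bullet> \<nu>) * (x \<bullet> y)) / 2
    + (\<Sum>l\<in>UNIV. \<Sum>i\<in>UNIV. \<Sum>j\<in>UNIV. \<Gamma> l i j * x $ i * y $ j * \<nu> $ l)"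

text \<open>What is left after duality rewrites \<psi> (q . \<nu>) as q . N - q . (e \<nu>). For
  tangent \<open>x\<close>, \<open>y\<close> it vanishes when \<open>e\<close> and \<Gamma> do,
  since then \<nu> is parallel to \<open>N\<close>.\<close>

definition "sff_error x y = ((q \<bullet> x) * (y \<bullet> \<nu>) + (q \<bullet> y) * (x \<bullet> \<nu>)) / 2 + (q \<bullet> (e *v \<nu>)) * (x \<bullet> y) / (2 * \<psi>)
    + (\<Sum>l\<in>UNIV. \<Sum>i\<in>UNIV. \<Sum>j\<in>UNIV. \<Gamma> l i j * x $ i * y $ j * \<nu> $ l)"

lemma sff_entry_eq: "sff_entry P x y = P \<bullet> N - (q \<bullet> N) / (2 * \<psi>) * (x \<bullet> y) + sff_error x y"
proof -
  have "q \<bullet> N = \<psi> * (q \<bullet> \<nu>) + q \<bullet> (e *v \<nu>)"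
    unfolding \<nu>[symmetric] by (simp add: inner_add_right)
  then show ?thesis using \<psi> by (simp add: sff_entry_def sff_error_def field_simps)
qed

text \<open>The smallness of \<kappa> is used here: the \<open>e\<close>-term is at most half of the
  norm of \<nu> and is absorbed, leaving twice the bound for \<open>N\<close>.\<close>

lemma norm_nu: "norm \<nu> \<le> 128"
proof -
  have "norm (\<psi> *\<^sub>R \<nu>) \<le> norm N + norm (e *v \<nu>)"
    unfolding \<nu>[symmetric] using norm_triangle_ineq4[of "\<psi> *\<^sub>R \<nu> + e *v \<nu>" "e *v \<nu>"] by simp
  moreover have "norm (e *v \<nu>) \<le> 9 * \<kappa> * norm \<nu>" by (rule norm_matrix_vector_le) (rule e)
  moreover have "9 * \<kappa> * norm \<nu> \<le> 1 / 2 * norm \<nu>" using \<kappa> by (intro mult_right_mono) auto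
  moreover have "1 * norm \<nu> \<le> norm (\<psi> *\<^sub>R \<nu>)" unfolding norm_scaleR using \<psi> by (intro mult_right_mono) auto
  ultimately show ?thesis using norms(3) by linarith
qed

lemma norm_e_nu: "norm (e *v \<nu>) \<le> 1152 * \<kappa>"
proof -
  have "norm (e *v \<nu>) \<le> 9 * \<kappa> * norm \<nu>" by (rule norm_matrix_vector_le) (rule e)
  also have "\<dots> \<le> 9 * \<kappa> * 128" using norm_nu \<kappa> by (intro mult_left_mono) auto
  finally show ?thesis by simp
qed

lemma tangent_inner_nu:
  assumes "norm x \<le> 8" "x \<bullet> N = 0"
  shows "\<bar>x \<bullet> \<nu>\<bar> \<le> 9216 * \<kappa>"
proof -
  have "\<psi> * (x \<bullet> \<nu>) = - (x \<bullet> (e *v \<nu>))"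
    using assms(2) unfolding \<nu>[symmetric] by (simp add: inner_add_right)
  then have "\<bar>\<psi>\<bar> * \<bar>x \<bullet> \<nu>\<bar> = \<bar>x \<bullet> (e *v \<nu>)\<bar>" by (simp flip: abs_mult)
  also have "\<dots> \<le> 8 * (1152 * \<kappa>)" by (rule abs_inner_le[OF assms(1) norm_e_nu])
  finally have "\<bar>\<psi>\<bar> * \<bar>x \<bullet> \<nu>\<bar> \<le> 9216 * \<kappa>" by simp
  moreover have "1 * \<bar>x \<bullet> \<nu>\<bar> \<le> \<bar>\<psi>\<bar> * \<bar>x \<bullet> \<nu>\<bar>" using \<psi> by (intro mult_right_mono) auto
  ultimately show ?thesis by linarith
qed

lemma abs_sff_error_le:
  assumes "norm x \<le> 8" "x \<bullet> N = 0" "norm y \<le> 8" "y \<bullet> N = 0"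
  shows "\<bar>sff_error x y\<bar> \<le> 10000000 * \<kappa>"
proof -
  have 1: "\<bar>(q \<bullet> x) * (y \<bullet> \<nu>)\<bar> \<le> 64 * 8 * (9216 * \<kappa>)" "\<bar>(q \<bullet> y) * (x \<bullet> \<nu>)\<bar> \<le> 64 * 8 * (9216 * \<kappa>)"
    by (intro abs_mult_le abs_inner_le norms assms tangent_inner_nu)+
  have "\<bar>(q \<bullet> (e *v \<nu>)) * (x \<bullet> y) * (1 / (2 * \<psi>))\<bar> \<le> 64 * (1152 * \<kappa>) * (8 * 8) * (1 / 2)"
    by (intro abs_mult_le abs_inner_le norms assms norm_e_nu) (use \<psi> in \<open>simp add: field_simps\<close>)
  then have 2: "\<bar>(q \<bullet> (e *v \<nu>)) * (x \<bullet> y) / (2 * \<psi>)\<bar> \<le> 2359296 * \<kappa>" by simp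
  have "\<bar>\<Sum>l\<in>UNIV. \<Sum>i\<in>UNIV. \<Sum>j\<in>UNIV. \<Gamma> l i j * x $ i * y $ j * \<nu> $ l\<bar>
      \<le> 27 * (2 * \<kappa> * norm x * norm y * norm \<nu>)"
    by (rule abs_trilinear_le) (rule \<Gamma>)
  also have "\<dots> \<le> 27 * (2 * \<kappa> * 8 * 8 * 128)"
    using \<kappa> by (intro mult_left_mono mult_mono assms norm_nu) auto
  finally have 3: "\<bar>\<Sum>l\<in>UNIV. \<Sum>i\<in>UNIV. \<Sum>j\<in>UNIV. \<Gamma> l i j * x $ i * y $ j * \<nu> $ l\<bar> \<le> 442368 * \<kappa>" by simp
  have "\<bar>(x1 + x2) / 2 + x3 + x4\<bar> \<le> 10000000 * \<kappa>"
    if "\<bar>x1\<bar> \<le> 64 * 8 * (9216 * \<kappa>)" "\<bar>x2\<bar> \<le> 64 * 8 * (9216 * \<kappa>)" "\<bar>x3\<bar> \<le> 2359296 * \<kappa>"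
      "\<bar>x4\<bar> \<le> 442368 * \<kappa>" for x1 x2 x3 x4
  proof -
    have eq: "(x1 + x2) / 2 + x3 + x4 = (x1 + x2 + 2 * x3 + 2 * x4) / 2" by simp
    have "\<bar>x1 + x2 + 2 * x3 + 2 * x4\<bar> \<le> 20000000 * \<kappa>" using that \<kappa>(1) by linarith
    then have "\<bar>x1 + x2 + 2 * x3 + 2 * x4\<bar> / 2 \<le> 20000000 * \<kappa> / 2" by (rule divide_right_mono) simp
    also have "\<dots> = 10000000 * \<kappa>" by simp
    finally show ?thesis unfolding eq abs_divide abs_numeral .
  qed
  from this[OF 1 2 3] show ?thesis unfolding sff_error_def .
qed

text \<open>The vanishing numerator splits as \<psi> (X + E) + H. Here \<open>X\<close> is the
  Euclidean numerator with the conformal correction, whose trace is 2 \<mu> times the determinant;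
  \<open>E\<close> collects the errors of the second fundamental form and \<open>H\<close> those of
  the induced metric. Dividing by \<psi>, which is at least 1, loses nothing.\<close>

lemma numerator_bound:
  assumes P: "norm P11 \<le> 8" "norm P12 \<le> 8" "norm P22 \<le> 8"
    and zero: "metric_entry b b * sff_entry P11 a a - metric_entry a b * sff_entry P12 b a
      - metric_entry b a * sff_entry P12 a b + metric_entry a a * sff_entry P22 b b = 0"
  shows "\<bar>(b \<bullet> b) * (P11 \<bullet> N) - 2 * (a \<bullet> b) * (P12 \<bullet> N) + (a \<bullet> a) * (P22 \<bullet> N)
      - (q \<bullet> N) / \<psi> * ((a \<bullet> a) * (b \<bullet> b) - (a \<bullet> b)\<^sup>2)\<bar> \<le> 1000000000000 * \<kappa>"
proof -
  define \<mu> where "\<mu> = - ((q \<bullet> N) / (2 * \<psi>))"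
  define \<epsilon> where "\<epsilon> x y = x \<bullet> (e *v y)" for x y
  have \<epsilon>: "\<bar>\<epsilon> x y\<bar> \<le> 576 * \<kappa>" if "norm x \<le> 8" "norm y \<le> 8" for x y
  proof -
    have "\<bar>\<epsilon> x y\<bar> \<le> 9 * \<kappa> * (norm x * norm y)" unfolding \<epsilon>_def by (rule abs_matrix_form_le) (rule e)
    also have "\<dots> \<le> 9 * \<kappa> * (8 * 8)" using \<kappa> that by (intro mult_left_mono mult_mono) auto
    finally show ?thesis by simp
  qed
  have \<mu>: "\<bar>\<mu>\<bar> \<le> 2048"
  proof -
    have "\<bar>(q \<bullet> N) * (1 / (2 * \<psi>))\<bar> \<le> 64 * 64 * (1 / 2)"
      by (intro abs_mult_le abs_inner_le norms) (use \<psi> in \<open>simp add: field_simps\<close>)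
    then show ?thesis by (simp add: \<mu>_def)
  qed
  have II: "sff_entry P x y = P \<bullet> N + \<mu> * (x \<bullet> y) + sff_error x y" for P x y
    by (simp add: sff_entry_eq \<mu>_def)
  have II_le: "\<bar>sff_entry P x y\<bar> \<le> 1000000"
    if "norm P \<le> 8" "norm x \<le> 8" "x \<bullet> N = 0" "norm y \<le> 8" "y \<bullet> N = 0" for P x y
  proof -
    have "\<bar>P \<bullet> N\<bar> \<le> 8 * 64" "\<bar>\<mu> * (x \<bullet> y)\<bar> \<le> 2048 * (8 * 8)" "\<bar>sff_error x y\<bar> \<le> 10000000 * \<kappa>"
      by (intro abs_mult_le abs_inner_le norms that \<mu> abs_sff_error_le)+
    then show ?thesis unfolding II using \<kappa>(2) by linarith
  qed
  note ta = norms(1) aN and tb = norms(2) bN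
  define E where "E = (b \<bullet> b) * sff_error a a - (a \<bullet> b) * sff_error b a - (a \<bullet> b) * sff_error a b
      + (a \<bullet> a) * sff_error b b"
  define H where "H = \<epsilon> b b * sff_entry P11 a a - \<epsilon> a b * sff_entry P12 b a
      - \<epsilon> b a * sff_entry P12 a b + \<epsilon> a a * sff_entry P22 b b"
  have E: "\<bar>E\<bar> \<le> 4 * (64 * (10000000 * \<kappa>))"
  proof -
    have "\<bar>(b \<bullet> b) * sff_error a a\<bar> \<le> 8 * 8 * (10000000 * \<kappa>)" "\<bar>(a \<bullet> b) * sff_error b a\<bar> \<le> 8 * 8 * (10000000 * \<kappa>)"
      "\<bar>(a \<bullet> b) * sff_error a b\<bar> \<le> 8 * 8 * (10000000 * \<kappa>)" "\<bar>(a \<bullet> a) * sff_error b b\<bar> \<le> 8 * 8 * (10000000 * \<kappa>)"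
      by (intro abs_mult_le abs_inner_le abs_sff_error_le ta tb)+
    then show ?thesis unfolding E_def by linarith
  qed
  have H: "\<bar>H\<bar> \<le> 4 * (576 * \<kappa> * 1000000)"
  proof -
    have "\<bar>\<epsilon> b b * sff_entry P11 a a\<bar> \<le> 576 * \<kappa> * 1000000" "\<bar>\<epsilon> a b * sff_entry P12 b a\<bar> \<le> 576 * \<kappa> * 1000000"
      "\<bar>\<epsilon> b a * sff_entry P12 a b\<bar> \<le> 576 * \<kappa> * 1000000" "\<bar>\<epsilon> a a * sff_entry P22 b b\<bar> \<le> 576 * \<kappa> * 1000000"
      by (intro abs_mult_le \<epsilon> II_le ta tb P)+
    then show ?thesis unfolding H_def by linarith
  qed
  define X where "X = (b \<bullet> b) * (P11 \<bullet> N) - 2 * (a \<bullet> b) * (P12 \<bullet> N) + (a \<bullet> a) * (P22 \<bullet> N)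
      + 2 * \<mu> * ((a \<bullet> a) * (b \<bullet> b) - (a \<bullet> b)\<^sup>2)"
  have "\<psi> * (X + E) + H = 0"
    unfolding zero[symmetric] X_def E_def H_def metric_entry_def II \<epsilon>_def
      inner_commute[of b a] power2_eq_square by algebra
  then have "X = - E - (1 / \<psi>) * H" using \<psi> by (simp add: field_simps)
  moreover have "\<bar>(1 / \<psi>) * H\<bar> \<le> 1 * (4 * (576 * \<kappa> * 1000000))"
    by (rule abs_mult_le[OF _ H]) (use \<psi> in simp)
  ultimately have "\<bar>X\<bar> \<le> 1000000000000 * \<kappa>" using E \<kappa>(1) by linarith
  then show ?thesis by (simp add: X_def \<mu>_def)
qed

end

section \<open>The averaged Jacobi equation\<close>

text \<open>Up to the factor c, the normal component of the position vector on the catenoid of neck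
  c.\<close>

definition dilation_Jacobi :: "real \<Rightarrow> real" where
  "dilation_Jacobi v = 1 - v * tanh v"

definition Schwarzschild_source :: "real \<Rightarrow> real" where
  "Schwarzschild_source v = dilation_Jacobi v / cosh v / sqrt (1 + (v / cosh v)\<^sup>2) ^ 3"

section \<open>Elementary bounds for the Jacobi function and the source\<close>

lemma abs_tanh_le_1: "\<bar>tanh (v::real)\<bar> \<le> 1"
  using tanh_real_bounds[of v] by auto

lemma exp_abs_le_2_cosh: "exp \<bar>v\<bar> \<le> 2 * cosh (v::real)"
  by (cases "v \<ge> 0") (auto simp: cosh_def)

lemma abs_le_cosh: "\<bar>v\<bar> \<le> cosh (v::real)"
proof -
  have "(1 + \<bar>v\<bar> / 2) ^ 2 \<le> exp \<bar>v\<bar>"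
    using exp_ge_one_plus_x_over_n_power_n[of 2 "\<bar>v\<bar>"] by simp
  moreover have "2 * \<bar>v\<bar> \<le> (1 + \<bar>v\<bar> / 2) ^ 2"
    using zero_le_power2[of "1 - \<bar>v\<bar> / 2"] by (simp add: power2_eq_square algebra_simps)
  ultimately show ?thesis using exp_abs_le_2_cosh[of v] by linarith
qed

lemma abs_dilation_Jacobi_le: "\<bar>dilation_Jacobi v\<bar> \<le> 1 + \<bar>v\<bar>"
proof -
  have "\<bar>v * tanh v\<bar> \<le> \<bar>v\<bar> * 1" unfolding abs_mult by (intro mult_left_mono abs_tanh_le_1) simp
  then show ?thesis unfolding dilation_Jacobi_def by linarith
qed

lemma growth_over_cosh_le_exp:
  fixes v :: real
  shows "(1 + \<bar>v\<bar>) / cosh v \<le> 4 * exp (- (\<bar>v\<bar> / 2))"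
proof -
  have "1 + \<bar>v\<bar> / 2 \<le> exp (\<bar>v\<bar> / 2)" by (rule exp_ge_add_one_self)
  then have "1 + \<bar>v\<bar> \<le> 2 * exp (\<bar>v\<bar> / 2)" by linarith
  also have "\<dots> = 2 * (exp \<bar>v\<bar> * exp (- (\<bar>v\<bar> / 2)))" by (simp flip: exp_add)
  also have "\<dots> \<le> 2 * (2 * cosh v * exp (- (\<bar>v\<bar> / 2)))"
    by (intro mult_left_mono mult_right_mono exp_abs_le_2_cosh) auto
  finally show ?thesis by (simp add: pos_divide_le_eq cosh_real_pos mult_ac)
qed

text \<open>The majorant is chosen for its explicit bounded primitive, a multiple of arctan. The
  constant is 2 * 27, from (1 + x) (1 + x^2) \<le> 27 (1 + x / 3)^3 \<le> 27 exp x.\<close>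

lemma growth_over_cosh_le_rational:
  fixes v :: real
  shows "(1 + \<bar>v\<bar>) / cosh v \<le> 54 / (1 + v\<^sup>2)"
proof -
  define x where "x = \<bar>v\<bar>"
  have x: "0 \<le> x" "v\<^sup>2 = x\<^sup>2" by (auto simp: x_def)
  have "(1 + x) * (1 + x\<^sup>2) \<le> (3 * (1 + x / 3)) * (9 * (1 + x / 3)\<^sup>2)"
    using x by (intro mult_mono) (auto simp: power2_eq_square algebra_simps)
  also have "\<dots> = 27 * (1 + x / 3) ^ 3" by algebra
  also have "\<dots> \<le> 27 * exp x"
    using exp_ge_one_plus_x_over_n_power_n[of 3 x] x by simp
  also have "\<dots> \<le> 27 * (2 * cosh v)" unfolding x_def by (intro mult_left_mono exp_abs_le_2_cosh) auto
  finally have "(1 + x) * (1 + v\<^sup>2) \<le> 54 * cosh v" by (simp add: x)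
  moreover have "0 < 1 + v\<^sup>2" by (simp add: add_pos_nonneg)
  ultimately show ?thesis unfolding x_def[symmetric]
    by (simp add: divide_simps cosh_real_pos)
qed

lemma abs_source_le: "\<bar>Schwarzschild_source v\<bar> \<le> (1 + \<bar>v\<bar>) / cosh v"
proof -
  have "1 ^ 3 \<le> sqrt (1 + (v / cosh v)\<^sup>2) ^ 3" by (intro power_mono) auto
  then have "\<bar>dilation_Jacobi v / cosh v\<bar> / sqrt (1 + (v / cosh v)\<^sup>2) ^ 3 \<le> \<bar>dilation_Jacobi v / cosh v\<bar> / 1"
    by (intro divide_left_mono) (auto simp: add_pos_nonneg)
  also have "\<dots> \<le> (1 + \<bar>v\<bar>) / cosh v"
    using abs_dilation_Jacobi_le[of v] cosh_real_pos[of v] by (simp add: abs_divide divide_right_mono)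
  finally show ?thesis by (simp add: Schwarzschild_source_def abs_divide)
qed

lemma Jacobi_times_source_nonneg: "0 \<le> dilation_Jacobi v * Schwarzschild_source v"
proof -
  have "dilation_Jacobi v * Schwarzschild_source v = (dilation_Jacobi v)\<^sup>2 / cosh v / sqrt (1 + (v / cosh v)\<^sup>2) ^ 3"
    by (simp add: Schwarzschild_source_def power2_eq_square)
  then show ?thesis using cosh_real_pos[of v] by simp
qed

text \<open>Near the neck the Jacobi function is at least 1/2 while cosh and the square root are at
  most 2, so the product is at least (1/2)^2 / 2 / 2^3. This is the quantitative part of the
  pairing.\<close>

lemma Jacobi_times_source_ge:
  assumes "\<bar>v\<bar> \<le> 1 / 2"
  shows "1 / 64 \<le> dilation_Jacobi v * Schwarzschild_source v"
proof -
  have "\<bar>v * tanh v\<bar> \<le> 1 / 2 * 1" unfolding abs_mult by (intro mult_mono assms abs_tanh_le_1) auto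
  then have \<phi>: "1 / 2 \<le> dilation_Jacobi v" unfolding dilation_Jacobi_def by linarith
  then have \<phi>2: "(1 / 2)\<^sup>2 \<le> (dilation_Jacobi v)\<^sup>2" by (intro power_mono) auto
  have "exp v \<le> exp (1 / 2)" "exp (- v) \<le> exp (1 / 2)" using assms by auto
  moreover have "exp (1 / 2) \<le> (2::real)" using exp_bound_half[of "1/2::real"] by simp
  ultimately have "exp v + exp (- v) \<le> 4" by linarith
  then have c2: "cosh v \<le> 2" by (simp add: cosh_def)
  have "\<bar>v / cosh v\<bar> \<le> 1" using abs_le_cosh[of v] cosh_real_pos[of v] by (simp add: abs_divide)
  then have "(v / cosh v)\<^sup>2 \<le> 1" by (simp add: abs_square_le_1)
  then have "sqrt (1 + (v / cosh v)\<^sup>2) \<le> 2" by (intro real_le_lsqrt) auto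
  then have s3: "sqrt (1 + (v / cosh v)\<^sup>2) ^ 3 \<le> 2 ^ 3" by (intro power_mono) auto
  have s0: "0 < sqrt (1 + (v / cosh v)\<^sup>2) ^ 3" by (simp add: add_pos_nonneg)
  have "1 / 64 = (1 / 2 :: real)\<^sup>2 / 2 / 2 ^ 3" by (simp add: power2_eq_square)
  also have "\<dots> \<le> (dilation_Jacobi v)\<^sup>2 / cosh v / sqrt (1 + (v / cosh v)\<^sup>2) ^ 3"
    using \<phi>2 c2 s3 s0 cosh_real_pos[of v] by (intro frac_le) auto
  also have "\<dots> = dilation_Jacobi v * Schwarzschild_source v"
    by (simp add: Schwarzschild_source_def power2_eq_square)
  finally show ?thesis .
qed

text \<open>Adding 2 A exp(-v/2) to the derivative \<open>w1\<close> makes it nonincreasing. If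
  \<open>w1\<close> ever undershot the bound by \<open>h\<close>, it would stay below -h, and
  \<open>w\<close> would descend linearly instead of tending to 0.\<close>

lemma derivative_lower_bound_of_decay:
  fixes w w1 w2 :: "real \<Rightarrow> real"
  assumes w: "\<And>v. (w has_real_derivative w1 v) (at v)" "\<And>v. (w1 has_real_derivative w2 v) (at v)"
    and lim: "(w \<longlongrightarrow> 0) at_top" and bound: "\<And>v. 0 \<le> v \<Longrightarrow> w2 v \<le> A * exp (- (v / 2))"
    and A: "0 \<le> A" and V: "0 \<le> V"
  shows "- 2 * A * exp (- (V / 2)) \<le> w1 V"
proof (rule ccontr)
  assume neg: "\<not> ?thesis"
  define h where "h = - w1 V - 2 * A * exp (- (V / 2))"
  have h: "0 < h" using neg by (simp add: h_def)
  have w1: "w1 v \<le> - h" if "V \<le> v" for v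
  proof -
    have "w1 v + 2 * A * exp (- (v / 2)) \<le> w1 V + 2 * A * exp (- (V / 2))"
    proof (rule DERIV_nonpos_imp_nonincreasing[OF that])
      fix x assume "V \<le> x" "x \<le> v"
      then have "w2 x - A * exp (- (x / 2)) \<le> 0" using bound[of x] V by simp
      moreover have "((\<lambda>v. w1 v + 2 * A * exp (- (v / 2))) has_real_derivative w2 x - A * exp (- (x / 2))) (at x)"
        by (auto intro!: derivative_eq_intros w)
      ultimately show "\<exists>y. ((\<lambda>v. w1 v + 2 * A * exp (- (v / 2))) has_real_derivative y) (at x) \<and> y \<le> 0"
        by blast
    qed
    then show ?thesis using A by (simp add: h_def) (smt (verit) exp_ge_zero mult_nonneg_nonneg)
  qed
  have wv: "w v \<le> w V - h * (v - V)" if "V \<le> v" for v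
  proof -
    have "w v + h * v \<le> w V + h * V"
    proof (rule DERIV_nonpos_imp_nonincreasing[OF that])
      fix x assume "V \<le> x" "x \<le> v"
      moreover have "((\<lambda>v. w v + h * v) has_real_derivative w1 x + h) (at x)"
        by (auto intro!: derivative_eq_intros w)
      ultimately show "\<exists>y. ((\<lambda>v. w v + h * v) has_real_derivative y) (at x) \<and> y \<le> 0"
        using w1[of x] by fastforce
    qed
    then show ?thesis by (simp add: algebra_simps)
  qed
  have "eventually (\<lambda>v. \<bar>w v\<bar> < 1) at_top"
    using tendstoD[OF lim, of 1] by simp
  \<comment> \<open>From this point on the linear descent has brought \<open>w\<close> down to -2 or
    below, against the absolute value being less than 1.\<close>
  moreover have "eventually (\<lambda>v. V + (\<bar>w V\<bar> + 2) / h \<le> v) at_top" by (rule eventually_ge_at_top)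
  ultimately have "eventually (\<lambda>v. \<bar>w v\<bar> < 1 \<and> V + (\<bar>w V\<bar> + 2) / h \<le> v) at_top"
    by (rule eventually_conj)
  then obtain v where v: "\<bar>w v\<bar> < 1" "V + (\<bar>w V\<bar> + 2) / h \<le> v"
    using eventually_happens'[OF trivial_limit_at_top_linorder] by blast
  have "0 \<le> (\<bar>w V\<bar> + 2) / h" using h by simp
  then have "V \<le> v" using v by linarith
  moreover have "h * ((\<bar>w V\<bar> + 2) / h) \<le> h * (v - V)" using v h by (intro mult_left_mono) auto
  then have "\<bar>w V\<bar> + 2 \<le> h * (v - V)" using h by simp
  ultimately show False using wv[of v] v(1) by linarith
qed

lemma abs_derivative_decay:
  fixes w w1 w2 :: "real \<Rightarrow> real"
  assumes w: "\<And>v. (w has_real_derivative w1 v) (at v)" "\<And>v. (w1 has_real_derivative w2 v) (at v)"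
    and lim: "(w \<longlongrightarrow> 0) at_top" and bound: "\<And>v. 0 \<le> v \<Longrightarrow> \<bar>w2 v\<bar> \<le> A * exp (- (v / 2))"
    and A: "0 \<le> A" and V: "0 \<le> V"
  shows "\<bar>w1 V\<bar> \<le> 2 * A * exp (- (V / 2))"
proof -
  have "- 2 * A * exp (- (V / 2)) \<le> w1 V"
    by (rule derivative_lower_bound_of_decay[OF w lim _ A V]) (use bound in force)
  moreover have "- 2 * A * exp (- (V / 2)) \<le> - w1 V"
    by (rule derivative_lower_bound_of_decay[where w = "\<lambda>v. - w v" and ?w2.0 = "\<lambda>v. - w2 v" and ?w1.0 = "\<lambda>v. - w1 v", OF _ _ _ _ A V])
      (use bound in \<open>force intro!: derivative_eq_intros w tendsto_eq_intros lim\<close>)+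
  ultimately show ?thesis by linarith
qed

lemma dilation_Jacobi_derivs:
  "(dilation_Jacobi has_real_derivative - tanh v - v / (cosh v)\<^sup>2) (at v)"
  "((\<lambda>v. - tanh v - v / (cosh v)\<^sup>2) has_real_derivative - 2 * dilation_Jacobi v / (cosh v)\<^sup>2) (at v)"
proof -
  have c: "cosh v \<noteq> 0" using cosh_real_pos[of v] by simp
  have t: "1 - (tanh v)\<^sup>2 = 1 / (cosh v)\<^sup>2"
    using hyperbolic_pythagoras[of v] c by (simp add: tanh_def power_divide eq_divide_eq left_diff_distrib)
  show "(dilation_Jacobi has_real_derivative - tanh v - v / (cosh v)\<^sup>2) (at v)"
    unfolding dilation_Jacobi_def[abs_def]
    by (auto intro!: derivative_eq_intros simp: c t)
  have "((\<lambda>v. - tanh v - v / (cosh v)\<^sup>2) has_real_derivative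
      - (1 - (tanh v)\<^sup>2) - (1 * (cosh v)\<^sup>2 - v * (2 * cosh v * sinh v)) / ((cosh v)\<^sup>2 * (cosh v)\<^sup>2)) (at v)"
    by (auto intro!: derivative_eq_intros simp: c)
  also have "- (1 - (tanh v)\<^sup>2) - (1 * (cosh v)\<^sup>2 - v * (2 * cosh v * sinh v)) / ((cosh v)\<^sup>2 * (cosh v)\<^sup>2)
      = - 2 * dilation_Jacobi v / (cosh v)\<^sup>2"
    unfolding t unfolding dilation_Jacobi_def tanh_def using c by (simp add: field_simps power2_eq_square)
  finally show "((\<lambda>v. - tanh v - v / (cosh v)\<^sup>2) has_real_derivative - 2 * dilation_Jacobi v / (cosh v)\<^sup>2) (at v)" .
qed

lemma abs_dilation_Jacobi_deriv_le:
  fixes v :: real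
  shows "\<bar>- tanh v - v / (cosh v)\<^sup>2\<bar> \<le> 2"
proof -
  have "\<bar>v\<bar> * 1 \<le> cosh v * cosh v" using abs_le_cosh[of v] cosh_real_ge_1[of v] by (intro mult_mono) auto
  then have "\<bar>v / (cosh v)\<^sup>2\<bar> \<le> 1" using cosh_real_pos[of v]
    by (simp add: abs_divide power2_eq_square)
  then show ?thesis using abs_tanh_le_1[of v] by linarith
qed

text \<open>The Jacobi function grows linearly, so the decay of \<open>w\<close> alone does not
  suffice: its product with \<open>w1\<close> needs the exponential decay of
  \<open>abs_derivative_decay\<close>. In the other product the derivative of the Jacobi function is
  bounded by 2, and there the decay of \<open>w\<close> is enough.\<close>

lemma Wronskian_tendsto_0:
  fixes w w1 w2 :: "real \<Rightarrow> real"
  assumes w: "\<And>v. (w has_real_derivative w1 v) (at v)" "\<And>v. (w1 has_real_derivative w2 v) (at v)"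
    and lim: "(w \<longlongrightarrow> 0) at_top" and bound: "\<And>v. 0 \<le> v \<Longrightarrow> \<bar>w2 v\<bar> \<le> A * exp (- (v / 2))"
    and A: "0 \<le> A"
  shows "((\<lambda>v. dilation_Jacobi v * w1 v - (- tanh v - v / (cosh v)\<^sup>2) * w v) \<longlongrightarrow> 0) at_top"
proof (rule Lim_null_comparison)
  show "eventually (\<lambda>v. norm (dilation_Jacobi v * w1 v - (- tanh v - v / (cosh v)\<^sup>2) * w v)
      \<le> 2 * A * ((1 + v) * exp (- (v / 2))) + 2 * \<bar>w v\<bar>) at_top"
    using eventually_ge_at_top[of 0]
  proof eventually_elim
    case (elim v)
    have "\<bar>dilation_Jacobi v * w1 v\<bar> \<le> (1 + \<bar>v\<bar>) * (2 * A * exp (- (v / 2)))"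
      unfolding abs_mult
      by (intro mult_mono abs_dilation_Jacobi_le abs_derivative_decay[OF w lim bound A elim]) auto
    moreover have "\<bar>(- tanh v - v / (cosh v)\<^sup>2) * w v\<bar> \<le> 2 * \<bar>w v\<bar>"
      unfolding abs_mult by (intro mult_right_mono abs_dilation_Jacobi_deriv_le) auto
    moreover have "(1 + \<bar>v\<bar>) * (2 * A * exp (- (v / 2))) = 2 * A * ((1 + v) * exp (- (v / 2)))"
      using elim by simp
    ultimately show ?case unfolding real_norm_def by linarith
  qed
  have "((\<lambda>v::real. (1 + v) * exp (- (v / 2))) \<longlongrightarrow> 0) at_top" 
  proof (rule Lim_null_comparison)
    show "eventually (\<lambda>v::real. norm ((1 + v) * exp (- (v / 2))) \<le> 4 * exp (- (v / 4))) at_top"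
      using eventually_ge_at_top[of 0]
    proof eventually_elim
      case (elim v)
      \<comment> \<open>Half of the exponential rate is spent on the linear growth.\<close>
      have "1 + v \<le> 4 * exp (v / 4)" using exp_ge_add_one_self[of "v / 4"] elim by linarith
      then have "(1 + v) * exp (- (v / 2)) \<le> 4 * exp (v / 4) * exp (- (v / 2))" by (rule mult_right_mono) simp
      also have "\<dots> = 4 * exp (- (v / 4))" by (simp flip: exp_add)
      finally show ?case using elim by simp
    qed
    have "filterlim (\<lambda>v::real. - (1 / 4 * v)) at_bot at_top"
      by (intro filterlim_uminus_at_top[THEN iffD1] filterlim_tendsto_pos_mult_at_top[OF tendsto_const] filterlim_ident) simp
    then have "((\<lambda>v::real. exp (- (1 / 4 * v))) \<longlongrightarrow> 0) at_top" by (rule filterlim_compose[OF exp_at_bot])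
    from tendsto_mult_right_zero[OF this, of 4]
    show "((\<lambda>v::real. 4 * exp (- (v / 4))) \<longlongrightarrow> 0) at_top" by simp
  qed
  from tendsto_add[OF tendsto_mult_right_zero[OF this, of "2 * A"]
      tendsto_mult_right_zero[OF tendsto_rabs_zero[OF lim], of 2]]
  show "((\<lambda>v. 2 * A * ((1 + v) * exp (- (v / 2))) + 2 * \<bar>w v\<bar>) \<longlongrightarrow> 0) at_top" by simp
qed

text \<open>The Wronskian \<open>W\<close> with the Jacobi function has derivative
  \<open>dilation_Jacobi v * f v\<close>: the potential terms cancel. Up to the \<beta>-error this
  is -\<alpha> times a nonnegative function bounded below near 0. Since \<open>W\<close> tends to 0
  at both ends, the drop near 0 must be paid for by the error.\<close>

lemma source_coefficient_le:
  fixes w w1 f :: "real \<Rightarrow> real"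
  assumes w: "\<And>v. (w has_real_derivative w1 v) (at v)"
    "\<And>v. (w1 has_real_derivative f v - 2 / (cosh v)\<^sup>2 * w v) (at v)"
    and lim: "(w \<longlongrightarrow> 0) at_top" "(w \<longlongrightarrow> 0) at_bot" and B: "\<And>v. \<bar>w v\<bar> \<le> B"
    and f: "\<And>v. \<bar>f v + \<alpha> * Schwarzschild_source v\<bar> \<le> \<beta> / cosh v" and \<alpha>: "0 \<le> \<alpha>"
  shows "\<alpha> \<le> 13824 * \<beta>"
proof -
  define w2 where "w2 v = f v - 2 / (cosh v)\<^sup>2 * w v" for v
  define A where "A = 4 * (\<alpha> + \<beta> + 2 * B)"
  define W where "W v = dilation_Jacobi v * w1 v - (- tanh v - v / (cosh v)\<^sup>2) * w v" for v
  have \<beta>: "0 \<le> \<beta>" using f[of 0] by simp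
  have B0: "0 \<le> B" using B[of 0] by linarith
  have A: "0 \<le> A" using \<alpha> \<beta> B0 by (simp add: A_def)
  have w2: "\<bar>w2 v\<bar> \<le> A * exp (- (\<bar>v\<bar> / 2))" for v
  proof -
    have c: "1 \<le> cosh v" by (rule cosh_real_ge_1)
    have "\<bar>\<alpha> * Schwarzschild_source v\<bar> \<le> \<alpha> * ((1 + \<bar>v\<bar>) / cosh v)"
      unfolding abs_mult abs_of_nonneg[OF \<alpha>] by (intro mult_left_mono abs_source_le \<alpha>)
    moreover have "\<beta> / cosh v \<le> \<beta> * ((1 + \<bar>v\<bar>) / cosh v)"
      using \<beta> c by (simp add: divide_right_mono mult_left_mono algebra_simps)
    moreover have "\<bar>2 / (cosh v)\<^sup>2 * w v\<bar> \<le> 2 * B * ((1 + \<bar>v\<bar>) / cosh v)"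
    proof -
      have "cosh v \<le> (cosh v)\<^sup>2" using c by (simp add: power2_eq_square)
      then have "2 / (cosh v)\<^sup>2 \<le> 2 * ((1 + \<bar>v\<bar>) / cosh v)"
        using c by (simp add: frac_le)
      then have "\<bar>2 / (cosh v)\<^sup>2\<bar> * \<bar>w v\<bar> \<le> 2 * ((1 + \<bar>v\<bar>) / cosh v) * B"
        using B[of v] c by (intro mult_mono) auto
      then show ?thesis by (simp add: abs_mult algebra_simps)
    qed
    ultimately have "\<bar>w2 v\<bar> \<le> \<alpha> * ((1 + \<bar>v\<bar>) / cosh v) + \<beta> * ((1 + \<bar>v\<bar>) / cosh v) + 2 * B * ((1 + \<bar>v\<bar>) / cosh v)"
      using f[of v] unfolding w2_def by linarith
    also have "\<dots> = (\<alpha> + \<beta> + 2 * B) * ((1 + \<bar>v\<bar>) / cosh v)" by (simp only: algebra_simps)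
    also have "\<dots> \<le> (\<alpha> + \<beta> + 2 * B) * (4 * exp (- (\<bar>v\<bar> / 2)))"
      using \<alpha> \<beta> B0 by (intro mult_left_mono growth_over_cosh_le_exp) auto
    finally show ?thesis by (simp add: A_def algebra_simps)
  qed
  have W_top: "(W \<longlongrightarrow> 0) at_top"
    unfolding W_def
    by (rule Wronskian_tendsto_0[OF w(1) w(2)[folded w2_def] lim(1) _ A]) (metis w2 abs_of_nonneg)
  \<comment> \<open>The Jacobi function is even and its derivative odd, so the Wronskian of the
    reflected function is -W(-v), and the end at minus infinity reduces to the other one.\<close>
  have "((\<lambda>v. dilation_Jacobi v * (- w1 (- v)) - (- tanh v - v / (cosh v)\<^sup>2) * w (- v)) \<longlongrightarrow> 0) at_top"
  proof (rule Wronskian_tendsto_0[where w = "\<lambda>v. w (- v)" and ?w1.0 = "\<lambda>v. - w1 (- v)"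
        and ?w2.0 = "\<lambda>v. w2 (- v)", OF _ _ _ _ A])
    fix v :: real
    show "((\<lambda>v. w (- v)) has_real_derivative - w1 (- v)) (at v)"
      by (rule DERIV_cong[OF DERIV_chain2[OF w(1)]]) (auto intro!: derivative_eq_intros)
    show "((\<lambda>v. - w1 (- v)) has_real_derivative w2 (- v)) (at v)"
      by (rule DERIV_cong[OF DERIV_minus[OF DERIV_chain2[OF w(2)[folded w2_def]]]])
        (auto intro!: derivative_eq_intros)
    show "((\<lambda>v. w (- v)) \<longlongrightarrow> 0) at_top"
      using lim(2) by (simp add: at_bot_mirror filterlim_filtermap)
    show "\<bar>w2 (- v)\<bar> \<le> A * exp (- (v / 2))" if "0 \<le> v" using w2[of "- v"] that by simp
  qed
  then have "((\<lambda>v. - W (- v)) \<longlongrightarrow> 0) at_top"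
    by (simp add: W_def dilation_Jacobi_def algebra_simps)
  then have W_bot: "((\<lambda>v. W (- v)) \<longlongrightarrow> 0) at_top"
    using tendsto_minus by fastforce
  have W': "(W has_real_derivative dilation_Jacobi v * f v) (at v)" for v
  proof -
    have "(W has_real_derivative ((- tanh v - v / (cosh v)\<^sup>2) * w1 v + w2 v * dilation_Jacobi v)
      - ((- 2 * dilation_Jacobi v / (cosh v)\<^sup>2) * w v + w1 v * (- tanh v - v / (cosh v)\<^sup>2))) (at v)"
      unfolding W_def[abs_def]
      by (intro DERIV_diff DERIV_mult dilation_Jacobi_derivs w w(2)[folded w2_def])
    then show ?thesis by (rule DERIV_cong) (simp add: w2_def algebra_simps)
  qed
  \<comment> \<open>Subtracting a primitive of the error majorant makes the Wronskian monotone,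
    which replaces an improper integral over the whole line.\<close>
  define Z where "Z v = W v - 54 * \<beta> * arctan v" for v
  have Z': "(Z has_real_derivative dilation_Jacobi v * f v - 54 * \<beta> / (1 + v\<^sup>2)) (at v)" for v
    unfolding Z_def[abs_def] by (rule DERIV_cong[OF DERIV_diff[OF W' DERIV_cmult[OF DERIV_arctan]]])
      (simp add: divide_inverse)
  have neg: "dilation_Jacobi v * f v - 54 * \<beta> / (1 + v\<^sup>2) \<le> - \<alpha> * (dilation_Jacobi v * Schwarzschild_source v)" for v
  proof -
    have "\<bar>dilation_Jacobi v * (f v + \<alpha> * Schwarzschild_source v)\<bar> \<le> (1 + \<bar>v\<bar>) * (\<beta> / cosh v)"
      unfolding abs_mult by (intro mult_mono abs_dilation_Jacobi_le f) auto
    also have "\<dots> = \<beta> * ((1 + \<bar>v\<bar>) / cosh v)" by simp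
    also have "\<dots> \<le> \<beta> * (54 / (1 + v\<^sup>2))" using \<beta> by (intro mult_left_mono growth_over_cosh_le_rational)
    finally have "dilation_Jacobi v * (f v + \<alpha> * Schwarzschild_source v) \<le> 54 * \<beta> / (1 + v\<^sup>2)"
      by (simp add: mult.commute)
    then show ?thesis by (simp add: algebra_simps)
  qed
  have Z_mono: "Z y \<le> Z x" if "x \<le> y" for x y
    by (rule DERIV_nonpos_imp_nonincreasing[OF that])
      (use Z' neg \<alpha> Jacobi_times_source_nonneg in \<open>smt (verit) mult_nonneg_nonneg mult_minus_left\<close>)
  have "Z (1 / 2) + \<alpha> / 64 * (1 / 2) \<le> Z (- 1 / 2) + \<alpha> / 64 * (- 1 / 2)"
  proof (rule DERIV_nonpos_imp_nonincreasing[where f = "\<lambda>v. Z v + \<alpha> / 64 * v"])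
    fix x :: real assume "- 1 / 2 \<le> x" "x \<le> 1 / 2"
    then have "1 / 64 \<le> dilation_Jacobi x * Schwarzschild_source x"
      by (intro Jacobi_times_source_ge) auto
    then have "\<alpha> * (1 / 64) \<le> \<alpha> * (dilation_Jacobi x * Schwarzschild_source x)"
      using \<alpha> by (rule mult_left_mono)
    then have "dilation_Jacobi x * f x - 54 * \<beta> / (1 + x\<^sup>2) + \<alpha> / 64 * 1 \<le> 0" using neg[of x] by simp
    moreover have "((\<lambda>v. Z v + \<alpha> / 64 * v) has_real_derivative
        dilation_Jacobi x * f x - 54 * \<beta> / (1 + x\<^sup>2) + \<alpha> / 64 * 1) (at x)"
      by (intro DERIV_add Z' DERIV_cmult DERIV_ident)
    ultimately show "\<exists>y. ((\<lambda>v. Z v + \<alpha> / 64 * v) has_real_derivative y) (at x) \<and> y \<le> 0" by blast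
  qed simp
  then have mid: "Z (1 / 2) + \<alpha> / 64 \<le> Z (- (1 / 2))" by simp
  have "eventually (\<lambda>v. \<alpha> / 64 - 216 * \<beta> \<le> W (- v) - W v) at_top"
    using eventually_ge_at_top[of "1 / 2"]
  proof eventually_elim
    case (elim v)
    have "Z v + \<alpha> / 64 \<le> Z (- v)" using Z_mono[of "1 / 2" v] Z_mono[of "- v" "- (1 / 2)"] mid elim by simp
    \<comment> \<open>2 is a ceiling for pi / 2. Both ends together cost 4 * 54 = 216 times \<beta>,
      and 64 * 216 = 13824.\<close>
    moreover have "54 * \<beta> * arctan v \<le> 54 * \<beta> * 2"
      using arctan_ubound[of v] pi_less_4 \<beta> by (intro mult_left_mono) auto
    ultimately show ?case by (simp add: Z_def arctan_minus)
  qed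
  then have "\<alpha> / 64 - 216 * \<beta> \<le> 0 - 0"
    by (intro tendsto_lowerbound[OF tendsto_diff[OF W_bot W_top]]) auto
  then show ?thesis by simp
qed

section \<open>Normal graphs over the catenoid\<close>

text \<open>The relational form leaves the derivative schematic, so that resolution with
  \<open>has_pd_intros\<close> computes it for composite expressions.\<close>

definition has_pd :: "'n::finite \<Rightarrow> (real^'n \<Rightarrow> real) \<Rightarrow> real^'n \<Rightarrow> real \<Rightarrow> bool" where
  "has_pd i f p d \<longleftrightarrow> ((\<lambda>t. f (p + t *\<^sub>R axis i 1)) has_real_derivative d) (at 0)"

lemma has_pd_imp_pd: "has_pd i f p d \<Longrightarrow> pd UNIV i f p = d"
  using pd_eqI(1)[OF axis_accessible_UNIV, of p f i d] by (simp add: has_pd_def)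

lemma Ck_imp_has_pd: "Ck (Suc k) UNIV f \<Longrightarrow> has_pd i f p (pd UNIV i f p)"
  using has_derivative_pd[of UNIV i f p] by (simp add: has_pd_def)

lemma has_pd_eq_rhs: "has_pd i f p d \<Longrightarrow> d = d' \<Longrightarrow> has_pd i f p d'"
  by simp

named_theorems has_pd_intros

lemma has_pd_const [has_pd_intros]: "has_pd i (\<lambda>q. k) p 0"
  by (simp add: has_pd_def)

lemma has_pd_add [has_pd_intros]:
  "has_pd i f p d \<Longrightarrow> has_pd i g p d' \<Longrightarrow> has_pd i (\<lambda>q. f q + g q) p (d + d')"
  unfolding has_pd_def by (rule DERIV_add)

lemma has_pd_diff [has_pd_intros]:
  "has_pd i f p d \<Longrightarrow> has_pd i g p d' \<Longrightarrow> has_pd i (\<lambda>q. f q - g q) p (d - d')"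
  unfolding has_pd_def by (rule DERIV_diff)

lemma has_pd_minus [has_pd_intros]: "has_pd i f p d \<Longrightarrow> has_pd i (\<lambda>q. - f q) p (- d)"
  unfolding has_pd_def by (rule DERIV_minus)

lemma has_pd_mult [has_pd_intros]:
  "has_pd i f p d \<Longrightarrow> has_pd i g p d' \<Longrightarrow> has_pd i (\<lambda>q. f q * g q) p (d * g p + d' * f p)"
  unfolding has_pd_def
  using DERIV_mult[of "\<lambda>t. f (p + t *\<^sub>R axis i 1)" d 0 UNIV "\<lambda>t. g (p + t *\<^sub>R axis i 1)" d'] by simp

lemma has_pd_coordinate:
  fixes p :: "real^2"
  assumes "(h has_real_derivative d) (at (p $ j))"
  shows "has_pd i (\<lambda>q. h (q $ j)) p (if i = j then d else 0)"
proof (cases "i = j")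
  case True
  have "((\<lambda>t. h (p $ j + t)) has_real_derivative d) (at 0)"
    using assms DERIV_shift[of h d 0 "p $ j"] by (simp add: add.commute)
  then show ?thesis using True by (simp add: has_pd_def axis_def)
qed (simp add: has_pd_def axis_def)

lemma has_pd_coordinate_functions [has_pd_intros]:
  fixes p :: "real^2"
  shows "has_pd 1 (\<lambda>q. cos (q $ 1)) p (- sin (p $ 1))" "has_pd 2 (\<lambda>q. cos (q $ 1)) p 0"
    "has_pd 1 (\<lambda>q. sin (q $ 1)) p (cos (p $ 1))" "has_pd 2 (\<lambda>q. sin (q $ 1)) p 0"
    "has_pd 1 (\<lambda>q. cosh (q $ 2)) p 0" "has_pd 2 (\<lambda>q. cosh (q $ 2)) p (sinh (p $ 2))"
    "has_pd 1 (\<lambda>q. sinh (q $ 2)) p 0" "has_pd 2 (\<lambda>q. sinh (q $ 2)) p (cosh (p $ 2))"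
    "has_pd 1 (\<lambda>q. tanh (q $ 2)) p 0" "has_pd 2 (\<lambda>q. tanh (q $ 2)) p ((1 / cosh (p $ 2)) * (1 / cosh (p $ 2)))"
    "has_pd 1 (\<lambda>q. 1 / cosh (q $ 2)) p 0"
    "has_pd 2 (\<lambda>q. 1 / cosh (q $ 2)) p (- (1 / cosh (p $ 2)) * tanh (p $ 2))"
    "has_pd 1 (\<lambda>q. q $ 2) p 0" "has_pd 2 (\<lambda>q. q $ 2) p 1"
proof -
  have c: "cosh (p $ 2) \<noteq> 0" using cosh_real_pos[of "p $ 2"] by simp
  have t: "(tanh has_real_derivative (1 / cosh (p $ 2)) * (1 / cosh (p $ 2))) (at (p $ 2))"
  proof -
    have "1 - (tanh (p $ 2))\<^sup>2 = (1 / cosh (p $ 2)) * (1 / cosh (p $ 2))"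
      using hyperbolic_pythagoras[of "p $ 2"] c
      by (simp add: tanh_def power_divide eq_divide_eq left_diff_distrib flip: power2_eq_square)
    then show ?thesis using has_field_derivative_tanh[of "\<lambda>x. x" "p $ 2" 1 UNIV] c by simp
  qed
  have s: "((\<lambda>v. 1 / cosh v) has_real_derivative - (1 / cosh (p $ 2)) * tanh (p $ 2)) (at (p $ 2))"
    using c by (auto intro!: derivative_eq_intros simp: tanh_def power2_eq_square)
  note h = has_pd_coordinate[of _ _ p]
  show "has_pd 1 (\<lambda>q. cos (q $ 1)) p (- sin (p $ 1))" "has_pd 2 (\<lambda>q. cos (q $ 1)) p 0"
    using h[OF DERIV_cos, of 1 1] h[OF DERIV_cos, of 2 1] by simp_all
  show "has_pd 1 (\<lambda>q. sin (q $ 1)) p (cos (p $ 1))" "has_pd 2 (\<lambda>q. sin (q $ 1)) p 0"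
    using h[OF DERIV_sin, of 1 1] h[OF DERIV_sin, of 2 1] by simp_all
  have ch: "(cosh has_real_derivative sinh (p $ 2)) (at (p $ 2))"
    and sh: "(sinh has_real_derivative cosh (p $ 2)) (at (p $ 2))"
    by (auto intro!: derivative_eq_intros)
  show "has_pd 1 (\<lambda>q. cosh (q $ 2)) p 0" "has_pd 2 (\<lambda>q. cosh (q $ 2)) p (sinh (p $ 2))"
    using h[OF ch, of 1] h[OF ch, of 2] by simp_all
  show "has_pd 1 (\<lambda>q. sinh (q $ 2)) p 0" "has_pd 2 (\<lambda>q. sinh (q $ 2)) p (cosh (p $ 2))"
    using h[OF sh, of 1] h[OF sh, of 2] by simp_all
  show "has_pd 1 (\<lambda>q. tanh (q $ 2)) p 0"
    "has_pd 2 (\<lambda>q. tanh (q $ 2)) p ((1 / cosh (p $ 2)) * (1 / cosh (p $ 2)))"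
    using h[OF t, of 1] h[OF t, of 2] by simp_all
  show "has_pd 1 (\<lambda>q. 1 / cosh (q $ 2)) p 0"
    "has_pd 2 (\<lambda>q. 1 / cosh (q $ 2)) p (- (1 / cosh (p $ 2)) * tanh (p $ 2))"
    using h[OF s, of 1] h[OF s, of 2] by simp_all
  show "has_pd 1 (\<lambda>q. q $ 2) p 0" "has_pd 2 (\<lambda>q. q $ 2) p 1"
    using h[OF DERIV_ident, of 1 2] h[OF DERIV_ident, of 2 2] by simp_all
qed

section \<open>Slices of the plane and symmetry of mixed partial derivatives\<close>

definition pt :: "real \<Rightarrow> real \<Rightarrow> real^2" where
  "pt u v = (\<chi> k. if k = 1 then u else v)"

lemma pt_nth [simp]: "pt u v $ 1 = u" "pt u v $ 2 = v"
  by (simp_all add: pt_def)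

lemma pt_add_axis: "pt u v + t *\<^sub>R axis 1 1 = pt (u + t) v" "pt u v + t *\<^sub>R axis 2 1 = pt u (v + t)"
  by (simp_all add: vec_eq_iff forall_2 axis_def)

lemma pt_collapse: "pt (p $ 1) (p $ 2) = p"
  by (simp add: vec_eq_iff forall_2)

lemma continuous_on_pt: "continuous_on S (\<lambda>x. pt (f x) (g x))"
  if "continuous_on S f" "continuous_on S g"
  unfolding pt_def
proof (rule continuous_on_vec_lambda)
  show "continuous_on S (\<lambda>x. if k = 1 then f x else g x)" for k :: 2
    using that by (cases "k = 1") auto
qed

lemma has_pd_pt_iff:
  "has_pd 1 f (pt u v) d \<longleftrightarrow> ((\<lambda>u. f (pt u v)) has_real_derivative d) (at u)"
  "has_pd 2 f (pt u v) d \<longleftrightarrow> ((\<lambda>v. f (pt u v)) has_real_derivative d) (at v)"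
  using DERIV_shift[of "\<lambda>u. f (pt u v)" d 0 u] DERIV_shift[of "\<lambda>v. f (pt u v)" d 0 v]
  by (simp_all add: has_pd_def pt_add_axis add.commute)

text \<open>\<open>Ck\<close> speaks only of iterated partial derivatives, so the symmetry is
  obtained by integration: write f as an integral of its first partial in the first variable,
  differentiate under the integral in the second, and then recover the integrand by the fundamental
  theorem.\<close>

lemma pd_commute:
  fixes f :: "real^2 \<Rightarrow> real"
  assumes "Ck 2 UNIV f"
  shows "pd UNIV 1 (pd UNIV 2 f) p = pd UNIV 2 (pd UNIV 1 f) p"
proof -
  define u v where "u = p $ 1" and "v = p $ 2"
  have p: "p = pt u v" by (simp add: u_def v_def pt_collapse)
  have C: "Ck (Suc (Suc 0)) UNIV f" using assms by (simp add: numeral_2_eq_2)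
  have C1: "Ck (Suc 0) UNIV (pd UNIV i f)" for i using C by auto
  have cont: "continuous_on S (\<lambda>x. pd UNIV i f (pt (g x) (h x)))"
    if "continuous_on S g" "continuous_on S h" for i S and g h :: "'b::topological_space \<Rightarrow> real"
    using continuous_on_compose2[of UNIV "pd UNIV i f" S "\<lambda>x. pt (g x) (h x)"] C1[of i]
      continuous_on_pt[OF that] by auto
  have cont2: "continuous_on S (\<lambda>x. pd UNIV 2 (pd UNIV 1 f) (pt (g x) (h x)))"
    if "continuous_on S g" "continuous_on S h" for S and g h :: "'b::topological_space \<Rightarrow> real"
    using continuous_on_compose2[of UNIV "pd UNIV 2 (pd UNIV 1 f)" S "\<lambda>x. pt (g x) (h x)"] C1[of 1]
      continuous_on_pt[OF that] by auto
  \<comment> \<open>Any base point to the left of \<open>u\<close> will do; \<open>u\<close> is then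
    interior to the interval from \<open>a\<close> to \<open>u + 1\<close>, where the derivative is
    two-sided.\<close>
  define a where "a = u - 1"
  have "a < u" by (simp add: a_def)
  have int: "integral {a..x} (\<lambda>x. pd UNIV 1 f (pt x y)) = f (pt x y) - f (pt a y)" if "a \<le> x" for x y
  proof (rule integral_unique, rule fundamental_theorem_of_calculus[OF that])
    fix z
    show "((\<lambda>z. f (pt z y)) has_vector_derivative pd UNIV 1 f (pt z y)) (at z within {a..x})"
      using Ck_imp_has_pd[OF C, of 1 "pt z y"]
      unfolding has_pd_pt_iff has_real_derivative_iff_has_vector_derivative
      by (rule has_vector_derivative_at_within)
  qed
  have mixed: "pd UNIV 2 f (pt x v) - pd UNIV 2 f (pt a v) = integral {a..x} (\<lambda>x. pd UNIV 2 (pd UNIV 1 f) (pt x v))"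
    if "a \<le> x" for x
  proof -
    have "((\<lambda>y. integral (cbox a x) (\<lambda>x. pd UNIV 1 f (pt x y))) has_field_derivative
        integral (cbox a x) (\<lambda>x. pd UNIV 2 (pd UNIV 1 f) (pt x v))) (at v within UNIV)"
    proof (rule leibniz_rule_field_derivative)
      fix y z
      show "((\<lambda>y. pd UNIV 1 f (pt z y)) has_field_derivative pd UNIV 2 (pd UNIV 1 f) (pt z y)) (at y within UNIV)"
        using Ck_imp_has_pd[OF C1, of 2 1 "pt z y"] unfolding has_pd_pt_iff by simp
      show "(\<lambda>x. pd UNIV 1 f (pt x y)) integrable_on cbox a x"
        by (intro integrable_continuous cont continuous_intros)
      show "continuous_on (UNIV \<times> cbox a x) (\<lambda>(y, z). pd UNIV 2 (pd UNIV 1 f) (pt z y))"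
        unfolding case_prod_beta by (intro cont2 continuous_intros)
    qed auto
    then have "((\<lambda>y. f (pt x y) - f (pt a y)) has_real_derivative
        integral {a..x} (\<lambda>x. pd UNIV 2 (pd UNIV 1 f) (pt x v))) (at v)"
      unfolding cbox_interval int[OF that] by simp
    moreover have "((\<lambda>y. f (pt x y) - f (pt a y)) has_real_derivative
        pd UNIV 2 f (pt x v) - pd UNIV 2 f (pt a v)) (at v)"
      by (intro DERIV_diff has_pd_pt_iff(2)[THEN iffD1] Ck_imp_has_pd[OF C])
    ultimately show ?thesis by (rule DERIV_unique[symmetric])
  qed
  have "((\<lambda>x. integral {a..x} (\<lambda>x. pd UNIV 2 (pd UNIV 1 f) (pt x v))) has_vector_derivative
      pd UNIV 2 (pd UNIV 1 f) (pt u v)) (at u within {a..u + 1})"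
    by (rule integral_has_vector_derivative) (auto intro!: cont2 continuous_intros simp: a_def)
  then have "((\<lambda>x. integral {a..x} (\<lambda>x. pd UNIV 2 (pd UNIV 1 f) (pt x v))) has_vector_derivative
      pd UNIV 2 (pd UNIV 1 f) (pt u v)) (at u)"
    using at_within_Icc_at[of a u "u + 1"] by (simp add: a_def)
  then have "((\<lambda>x. pd UNIV 2 f (pt x v) - pd UNIV 2 f (pt a v)) has_vector_derivative
      pd UNIV 2 (pd UNIV 1 f) (pt u v)) (at u)"
    by (rule has_vector_derivative_transform_within_open[where S = "{a<..}"]) (use \<open>a < u\<close> in \<open>auto simp: mixed\<close>)
  moreover have "((\<lambda>x. pd UNIV 2 f (pt x v) - pd UNIV 2 f (pt a v)) has_real_derivative
      pd UNIV 1 (pd UNIV 2 f) (pt u v) - 0) (at u)"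
    by (intro DERIV_diff has_pd_pt_iff(1)[THEN iffD1] Ck_imp_has_pd[OF C1] DERIV_const)
  ultimately show ?thesis unfolding p has_real_derivative_iff_has_vector_derivative[symmetric]
    using DERIV_unique by fastforce
qed

text \<open>Radial, angular and vertical components at angle \<open>u\<close>. Inner and cross
  products do not depend on \<open>u\<close>, which removes all trigonometric functions from the
  geometry.\<close>

definition frame :: "real \<Rightarrow> real \<Rightarrow> real \<Rightarrow> real \<Rightarrow> real^3" where
  "frame u x y z = vector [x * cos u - y * sin u, x * sin u + y * cos u, z]"

lemma frame_nth [simp]:
  "frame u x y z $ 1 = x * cos u - y * sin u" "frame u x y z $ 2 = x * sin u + y * cos u" "frame u x y z $ 3 = z"
  by (simp_all add: frame_def)

lemma frame_inner: "frame u x y z \<bullet> frame u x' y' z' = x * x' + y * y' + z * z'"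
proof -
  have cs: "sin u * sin u + cos u * cos u = 1" using sin_cos_squared_add[of u] by (simp add: power2_eq_square)
  have "frame u x y z \<bullet> frame u x' y' z' = (x * cos u - y * sin u) * (x' * cos u - y' * sin u)
      + (x * sin u + y * cos u) * (x' * sin u + y' * cos u) + z * z'"
    by (simp add: inner_vec_def sum_3)
  with cs show ?thesis by algebra
qed

lemma frame_cross:
  "cross3 (frame u x y z) (frame u x' y' z') = frame u (y * z' - z * y') (z * x' - x * z') (x * y' - y * x')"
proof -
  have cs: "sin u * sin u + cos u * cos u = 1" using sin_cos_squared_add[of u] by (simp add: power2_eq_square)
  have "(x * cos u - y * sin u) * (x' * sin u + y' * cos u) - (x * sin u + y * cos u) * (x' * cos u - y' * sin u)
     = x * y' - y * x'" using cs by algebra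
  then show ?thesis by (simp add: cross3_def vec_eq_iff forall_3) (simp add: algebra_simps)
qed

lemma frame_scaleR: "k *\<^sub>R frame u x y z = frame u (k * x) (k * y) (k * z)"
  by (simp add: vec_eq_iff forall_3 algebra_simps)

lemma norm_frame: "norm (frame u x y z) = sqrt (x\<^sup>2 + y\<^sup>2 + z\<^sup>2)"
  by (simp add: norm_eq_sqrt_inner frame_inner power2_eq_square)

lemma norm_frame_le: "norm (frame u x y z) \<le> \<bar>x\<bar> + \<bar>y\<bar> + \<bar>z\<bar>"
proof -
  have "sqrt (x\<^sup>2 + y\<^sup>2 + z\<^sup>2) \<le> sqrt (x\<^sup>2 + y\<^sup>2) + sqrt (z\<^sup>2)" by (rule sqrt_add_le_add_sqrt) auto
  also have "sqrt (x\<^sup>2 + y\<^sup>2) \<le> sqrt (x\<^sup>2) + sqrt (y\<^sup>2)" by (rule sqrt_add_le_add_sqrt) auto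
  finally show ?thesis by (simp add: norm_frame)
qed

section \<open>Derivatives of the radius and height functions of the graph\<close>

locale catenoid_graph =
  fixes c :: real and \<Omega> :: "real^2 \<Rightarrow> real"
  assumes C2: "Ck 2 UNIV \<Omega>"
begin

abbreviation "S q \<equiv> 1 / cosh ((q::real^2) $ 2)"
abbreviation "T q \<equiv> tanh ((q::real^2) $ 2)"
abbreviation "\<Omega>u \<equiv> pd UNIV 1 \<Omega>"
abbreviation "\<Omega>v \<equiv> pd UNIV 2 \<Omega>"
abbreviation "\<Omega>uu \<equiv> pd UNIV 1 \<Omega>u"
abbreviation "\<Omega>uv \<equiv> pd UNIV 1 \<Omega>v"
abbreviation "\<Omega>vv \<equiv> pd UNIV 2 \<Omega>v"

text \<open>Everything is expressed through \<open>S\<close> and \<open>T\<close>, which are closed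
  under differentiation: T' = S^2 and S' = -S T.\<close>

definition "rho q = c * cosh (q $ 2) + S q * \<Omega> q"
definition "rho_u q = S q * \<Omega>u q"
definition "rho_v q = c * sinh (q $ 2) + S q * \<Omega>v q - S q * T q * \<Omega> q"
definition "rho_uu q = S q * \<Omega>uu q"
definition "rho_uv q = S q * \<Omega>uv q - S q * T q * \<Omega>u q"
definition "rho_vv q = c * cosh (q $ 2) + S q * \<Omega>vv q - 2 * (S q * T q * \<Omega>v q)
    + S q * T q * T q * \<Omega> q - S q * S q * S q * \<Omega> q"
definition "zet q = c * q $ 2 - T q * \<Omega> q"
definition "zet_u q = - (T q * \<Omega>u q)"
definition "zet_v q = c - S q * S q * \<Omega> q - T q * \<Omega>v q"
definition "zet_uu q = - (T q * \<Omega>uu q)"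
definition "zet_uv q = - (S q * S q * \<Omega>u q) - T q * \<Omega>uv q"
definition "zet_vv q = 2 * (S q * S q * T q * \<Omega> q) - 2 * (S q * S q * \<Omega>v q) - T q * \<Omega>vv q"

lemma C2': "Ck (Suc (Suc 0)) UNIV \<Omega>" using C2 by (simp add: numeral_2_eq_2)

lemma C1: "Ck (Suc 0) UNIV (pd UNIV i \<Omega>)" using C2' by auto

lemma has_pd_Omega [has_pd_intros]:
  "has_pd i \<Omega> p (pd UNIV i \<Omega> p)" "has_pd i \<Omega>u p (pd UNIV i \<Omega>u p)" "has_pd i \<Omega>v p (pd UNIV i \<Omega>v p)"
  by (rule Ck_imp_has_pd[OF C2'] Ck_imp_has_pd[OF C1])+

lemma pd_commute_Omega: "pd UNIV 2 \<Omega>u = \<Omega>uv"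
  using pd_commute[OF C2] by auto

lemma has_pd_rho_zet [has_pd_intros]:
  "has_pd 1 rho p (rho_u p)" "has_pd 2 rho p (rho_v p)"
  "has_pd 1 rho_u p (rho_uu p)" "has_pd 2 rho_u p (rho_uv p)"
  "has_pd 1 rho_v p (rho_uv p)" "has_pd 2 rho_v p (rho_vv p)"
  "has_pd 1 zet p (zet_u p)" "has_pd 2 zet p (zet_v p)"
  "has_pd 1 zet_u p (zet_uu p)" "has_pd 2 zet_u p (zet_uv p)"
  "has_pd 1 zet_v p (zet_uv p)" "has_pd 2 zet_v p (zet_vv p)"
  unfolding rho_def[abs_def] rho_u_def[abs_def] rho_v_def[abs_def] zet_def[abs_def] zet_u_def[abs_def]
    zet_v_def[abs_def]
  by (rule has_pd_eq_rhs, (rule has_pd_intros)+, simp add: rho_u_def rho_v_def rho_uu_def rho_uv_def rho_vv_def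
      zet_u_def zet_v_def zet_uu_def zet_uv_def zet_vv_def pd_commute_Omega algebra_simps)+

lemma Fcat_eq_frame: "Fcat c \<Omega> p = frame (p $ 1) (rho p) 0 (zet p)"
  by (simp add: vec_eq_iff forall_3 Fcat_def Let_def rho_def zet_def)

lemma dF_Fcat:
  "dF (Fcat c \<Omega>) 1 p = frame (p $ 1) (rho_u p) (rho p) (zet_u p)"
  "dF (Fcat c \<Omega>) 2 p = frame (p $ 1) (rho_v p) 0 (zet_v p)"
  unfolding dF_def vec_eq_iff forall_3 Fcat_eq_frame vec_lambda_beta frame_nth
  by (intro conjI has_pd_imp_pd; rule has_pd_eq_rhs, (rule has_pd_intros)+, simp)+

lemma ddF_Fcat:
  "ddF (Fcat c \<Omega>) 1 1 p = frame (p $ 1) (rho_uu p - rho p) (2 * rho_u p) (zet_uu p)"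
  "ddF (Fcat c \<Omega>) 1 2 p = frame (p $ 1) (rho_uv p) (rho_v p) (zet_uv p)"
  "ddF (Fcat c \<Omega>) 2 1 p = frame (p $ 1) (rho_uv p) (rho_v p) (zet_uv p)"
  "ddF (Fcat c \<Omega>) 2 2 p = frame (p $ 1) (rho_vv p) 0 (zet_vv p)"
proof -
  have 1: "pd UNIV 1 (\<lambda>q. Fcat c \<Omega> q $ k) = (\<lambda>q. frame (q $ 1) (rho_u q) (rho q) (zet_u q) $ k)" for k
    using dF_Fcat(1) by (simp add: dF_def vec_eq_iff fun_eq_iff)
  have 2: "pd UNIV 2 (\<lambda>q. Fcat c \<Omega> q $ k) = (\<lambda>q. frame (q $ 1) (rho_v q) 0 (zet_v q) $ k)" for k
    using dF_Fcat(2) by (simp add: dF_def vec_eq_iff fun_eq_iff)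
  show "ddF (Fcat c \<Omega>) 1 1 p = frame (p $ 1) (rho_uu p - rho p) (2 * rho_u p) (zet_uu p)"
    "ddF (Fcat c \<Omega>) 1 2 p = frame (p $ 1) (rho_uv p) (rho_v p) (zet_uv p)"
    "ddF (Fcat c \<Omega>) 2 1 p = frame (p $ 1) (rho_uv p) (rho_v p) (zet_uv p)"
    "ddF (Fcat c \<Omega>) 2 2 p = frame (p $ 1) (rho_vv p) 0 (zet_vv p)"
    unfolding ddF_def 1 2 vec_eq_iff forall_3 vec_lambda_beta frame_nth
    by (intro conjI has_pd_imp_pd; rule has_pd_eq_rhs, (rule has_pd_intros)+, simp add: algebra_simps)+
qed

end

section \<open>The mean curvature equation\<close>

lemma gform_eq_inner: "gform G x v w = v \<bullet> (G x *v w)"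
  by (simp add: gform_def inner_vec_def matrix_vector_mult_def sum_distrib_left algebra_simps)

lemma gmet_mult_vector: "gmet m e x *v y = (1 + m / (2 * norm x)) ^ 4 *\<^sub>R y + e x *v y"
  by (simp add: gmet_def matrix_vector_mult_add_rdistrib scaleR_matrix_vector_assoc[symmetric])

lemma has_derivative_norm_along_axis:
  fixes x :: "real^'n"
  assumes "x \<noteq> 0"
  shows "((\<lambda>t. norm (x + t *\<^sub>R axis i 1)) has_real_derivative x $ i / norm x) (at 0 within A)"
proof -
  have "(norm (x + t *\<^sub>R axis i 1))\<^sup>2 = (norm x)\<^sup>2 + 2 * (t * x $ i) + t * t" for t
    unfolding power2_norm_eq_inner inner_add_left inner_add_right inner_scaleR_left
      inner_scaleR_right inner_axis inner_axis' inner_axis_axis by (simp add: axis_def algebra_simps)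
  then have eq: "norm (x + t *\<^sub>R axis i 1) = sqrt ((norm x)\<^sup>2 + 2 * (t * x $ i) + t * t)" for t
    by (metis norm_ge_zero real_sqrt_unique)
  show ?thesis unfolding eq
    using assms by (auto intro!: derivative_eq_intros simp: field_simps)
qed

lemma pd_gmet:
  assumes x: "x \<in> Mset r0" "x \<noteq> 0" and ex: "pd_exists (Mset r0) i (\<lambda>y. e y $ j $ l) x"
  shows "pd (Mset r0) i (\<lambda>y. gmet m e y $ j $ l) x
    = - (2 * m * (1 + m / (2 * norm x)) ^ 3 / norm x ^ 3) * x $ i * (mat 1 :: real^3^3) $ j $ l
      + pd (Mset r0) i (\<lambda>y. e y $ j $ l) x"
proof (rule pd_eqI(1)[OF axis_accessible_Mset x(1)])
  let ?A = "{t. x + t *\<^sub>R axis i 1 \<in> Mset r0}"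
  have "((\<lambda>t. (1 + m / (2 * norm (x + t *\<^sub>R axis i 1))) ^ 4) has_real_derivative
      - (2 * m * (1 + m / (2 * norm x)) ^ 3 / norm x ^ 3) * x $ i) (at 0 within ?A)"
    using x(2) by (auto intro!: derivative_eq_intros has_derivative_norm_along_axis
        simp: power2_eq_square power3_eq_cube) (simp add: field_simps)
  from DERIV_add[OF DERIV_mult[OF this DERIV_const] has_derivative_pd[OF ex]]
  show "((\<lambda>t. gmet m e (x + t *\<^sub>R axis i 1) $ j $ l) has_real_derivative
      - (2 * m * (1 + m / (2 * norm x)) ^ 3 / norm x ^ 3) * x $ i * (mat 1 :: real^3^3) $ j $ l
      + pd (Mset r0) i (\<lambda>y. e y $ j $ l) x) (at 0 within ?A)"
    by (simp add: gmet_def)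
qed

lemma conformal_christoffel_contraction:
  fixes q a b \<nu> :: "real^3"
  shows "(\<Sum>l\<in>UNIV. \<Sum>i\<in>UNIV. \<Sum>j\<in>UNIV. (q $ i * (mat 1 :: real^3^3) $ j $ l + q $ j * (mat 1 :: real^3^3) $ i $ l
        - q $ l * (mat 1 :: real^3^3) $ i $ j) / 2 * a $ i * b $ j * \<nu> $ l)
    = ((q \<bullet> a) * (b \<bullet> \<nu>) + (q \<bullet> b) * (a \<bullet> \<nu>) - (q \<bullet> \<nu>) * (a \<bullet> b)) / 2"
  by (simp add: sum_3 inner_vec_def mat_def) (simp add: field_simps)

text \<open>\<open>christ\<close> has all indices lowered and is therefore linear in the metric, so
  the two parts of the metric separate and no inverse metric appears. The vector \<open>q\<close> is
  the gradient of the conformal factor.\<close>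

lemma christ_gmet_contraction:
  fixes a b \<nu> :: "real^3" and m :: real
  assumes x: "x \<in> Mset r0" "x \<noteq> 0" and ex: "\<And>i j l. pd_exists (Mset r0) i (\<lambda>y. e y $ j $ l) x"
  defines "q \<equiv> - (2 * m * (1 + m / (2 * norm x)) ^ 3 / norm x ^ 3) *\<^sub>R x"
  shows "(\<Sum>l\<in>UNIV. \<Sum>i\<in>UNIV. \<Sum>j\<in>UNIV. christ (Mset r0) (gmet m e) x l i j * a $ i * b $ j * \<nu> $ l)
    = ((q \<bullet> a) * (b \<bullet> \<nu>) + (q \<bullet> b) * (a \<bullet> \<nu>) - (q \<bullet> \<nu>) * (a \<bullet> b)) / 2
      + (\<Sum>l\<in>UNIV. \<Sum>i\<in>UNIV. \<Sum>j\<in>UNIV. christ (Mset r0) e x l i j * a $ i * b $ j * \<nu> $ l)"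
proof -
  have "christ (Mset r0) (gmet m e) x l i j = (q $ i * (mat 1 :: real^3^3) $ j $ l + q $ j * (mat 1 :: real^3^3) $ i $ l
        - q $ l * (mat 1 :: real^3^3) $ i $ j) / 2 + christ (Mset r0) e x l i j" for l i j
    unfolding christ_def pd_gmet[OF x ex] q_def by (simp add: field_simps)
  then show ?thesis
    unfolding conformal_christoffel_contraction[symmetric] by (simp only: distrib_right sum.distrib)
qed

section \<open>From minimality to a vanishing numerator\<close>

lemma gform_bilinear:
  "gform G x (v + v') w = gform G x v w + gform G x v' w"
  "gform G x (k *\<^sub>R v) w = k * gform G x v w"
  "gform G x v (w + w') = gform G x v w + gform G x v w'"
  "gform G x v (k *\<^sub>R w) = k * gform G x v w"
  by (simp_all add: gform_eq_inner inner_add_left matrix_vector_right_distrib inner_add_right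
      matrix_vector_mult_scaleR)

lemma sff_scaleR: "sff S G F (k *\<^sub>R \<nu>) a b p = k * sff S G F \<nu> a b p"
  by (simp add: sff_def gform_bilinear distrib_left sum_distrib_left algebra_simps)

text \<open>The numerator is linear in \<nu>, so it may be normalised. The determinant of the
  induced metric must be shown to be nonzero: with division by zero \<open>meancurv\<close> would
  vanish for free.\<close>

lemma minimal_immersion_numerator:
  assumes min: "minimal_immersion S G F" and sym: "\<And>v w. gform G (F p) v w = gform G (F p) w v"
    and \<nu>: "gform G (F p) (dF F 1 p) \<nu> = 0" "gform G (F p) (dF F 2 p) \<nu> = 0"
  shows "hind G F 2 2 p * sff S G F \<nu> 1 1 p - hind G F 1 2 p * sff S G F \<nu> 2 1 p
      - hind G F 2 1 p * sff S G F \<nu> 1 2 p + hind G F 1 1 p * sff S G F \<nu> 2 2 p = 0" (is "?num \<nu> = 0")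
proof (cases "\<nu> = 0")
  case True
  then show ?thesis using sff_scaleR[of S G F 0] by simp
next
  case False
  have pos: "gform G (F p) w w > 0" if "w \<noteq> 0" for w
    using min that by (simp add: minimal_immersion_def)
  have indep: "s = 0 \<and> t = 0" if "s *\<^sub>R dF F 1 p + t *\<^sub>R dF F 2 p = 0" for s t
    using min that unfolding minimal_immersion_def by blast
  let ?a = "dF F 1 p" and ?b = "dF F 2 p"
  have "?a \<noteq> 0" using indep[of 1 0] by auto
  then have h11: "hind G F 1 1 p > 0" by (simp add: hind_def pos)
  have sym12: "hind G F 2 1 p = hind G F 1 2 p" by (simp add: hind_def sym)
  \<comment> \<open>The Gram-Schmidt vector: its squared length is \<open>hind G F 1 1 p\<close>
    times the determinant.\<close>
  define w where "w = (- hind G F 1 2 p) *\<^sub>R ?a + hind G F 1 1 p *\<^sub>R ?b"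
  have "w \<noteq> 0" using indep h11 unfolding w_def by fastforce
  from pos[OF this] have "hind G F 1 1 p * (hind G F 1 1 p * hind G F 2 2 p - hind G F 1 2 p * hind G F 2 1 p) > 0"
    unfolding w_def gform_bilinear by (simp add: hind_def[symmetric] sym12 algebra_simps)
  then have den: "hind G F 1 1 p * hind G F 2 2 p - hind G F 1 2 p * hind G F 2 1 p > 0"
    using h11 by (simp add: zero_less_mult_iff)
  define k where "k = 1 / sqrt (gform G (F p) \<nu> \<nu>)"
  have g: "gform G (F p) \<nu> \<nu> > 0" by (rule pos[OF False])
  have "gform G (F p) (k *\<^sub>R \<nu>) (k *\<^sub>R \<nu>) = 1"
    using g by (simp add: gform_bilinear k_def)
  moreover have "gform G (F p) ?a (k *\<^sub>R \<nu>) = 0" "gform G (F p) ?b (k *\<^sub>R \<nu>) = 0"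
    using \<nu> by (simp_all add: gform_bilinear)
  ultimately have "meancurv S G F (k *\<^sub>R \<nu>) p = 0"
    using min unfolding minimal_immersion_def by blast
  then have "?num (k *\<^sub>R \<nu>) = 0" using den by (simp add: meancurv_def)
  then have "k * ?num \<nu> = 0" unfolding sff_scaleR by (simp add: algebra_simps)
  moreover have "k \<noteq> 0" using g by (simp add: k_def)
  ultimately show ?thesis by simp
qed

text \<open>Yields the vector dual to the Euclidean normal without inverting the metric explicitly;
  positivity gives injectivity, hence surjectivity in finite dimension.\<close>

lemma positive_definite_solvable:
  fixes A :: "real^3^3"
  assumes "\<And>w. w \<noteq> 0 \<Longrightarrow> w \<bullet> (A *v w) > 0"
  obtains \<nu> where "A *v \<nu> = N"
proof -
  have "inj ((*v) A)"
  proof (rule injI)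
    fix x y assume "A *v x = A *v y"
    then have "A *v (x - y) = 0" by (simp add: matrix_vector_mult_diff_distrib)
    then show "x = y" using assms[of "x - y"] by auto
  qed
  then have "surj ((*v) A)" by (intro linear_injective_imp_surjective[OF matrix_vector_mul_linear] refl)
  then show thesis using that by (metis surjD)
qed

text \<open>All lengths are divided by R = c cosh v. The graph then has size k / R, the perturbation
  and its Christoffel symbols \<kappa> / R^2, and the Schwarzschild gradient m / R. This puts the
  point into the scale-free settings \<open>graph_jet\<close> and \<open>perturbed_normal\<close>,
  whose constants know nothing of c or v.\<close>

lemma minimal_graph_pointwise_estimate:
  fixes e :: "real^3 \<Rightarrow> real^3^3"
  assumes r0: "0 < r0" and E: "in_E r0 2 e"
    and e0: "\<And>x i j. x \<in> Mset r0 \<Longrightarrow> \<bar>e x $ i $ j\<bar> * norm x ^ 2 \<le> \<kappa>"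
    and e1: "\<And>x i j l. x \<in> Mset r0 \<Longrightarrow> \<bar>pd (Mset r0) l (\<lambda>y. e y $ i $ j) x\<bar> * norm x ^ 3 \<le> \<kappa>"
    and \<kappa>: "\<kappa> \<le> 1 / 108" and m: "0 \<le> m" "m \<le> 1" and c: "1 \<le> c"
    and C2: "Ck 2 UNIV \<Omega>" and k: "k \<le> 1 / 2"
    and \<Omega>: "\<bar>\<Omega> p\<bar> \<le> k" "\<bar>pd UNIV 1 \<Omega> p\<bar> \<le> k" "\<bar>pd UNIV 2 \<Omega> p\<bar> \<le> k"
      "\<bar>pd UNIV 1 (pd UNIV 1 \<Omega>) p\<bar> \<le> k" "\<bar>pd UNIV 1 (pd UNIV 2 \<Omega>) p\<bar> \<le> k" "\<bar>pd UNIV 2 (pd UNIV 2 \<Omega>) p\<bar> \<le> k"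
    and min: "minimal_immersion (Mset r0) (gmet m e) (Fcat c \<Omega>)"
  shows "\<bar>pd UNIV 1 (pd UNIV 1 \<Omega>) p + pd UNIV 2 (pd UNIV 2 \<Omega>) p + 2 / (cosh (p $ 2))\<^sup>2 * \<Omega> p
      + 2 * m * Schwarzschild_source (p $ 2)\<bar> \<le> 10 ^ 21 * (\<kappa> + k\<^sup>2 + m * k + m\<^sup>2) / (c * cosh (p $ 2))"
proof -
  interpret catenoid_graph c \<Omega> by standard (rule C2)
  define u v where "u = p $ 1" and "v = p $ 2"
  define R where "R = c * cosh v"
  define s t where "s = 1 / cosh v" and "t = tanh v"
  have ch: "1 \<le> cosh v" by (rule cosh_real_ge_1)
  have R1: "1 \<le> R" using mult_mono[OF c ch] c by (simp add: R_def)
  then have R0: "0 < R" by simp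
  define \<eta> where "\<eta> = k / R"
  have k0: "0 \<le> k" using \<Omega>(1) by linarith
  have \<eta>k: "0 \<le> \<eta>" "\<eta> \<le> 1 / 2"
  proof -
    show "0 \<le> \<eta>" using k0 R0 by (simp add: \<eta>_def)
    have "k / R \<le> k / 1" using k0 R1 by (intro divide_left_mono) auto
    then show "\<eta> \<le> 1 / 2" using k unfolding \<eta>_def by linarith
  qed
  have st: "s\<^sup>2 + t\<^sup>2 = 1"
    using hyperbolic_pythagoras[of v] ch
    by (simp add: s_def t_def tanh_def power_divide add_divide_distrib[symmetric])
  define w wu wv wuu wuv wvv where "w = \<Omega> p / R" and "wu = \<Omega>u p / R" and "wv = \<Omega>v p / R"
    and "wuu = \<Omega>uu p / R" and "wuv = \<Omega>uv p / R" and "wvv = \<Omega>vv p / R"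
  interpret J: graph_jet s t w wu wv wuu wuv wvv \<eta>
    using st \<eta>k \<Omega> R0
    by unfold_locales (auto simp: w_def wu_def wv_def wuu_def wuv_def wvv_def \<eta>_def divide_right_mono)
  have \<Omega>R: "\<Omega> p = R * w" "\<Omega>u p = R * wu" "\<Omega>v p = R * wv" "\<Omega>uu p = R * wuu" "\<Omega>uv p = R * wuv" "\<Omega>vv p = R * wvv"
    using R0 by (simp_all add: w_def wu_def wv_def wuu_def wuv_def wvv_def)
  have cR: "c * cosh v = R" "c * sinh v = R * t" "c = R * s"
    using ch by (simp_all add: R_def t_def s_def tanh_def)
  have scaled: "rho p = R * J.r" "rho_u p = R * J.ru" "rho_v p = R * J.rv" "zet_u p = R * J.zu" "zet_v p = R * J.zv"
    "rho_uu p = R * J.ruu" "rho_uv p = R * J.ruv" "rho_vv p = R * J.rvv"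
    "zet_uu p = R * J.zuu" "zet_uv p = R * J.zuv" "zet_vv p = R * J.zvv" "zet p = R * (s * v - t * w)"
    unfolding rho_def rho_u_def rho_v_def zet_u_def zet_v_def rho_uu_def rho_uv_def rho_vv_def
      zet_uu_def zet_uv_def zet_vv_def zet_def J.r_def J.ru_def J.rv_def J.zu_def J.zv_def J.ruu_def
      J.ruv_def J.rvv_def J.zuu_def J.zuv_def J.zvv_def v_def[symmetric] s_def[symmetric] t_def[symmetric]
      \<Omega>R cR(1,2)
    by (simp_all add: power2_eq_square power3_eq_cube algebra_simps flip: cR(3))
  define a where "a = frame u J.ru J.r J.zu"
  define b where "b = frame u J.rv 0 J.zv"
  define P11 where "P11 = frame u (J.ruu - J.r) (J.ru + J.ru) J.zuu"
  define P12 where "P12 = frame u J.ruv J.rv J.zuv"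
  define P22 where "P22 = frame u J.rvv 0 J.zvv"
  define N where "N = frame u J.n1 J.n2 J.n3"
  define X where "X = frame u J.r 0 (s * v - t * w)"
  let ?F = "Fcat c \<Omega>"
  let ?G = "gmet m e"
  have dF: "dF ?F 1 p = R *\<^sub>R a" "dF ?F 2 p = R *\<^sub>R b" "ddF ?F 1 1 p = R *\<^sub>R P11" "ddF ?F 1 2 p = R *\<^sub>R P12"
    "ddF ?F 2 1 p = R *\<^sub>R P12" "ddF ?F 2 2 p = R *\<^sub>R P22" "?F p = R *\<^sub>R X"
    unfolding dF_Fcat ddF_Fcat Fcat_eq_frame scaled a_def b_def P11_def P12_def P22_def X_def frame_scaleR u_def[symmetric]
    by (simp_all add: algebra_simps)
  have N: "a \<bullet> N = 0" "b \<bullet> N = 0"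
    by (simp_all add: a_def b_def N_def frame_inner J.n1_def J.n2_def J.n3_def algebra_simps)
  have Fp: "?F p \<in> Mset r0" using min by (simp add: minimal_immersion_def)
  then have Fp0: "?F p \<noteq> 0" using r0 by (auto simp: Mset_def)
  define f where "f = norm X"
  have f_eq: "f = sqrt (J.r\<^sup>2 + (s * v - t * w)\<^sup>2)" by (simp add: f_def X_def norm_frame)
  have f: "1 / 2 \<le> f" and normF: "norm (?F p) = R * f"
  proof -
    \<comment> \<open>The radial component alone keeps the point at distance at least R / 2 from the
      origin, which turns decay in the norm of x into decay in R.\<close>
    have "\<bar>J.r\<bar> \<le> f" unfolding f_eq by (rule real_le_rsqrt) simp
    moreover have "1 / 2 \<le> J.r" using J.mult_le_eta[OF J.s_le J.w(1)] \<eta>k unfolding J.r_def by linarith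
    ultimately show "1 / 2 \<le> f" by linarith
    show "norm (?F p) = R * f" using R0 by (simp add: dF f_def)
  qed
  define \<phi> where "\<phi> = 1 + m / (2 * norm (?F p))"
  have \<phi>: "1 \<le> \<phi>" "\<phi> - 1 \<le> m / R" "\<phi> \<le> 2"
  proof -
    have pos: "0 < 2 * norm (?F p)" using Fp0 by simp
    show "1 \<le> \<phi>" using m pos by (simp add: \<phi>_def)
    have "R * (1 / 2) \<le> R * f" using f R0 by (intro mult_left_mono) auto
    then have "R \<le> 2 * norm (?F p)" by (simp add: normF)
    then show "\<phi> - 1 \<le> m / R" unfolding \<phi>_def using m R0 by (simp add: frac_le)
    also have "m / R \<le> 1" using m R1 by simp
    finally show "\<phi> \<le> 2" by simp
  qed
  have \<kappa>0: "0 \<le> \<kappa>" using e0[OF Fp, of 1 1] by (meson abs_ge_zero mult_nonneg_nonneg order_trans norm_ge_zero zero_le_power)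
  \<comment> \<open>The entries of \<open>e\<close> would need only 4. The factor 6 comes from the
    Christoffel symbols, 3 * 8 / 2 = 2 * 6, and turns the bound 1/108 into the required
    1/18.\<close>
  define \<kappa>' where "\<kappa>' = 6 * \<kappa> / R\<^sup>2"
  have eb: "\<bar>e (?F p) $ i $ j\<bar> \<le> \<kappa>'" for i j
  proof -
    have "(R * (1 / 2))\<^sup>2 \<le> (norm (?F p))\<^sup>2" unfolding normF using f R0 by (intro power_mono mult_left_mono) auto
    then have "\<bar>e (?F p) $ i $ j\<bar> * (R * (1 / 2))\<^sup>2 \<le> \<bar>e (?F p) $ i $ j\<bar> * (norm (?F p))\<^sup>2" by (rule mult_left_mono) simp
    also have "\<dots> \<le> \<kappa>" by (rule e0[OF Fp])
    finally have "\<bar>e (?F p) $ i $ j\<bar> * R\<^sup>2 \<le> 6 * \<kappa>" using \<kappa>0 by (simp add: power2_eq_square)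
    then show ?thesis using R0 by (simp add: \<kappa>'_def pos_le_divide_eq)
  qed
  \<comment> \<open>Christoffel symbols scale like an inverse length, hence the factor
    \<open>R\<close>.\<close>
  define \<Gamma> where "\<Gamma> l i j = R * christ (Mset r0) e (?F p) l i j" for l i j
  have \<Gamma>: "\<bar>\<Gamma> l i j\<bar> \<le> 2 * \<kappa>'" for l i j
  proof -
    have pde: "\<bar>pd (Mset r0) l (\<lambda>y. e y $ i $ j) (?F p)\<bar> * R ^ 3 \<le> 8 * \<kappa>" for l i j
    proof -
      have "(R * (1 / 2)) ^ 3 \<le> (norm (?F p)) ^ 3" unfolding normF using f R0 by (intro power_mono mult_left_mono) auto
      then have "\<bar>pd (Mset r0) l (\<lambda>y. e y $ i $ j) (?F p)\<bar> * (R * (1 / 2)) ^ 3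
          \<le> \<bar>pd (Mset r0) l (\<lambda>y. e y $ i $ j) (?F p)\<bar> * (norm (?F p)) ^ 3" by (rule mult_left_mono) simp
      also have "\<dots> \<le> \<kappa>" by (rule e1[OF Fp])
      finally show ?thesis by (simp add: power3_eq_cube)
    qed
    have "\<bar>christ (Mset r0) e (?F p) l i j\<bar> \<le> (\<bar>pd (Mset r0) i (\<lambda>y. e y $ j $ l) (?F p)\<bar>
        + \<bar>pd (Mset r0) j (\<lambda>y. e y $ i $ l) (?F p)\<bar> + \<bar>pd (Mset r0) l (\<lambda>y. e y $ i $ j) (?F p)\<bar>) / 2"
      unfolding christ_def abs_divide abs_numeral by (rule divide_right_mono) linarith+
    then have "\<bar>christ (Mset r0) e (?F p) l i j\<bar> * R ^ 3 \<le> (\<bar>pd (Mset r0) i (\<lambda>y. e y $ j $ l) (?F p)\<bar>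
        + \<bar>pd (Mset r0) j (\<lambda>y. e y $ i $ l) (?F p)\<bar> + \<bar>pd (Mset r0) l (\<lambda>y. e y $ i $ j) (?F p)\<bar>) / 2 * R ^ 3"
      by (rule mult_right_mono) (use R0 in simp)
    also have "\<dots> = (\<bar>pd (Mset r0) i (\<lambda>y. e y $ j $ l) (?F p)\<bar> * R ^ 3
        + \<bar>pd (Mset r0) j (\<lambda>y. e y $ i $ l) (?F p)\<bar> * R ^ 3 + \<bar>pd (Mset r0) l (\<lambda>y. e y $ i $ j) (?F p)\<bar> * R ^ 3) / 2"
      by (simp only: distrib_right times_divide_eq_left)
    also have "\<dots> \<le> (8 * \<kappa> + 8 * \<kappa> + 8 * \<kappa>) / 2" by (intro divide_right_mono add_mono pde) simp
    finally have "\<bar>\<Gamma> l i j\<bar> * R\<^sup>2 \<le> 12 * \<kappa>"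
      using R0 by (simp add: \<Gamma>_def abs_mult power2_eq_square power3_eq_cube mult_ac)
    then show ?thesis using R0 by (simp add: \<kappa>'_def pos_le_divide_eq)
  qed
  define q0 where "q0 = - (2 * m * \<phi> ^ 3 / norm (?F p) ^ 3) *\<^sub>R ?F p"
  \<comment> \<open>64 = 2 * 2^3 / (1/2)^2, from m \<le> 1, \<phi> \<le> 2, f \<ge> 1/2 and R \<ge>
    1.\<close>
  have normq: "norm (R *\<^sub>R q0) \<le> 64"
  proof -
    have "norm (R *\<^sub>R q0) = R * (2 * m * \<phi> ^ 3 / norm (?F p) ^ 3 * norm (?F p))"
      using R0 m \<phi> by (simp add: q0_def abs_mult)
    also have "\<dots> = 2 * m * \<phi> ^ 3 / (R * f\<^sup>2)"
      unfolding normF using R0 f by (simp add: power2_eq_square power3_eq_cube mult_ac)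
    also have "\<dots> \<le> 2 * 1 * 2 ^ 3 / (1 * (1 / 2)\<^sup>2)"
      using R1 R0 f m \<phi> by (intro frac_le mult_mono power_mono) auto
    finally show ?thesis by (simp add: power2_eq_square)
  qed
  have pos: "w \<bullet> (?G (?F p) *v w) > 0" if "w \<noteq> 0" for w
    using min that by (simp add: minimal_immersion_def gform_eq_inner)
  from positive_definite_solvable[OF pos] obtain \<nu> where G\<nu>: "?G (?F p) *v \<nu> = N" by blast
  note comps = J.component_bounds[OF \<eta>k(2)]
  interpret Q: perturbed_normal a b N \<nu> "R *\<^sub>R q0" "e (?F p)" \<Gamma> "\<phi> ^ 4" \<kappa>'
  proof
    show "0 \<le> \<kappa>'" using \<kappa>0 by (simp add: \<kappa>'_def)
    have "6 * \<kappa> / R\<^sup>2 \<le> 6 * \<kappa> / 1" using \<kappa>0 R1 by (intro divide_left_mono) auto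
    then show "\<kappa>' \<le> 1 / 18" using \<kappa> by (simp add: \<kappa>'_def)
    show "1 \<le> \<phi> ^ 4" using \<phi> by simp
    show "\<bar>e (?F p) $ i $ j\<bar> \<le> \<kappa>'" for i j by (rule eb)
    show "\<bar>\<Gamma> l i j\<bar> \<le> 2 * \<kappa>'" for l i j by (rule \<Gamma>)
    show na: "norm a \<le> 8"
      unfolding a_def by (rule order_trans[OF norm_frame_le]) (use comps(1-3) in linarith)
    show nb: "norm b \<le> 8"
      unfolding b_def by (rule order_trans[OF norm_frame_le]) (use comps(4,5) in linarith)
    have "N = cross3 a b" by (simp add: N_def a_def b_def frame_cross J.n1_def J.n2_def J.n3_def)
    moreover have "norm (cross3 a b) \<le> norm a * norm b"
      by (rule power2_le_imp_le) (simp_all add: norm_cross power_mult_distrib)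
    moreover have "norm a * norm b \<le> 8 * 8" using na nb by (intro mult_mono) auto
    ultimately show "norm N \<le> 64" by simp
    show "norm (R *\<^sub>R q0) \<le> 64" by (rule normq)
    show "\<phi> ^ 4 *\<^sub>R \<nu> + e (?F p) *v \<nu> = N" using G\<nu> by (simp add: gmet_mult_vector \<phi>_def)
  qed (use N in auto)
  have sym: "gform ?G (?F p) x y = gform ?G (?F p) y x" for x y
  proof -
    have "?G (?F p) $ i $ j = ?G (?F p) $ j $ i" for i j
      using E Fp by (simp add: gmet_def in_E_def mat_def)
    then show ?thesis unfolding gform_def by (subst sum.swap) (simp add: mult_ac)
  qed
  have ex: "pd_exists (Mset r0) i (\<lambda>y. e y $ j $ l) (?F p)" for i j l
    using E Fp by (simp add: in_E_def numeral_2_eq_2)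
  have h: "hind ?G ?F 1 1 p = R\<^sup>2 * Q.metric_entry a a" "hind ?G ?F 1 2 p = R\<^sup>2 * Q.metric_entry a b"
    "hind ?G ?F 2 1 p = R\<^sup>2 * Q.metric_entry b a" "hind ?G ?F 2 2 p = R\<^sup>2 * Q.metric_entry b b"
    unfolding hind_def dF(1,2) gform_bilinear Q.metric_entry_def gform_eq_inner gmet_mult_vector
      \<phi>_def[symmetric] inner_add_right inner_scaleR_right power2_eq_square
    by (simp_all add: matrix_vector_mult_scaleR algebra_simps)
  have sff_eq: "gform ?G (?F p) (R *\<^sub>R P) \<nu> + (\<Sum>l\<in>UNIV. \<Sum>i\<in>UNIV. \<Sum>j\<in>UNIV.
      christ (Mset r0) ?G (?F p) l i j * (R *\<^sub>R x) $ i * (R *\<^sub>R y) $ j * \<nu> $ l) = R * Q.sff_entry P x y" for P x y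
  proof -
    have "(\<Sum>l\<in>UNIV. \<Sum>i\<in>UNIV. \<Sum>j\<in>UNIV. christ (Mset r0) e (?F p) l i j * (R *\<^sub>R x) $ i * (R *\<^sub>R y) $ j * \<nu> $ l)
      = R * (\<Sum>l\<in>UNIV. \<Sum>i\<in>UNIV. \<Sum>j\<in>UNIV. \<Gamma> l i j * x $ i * y $ j * \<nu> $ l)"
      by (simp add: \<Gamma>_def sum_distrib_left mult_ac)
    then show ?thesis
      unfolding christ_gmet_contraction[OF Fp Fp0 ex] Q.sff_entry_def gform_eq_inner G\<nu> \<phi>_def[symmetric] q0_def[symmetric]
      by (simp add: field_simps)
  qed
  have sff: "sff (Mset r0) ?G ?F \<nu> 1 1 p = R * Q.sff_entry P11 a a" "sff (Mset r0) ?G ?F \<nu> 1 2 p = R * Q.sff_entry P12 a b"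
    "sff (Mset r0) ?G ?F \<nu> 2 1 p = R * Q.sff_entry P12 b a" "sff (Mset r0) ?G ?F \<nu> 2 2 p = R * Q.sff_entry P22 b b"
    unfolding sff_def dF(1-6) sff_eq by simp_all
  have "hind ?G ?F 2 2 p * sff (Mset r0) ?G ?F \<nu> 1 1 p - hind ?G ?F 1 2 p * sff (Mset r0) ?G ?F \<nu> 2 1 p
      - hind ?G ?F 2 1 p * sff (Mset r0) ?G ?F \<nu> 1 2 p + hind ?G ?F 1 1 p * sff (Mset r0) ?G ?F \<nu> 2 2 p = 0"
    by (rule minimal_immersion_numerator[OF min sym]) (simp_all add: gform_eq_inner G\<nu> dF(1,2) N)
  then have "R ^ 3 * (Q.metric_entry b b * Q.sff_entry P11 a a - Q.metric_entry a b * Q.sff_entry P12 b a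
      - Q.metric_entry b a * Q.sff_entry P12 a b + Q.metric_entry a a * Q.sff_entry P22 b b) = 0"
    unfolding h sff by (simp only: power2_eq_square power3_eq_cube algebra_simps)
  then have zero: "Q.metric_entry b b * Q.sff_entry P11 a a - Q.metric_entry a b * Q.sff_entry P12 b a
      - Q.metric_entry b a * Q.sff_entry P12 a b + Q.metric_entry a a * Q.sff_entry P22 b b = 0"
    using R0 by simp
  have "norm P11 \<le> 8"
    unfolding P11_def by (rule order_trans[OF norm_frame_le]) (use comps(1,2,6,7) in linarith)
  moreover have "norm P12 \<le> 8"
    unfolding P12_def by (rule order_trans[OF norm_frame_le]) (use comps(4,8,9) in linarith)
  moreover have "norm P22 \<le> 8"
    unfolding P22_def by (rule order_trans[OF norm_frame_le]) (use comps(10,11) in linarith)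
  ultimately have bound: "\<bar>(b \<bullet> b) * (P11 \<bullet> N) - 2 * (a \<bullet> b) * (P12 \<bullet> N) + (a \<bullet> a) * (P22 \<bullet> N)
      - ((R *\<^sub>R q0) \<bullet> N) / \<phi> ^ 4 * ((a \<bullet> a) * (b \<bullet> b) - (a \<bullet> b)\<^sup>2)\<bar> \<le> 1000000000000 * \<kappa>'"
    using zero by (rule Q.numerator_bound)
  have numer: "(b \<bullet> b) * (P11 \<bullet> N) - 2 * (a \<bullet> b) * (P12 \<bullet> N) + (a \<bullet> a) * (P22 \<bullet> N) = J.euclid_numerator"
    unfolding a_def b_def P11_def P12_def P22_def N_def frame_inner J.euclid_numerator_def by algebra
  have lagrange: "(a \<bullet> a) * (b \<bullet> b) - (a \<bullet> b)\<^sup>2 = J.normal_sq"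
    unfolding a_def b_def frame_inner J.normal_sq_def J.n1_def J.n2_def J.n3_def by algebra
  \<comment> \<open>The gradient carries \<phi>^3 and is divided by the conformal factor \<phi>^4;
    this leaves the single \<phi> in the denominator.\<close>
  define Y where "Y = (J.r * J.n1 + (s * v - t * w) * J.n3) * J.normal_sq / (\<phi> * f ^ 3)"
  have qN: "((R *\<^sub>R q0) \<bullet> N) / \<phi> ^ 4 * J.normal_sq = - (2 * m / R) * Y"
  proof -
    have XN: "X \<bullet> N = J.r * J.n1 + (s * v - t * w) * J.n3" by (simp add: X_def N_def frame_inner)
    have "(R *\<^sub>R q0) \<bullet> N = - (2 * m * \<phi> ^ 3 / (R * f ^ 3)) * (X \<bullet> N)"
      unfolding q0_def normF dF(7) using R0 f by (simp add: power3_eq_cube mult_ac f_def[symmetric])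
    then show ?thesis unfolding Y_def XN using R0 f \<phi>(1)
      by (simp add: power4_eq_xxxx power3_eq_cube mult_ac)
  qed
  define L where "L = wuu + wvv + 2 * s\<^sup>2 * w"
  have 1: "\<bar>J.euclid_numerator + 2 * m / R * Y\<bar> \<le> 1000000000000 * \<kappa>'"
    using bound unfolding numer lagrange qN by simp
  have 2: "\<bar>J.euclid_numerator - L\<bar> \<le> 10 ^ 20 * \<eta>\<^sup>2"
    unfolding L_def by (rule J.abs_euclid_numerator_minus_Jacobi_le)
  have src: "Schwarzschild_source v = s * (1 - v * t) / sqrt (1 + (s * v)\<^sup>2) ^ 3"
    by (simp add: Schwarzschild_source_def dilation_Jacobi_def s_def t_def)
  have "\<bar>s * v\<bar> \<le> 1" using abs_le_cosh[of v] ch by (simp add: s_def abs_mult)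
  from J.Schwarzschild_term_close[OF this \<eta>k(2) \<phi>(1)]
  have 3: "\<bar>Y - Schwarzschild_source v\<bar> \<le> 10 ^ 20 * \<eta> + 2 * (\<phi> - 1)"
    unfolding Y_def src f_eq .
  have "\<bar>L + 2 * m / R * Schwarzschild_source v\<bar> \<le> 1000000000000 * \<kappa>' + 10 ^ 20 * \<eta>\<^sup>2 + 2 * m / R * (10 ^ 20 * \<eta> + 2 * (m / R))"
  proof -
    have eq: "L + 2 * m / R * Schwarzschild_source v = (J.euclid_numerator + 2 * m / R * Y) - (J.euclid_numerator - L)
        - 2 * m / R * (Y - Schwarzschild_source v)" by (simp add: algebra_simps diff_divide_distrib)
    have "\<bar>2 * m / R * (Y - Schwarzschild_source v)\<bar> \<le> 2 * m / R * (10 ^ 20 * \<eta> + 2 * (m / R))"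
      by (rule abs_mult_le) (use m R0 3 \<phi>(2) in auto)
    moreover have "\<bar>x - y - z\<bar> \<le> A + B + C" if "\<bar>x\<bar> \<le> A" "\<bar>y\<bar> \<le> B" "\<bar>z\<bar> \<le> C" for x y z A B C :: real
      using that by linarith
    ultimately show ?thesis unfolding eq using 1 2 by blast
  qed
  \<comment> \<open>Undoes the rescaling of the defining function. Every error has order R^-2, so
    one factor 1 / R is kept.\<close>
  then have "R * \<bar>L + 2 * m / R * Schwarzschild_source v\<bar>
      \<le> R * (1000000000000 * \<kappa>' + 10 ^ 20 * \<eta>\<^sup>2 + 2 * m / R * (10 ^ 20 * \<eta> + 2 * (m / R)))"
    using R0 by (intro mult_left_mono) auto
  also have "\<dots> = (6 * 1000000000000 * \<kappa> + 10 ^ 20 * k\<^sup>2 + 2 * 10 ^ 20 * (m * k) + 4 * m\<^sup>2) / R"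
    using R0 by (simp add: \<kappa>'_def \<eta>_def power2_eq_square field_simps)
  also have "\<dots> \<le> 10 ^ 21 * (\<kappa> + k\<^sup>2 + m * k + m\<^sup>2) / R"
    using R0 \<kappa>0 m(1) k0 by (intro divide_right_mono) (auto intro!: add_nonneg_nonneg mult_nonneg_nonneg)
  also have "R * \<bar>L + 2 * m / R * Schwarzschild_source v\<bar>
      = \<bar>\<Omega>uu p + \<Omega>vv p + 2 / (cosh v)\<^sup>2 * \<Omega> p + 2 * m * Schwarzschild_source v\<bar>"
  proof -
    have "R * \<bar>L + 2 * m / R * Schwarzschild_source v\<bar> = \<bar>R * (L + 2 * m / R * Schwarzschild_source v)\<bar>"
      using R0 by (simp add: abs_mult)
    also have "R * (L + 2 * m / R * Schwarzschild_source v)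
        = \<Omega>uu p + \<Omega>vv p + 2 / (cosh v)\<^sup>2 * \<Omega> p + 2 * m * Schwarzschild_source v"
      unfolding \<Omega>R L_def s_def using R0 by (simp add: field_simps)
    finally show ?thesis .
  qed
  finally show ?thesis unfolding v_def R_def .
qed

section \<open>Averaging over the rotation angle\<close>

lemma Ck_imp_continuous: "Ck k S f \<Longrightarrow> continuous_on S f"
  by (cases k) auto

lemma continuous_on_slice:
  assumes "continuous_on UNIV f" "continuous_on S g" "continuous_on S h"
  shows "continuous_on S (\<lambda>x. f (pt (g x) (h x)))"
  by (rule continuous_on_compose2[OF assms(1) continuous_on_pt[OF assms(2,3)]]) auto

lemma has_derivative_slice_integral:
  assumes "Ck (Suc k) UNIV f"
  shows "((\<lambda>v. integral {a..b} (\<lambda>u. f (pt u v))) has_real_derivative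
    integral {a..b} (\<lambda>u. pd UNIV 2 f (pt u v))) (at v)"
proof -
  have cont: "continuous_on UNIV f" "continuous_on UNIV (pd UNIV 2 f)"
    using assms by (auto intro: Ck_imp_continuous)
  have "((\<lambda>v. integral (cbox a b) (\<lambda>u. f (pt u v))) has_field_derivative
      integral (cbox a b) (\<lambda>u. pd UNIV 2 f (pt u v))) (at v within UNIV)"
  proof (rule leibniz_rule_field_derivative)
    fix v u
    show "((\<lambda>v. f (pt u v)) has_field_derivative pd UNIV 2 f (pt u v)) (at v within UNIV)"
      using Ck_imp_has_pd[OF assms, of 2 "pt u v"] unfolding has_pd_pt_iff by simp
    show "(\<lambda>u. f (pt u v)) integrable_on cbox a b"
      by (intro integrable_continuous continuous_on_slice[OF cont(1)] continuous_intros)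
    show "continuous_on (UNIV \<times> cbox a b) (\<lambda>(v, u). pd UNIV 2 f (pt u v))"
      unfolding case_prod_beta by (intro continuous_on_slice[OF cont(2)] continuous_intros)
  qed auto
  then show ?thesis by simp
qed

text \<open>The graph tends to 0 only separately for each angle. The uniform bound allows dominated
  convergence, which is a statement about sequences, hence the sequence \<open>X\<close>.\<close>

lemma slice_integral_tendsto_0:
  fixes f :: "real^2 \<Rightarrow> real"
  assumes cont: "continuous_on UNIV f" and bound: "\<And>p. \<bar>f p\<bar> \<le> k"
    and lim: "\<And>u. (\<lambda>n. f (pt u (X n))) \<longlonglongrightarrow> 0"
  shows "(\<lambda>n. integral {a..b} (\<lambda>u. f (pt u (X n)))) \<longlonglongrightarrow> 0"
proof -
  have "(\<lambda>n. integral {a..b} (\<lambda>u. f (pt u (X n)))) \<longlonglongrightarrow> integral {a..b} (\<lambda>u. 0)"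
  proof (rule dominated_convergence(2)[where h = "\<lambda>_. k"])
    show "(\<lambda>u. f (pt u (X n))) integrable_on {a..b}" for n
      by (intro integrable_continuous_interval continuous_on_slice[OF cont] continuous_intros)
  qed (use bound lim in auto)
  then show ?thesis by simp
qed

text \<open>The first angular derivative inherits the period, so the angular part of the Jacobi
  operator integrates to 0 over a circle.\<close>

lemma integral_pd_periodic:
  assumes C: "Ck 2 UNIV f" and per: "\<And>p. f (p + (2 * pi) *\<^sub>R axis 1 1) = f p"
  shows "integral {0..2 * pi} (\<lambda>u. pd UNIV 1 (pd UNIV 1 f) (pt u v)) = 0"
proof -
  have C1: "Ck (Suc 0) UNIV (pd UNIV 1 f)" using C by (simp add: numeral_2_eq_2)
  have "((\<lambda>u. pd UNIV 1 (pd UNIV 1 f) (pt u v)) has_integral pd UNIV 1 f (pt (2 * pi) v) - pd UNIV 1 f (pt 0 v)) {0..2 * pi}"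
  proof (rule fundamental_theorem_of_calculus)
    fix u
    show "((\<lambda>u. pd UNIV 1 f (pt u v)) has_vector_derivative pd UNIV 1 (pd UNIV 1 f) (pt u v)) (at u within {0..2 * pi})"
      using Ck_imp_has_pd[OF C1, of 1 "pt u v"]
      unfolding has_pd_pt_iff has_real_derivative_iff_has_vector_derivative
      by (rule has_vector_derivative_at_within)
  qed simp
  moreover have "pd UNIV 1 f (pt (2 * pi) v) = pd UNIV 1 f (pt 0 v)"
  proof -
    have "f (pt (2 * pi) v + t *\<^sub>R axis 1 1) = f (pt 0 v + t *\<^sub>R axis 1 1)" for t
      using per[of "pt t v"] unfolding pt_add_axis by (simp add: add.commute)
    then show ?thesis by (simp add: pd_def)
  qed
  ultimately show ?thesis by (simp add: integral_unique)
qed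

text \<open>Integrating over the circle leaves an ordinary differential inequality for the integral
  of the graph. The source coefficient becomes 4 pi m and the error 2 pi B, so 13824 is
  halved.\<close>

lemma mass_le_of_Jacobi_estimate:
  assumes C: "Ck 2 UNIV \<Omega>" and per: "\<And>p. \<Omega> (p + (2 * pi) *\<^sub>R axis 1 1) = \<Omega> p" and bound: "\<And>p. \<bar>\<Omega> p\<bar> \<le> k"
    and lim: "\<And>u. ((\<lambda>v. \<Omega> (pt u v)) \<longlongrightarrow> 0) at_top" "\<And>u. ((\<lambda>v. \<Omega> (pt u v)) \<longlongrightarrow> 0) at_bot"
    and est: "\<And>p. \<bar>pd UNIV 1 (pd UNIV 1 \<Omega>) p + pd UNIV 2 (pd UNIV 2 \<Omega>) p + 2 / (cosh (p $ 2))\<^sup>2 * \<Omega> p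
      + 2 * m * Schwarzschild_source (p $ 2)\<bar> \<le> B / cosh (p $ 2)"
    and m: "0 \<le> m"
  shows "m \<le> 6912 * B"
proof -
  have C2: "Ck (Suc (Suc 0)) UNIV \<Omega>" using C by (simp add: numeral_2_eq_2)
  have C1: "Ck (Suc 0) UNIV (pd UNIV i \<Omega>)" for i using C2 by auto
  have cont: "continuous_on UNIV \<Omega>" "continuous_on UNIV (pd UNIV j (pd UNIV i \<Omega>))" for i j
    using C2 by auto
  define w where "w v = integral {0..2 * pi} (\<lambda>u. \<Omega> (pt u v))" for v
  define w1 where "w1 v = integral {0..2 * pi} (\<lambda>u. pd UNIV 2 \<Omega> (pt u v))" for v
  define w2 where "w2 v = integral {0..2 * pi} (\<lambda>u. pd UNIV 2 (pd UNIV 2 \<Omega>) (pt u v))" for v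
  have int: "(\<lambda>u. f (pt u v)) integrable_on {0..2 * pi}" if "continuous_on UNIV f" for f :: "real^2 \<Rightarrow> real" and v
    by (intro integrable_continuous_interval continuous_on_slice[OF that] continuous_intros)
  have "4 * pi * m \<le> 13824 * (2 * pi * B)"
  \<comment> \<open>With this \<open>f\<close> the required equation for the second derivative holds
    by construction; the content lies in the bound for \<open>f\<close> plus the source.\<close>
  proof (rule source_coefficient_le[where w = w and ?w1.0 = w1 and f = "\<lambda>v. w2 v + 2 / (cosh v)\<^sup>2 * w v" and B = "2 * pi * k"])
    fix v
    show "(w has_real_derivative w1 v) (at v)"
      unfolding w_def[abs_def] w1_def by (rule has_derivative_slice_integral[OF C2])
    show "(w1 has_real_derivative w2 v + 2 / (cosh v)\<^sup>2 * w v - 2 / (cosh v)\<^sup>2 * w v) (at v)"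
      using has_derivative_slice_integral[OF C1, of 0 "2 * pi" 2 v] unfolding w1_def[abs_def] w2_def by simp
    have k: "0 \<le> k" using bound[of 0] by linarith
    have "norm (w v) \<le> k * measure lborel (cbox 0 (2 * pi))"
      unfolding w_def using int[OF cont(1), of v] bound k
      by (intro has_integral_bound[of k "\<lambda>u. \<Omega> (pt u v)"]) (auto simp: integrable_integral)
    then show "\<bar>w v\<bar> \<le> 2 * pi * k" by (simp add: mult_ac)
    have "((\<lambda>u. pd UNIV 1 (pd UNIV 1 \<Omega>) (pt u v) + pd UNIV 2 (pd UNIV 2 \<Omega>) (pt u v) + 2 / (cosh v)\<^sup>2 * \<Omega> (pt u v)
        + 2 * m * Schwarzschild_source v) has_integral
        integral {0..2 * pi} (\<lambda>u. pd UNIV 1 (pd UNIV 1 \<Omega>) (pt u v)) + w2 v + 2 / (cosh v)\<^sup>2 * w v + measure lborel {0..2 * pi} *\<^sub>R (2 * m * Schwarzschild_source v)) (cbox 0 (2 * pi))"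
      unfolding cbox_interval w_def w2_def
      by (intro has_integral_add has_integral_mult_right integrable_integral int cont has_integral_const_real)
    then have "norm (integral {0..2 * pi} (\<lambda>u. pd UNIV 1 (pd UNIV 1 \<Omega>) (pt u v)) + w2 v + 2 / (cosh v)\<^sup>2 * w v + measure lborel {0..2 * pi} *\<^sub>R (2 * m * Schwarzschild_source v))
        \<le> B / cosh v * measure lborel (cbox 0 (2 * pi))"
    proof (rule has_integral_bound[rotated])
      show "0 \<le> B / cosh v" using est[of "pt 0 v"] by simp
      show "norm (pd UNIV 1 (pd UNIV 1 \<Omega>) (pt u v) + pd UNIV 2 (pd UNIV 2 \<Omega>) (pt u v) + 2 / (cosh v)\<^sup>2 * \<Omega> (pt u v)
        + 2 * m * Schwarzschild_source v) \<le> B / cosh v" for u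
        using est[of "pt u v"] by simp
    qed
    then show "\<bar>w2 v + 2 / (cosh v)\<^sup>2 * w v + 4 * pi * m * Schwarzschild_source v\<bar> \<le> 2 * pi * B / cosh v"
      unfolding integral_pd_periodic[OF C per] by (simp add: mult_ac)
  next
    show "(w \<longlongrightarrow> 0) at_top"
    proof (rule tendsto_at_topI_sequentially)
      fix X :: "nat \<Rightarrow> real" assume "filterlim X at_top sequentially"
      then show "(\<lambda>n. w (X n)) \<longlonglongrightarrow> 0"
        unfolding w_def by (intro slice_integral_tendsto_0[OF cont(1) bound] filterlim_compose[OF lim(1)])
    qed
    have "((\<lambda>v. w (- v)) \<longlongrightarrow> 0) at_top"
    proof (rule tendsto_at_topI_sequentially)
      fix X :: "nat \<Rightarrow> real" assume X: "filterlim X at_top sequentially"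
      then have "filterlim (\<lambda>n. - X n) at_bot sequentially" by (simp add: filterlim_uminus_at_top)
      then show "(\<lambda>n. w (- X n)) \<longlonglongrightarrow> 0"
        unfolding w_def by (intro slice_integral_tendsto_0[OF cont(1) bound] filterlim_compose[OF lim(2)])
    qed
    then show "(w \<longlongrightarrow> 0) at_bot" by (simp add: at_bot_mirror filterlim_filtermap)
  qed (use m in auto)
  then have "pi * (4 * m) \<le> pi * (27648 * B)" by (simp add: mult_ac)
  then have "4 * m \<le> 27648 * B" by (rule mult_left_le_imp_le) simp
  then show ?thesis by simp
qed

section \<open>Choice of the constants and the contradiction\<close>

theorem theorem1p2:
  fixes r0 eps0 :: real and e :: "real \<Rightarrow> real^3 \<Rightarrow> real^3^3"
  assumes "r0 > 0" and "eps0 > 0"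
    and "curve_cont (Enorm r0 2) (in_E r0 2) eps0 e"
    and "curve_diff_at0 (Enorm r0 2) (in_E r0 2) eps0 e"
    and "\<forall>x\<in>Mset r0. e 0 x = 0"
  shows "\<exists>cbar \<ge> r0. \<not> (\<exists>(\<Omega> :: real \<Rightarrow> real^2 \<Rightarrow> real) (m :: nat \<Rightarrow> real) (c :: nat \<Rightarrow> real).
            curve_cont (Cbnorm 2) (in_Cb 2) eps0 \<Omega>
          \<and> curve_diff_at0 (Cbnorm 2) (in_Cb 2) eps0 \<Omega>
          \<and> (\<forall>p. \<Omega> 0 p = 0)
          \<and> (\<forall>\<mu>\<in>{0..eps0}. \<forall>u::real. ((\<lambda>v. \<Omega> \<mu> (\<chi> k. if k = 1 then u else v)) \<longlongrightarrow> 0) at_top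
                                \<and> ((\<lambda>v. \<Omega> \<mu> (\<chi> k. if k = 1 then u else v)) \<longlongrightarrow> 0) at_bot)
          \<and> decseq m \<and> m \<longlonglongrightarrow> 0 \<and> (\<forall>i. 0 < m i \<and> m i < eps0)
          \<and> (\<forall>i. c i \<ge> cbar)
          \<and> (\<forall>i. minimal_immersion (Mset r0) (gmet (m i) (e (m i))) (Fcat (c i) (\<Omega> (m i)))))"
proof -
  from metric_curve_linear_bound[OF assms(2-5)] obtain K d where K: "0 \<le> K" "0 < d"
    and e_bound: "\<And>m i j \<alpha> x. 0 < m \<Longrightarrow> m < d \<Longrightarrow> m \<le> eps0 \<Longrightarrow> x \<in> Mset r0 \<Longrightarrow> sum \<alpha> UNIV \<le> 2 \<Longrightarrow>
       \<bar>dalpha3 (Mset r0) \<alpha> (\<lambda>y. e m y $ i $ j) x\<bar> * norm x ^ (2 + sum \<alpha> UNIV) \<le> K * m"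
    by blast
  \<comment> \<open>\<open>K\<close> depends on the metrics alone, so this is legitimate before any
    graph is given. The summand 1 in the maximum ensures c \<ge> 1, and 10^25 exceeds 6912 *
    10^21.\<close>
  define cbar where "cbar = max r0 1 + 10 ^ 25 * (K + 1)"
  have cbar: "r0 \<le> cbar" "1 \<le> cbar" "10 ^ 25 * (K + 1) < cbar"
    using K(1) assms(1) by (auto simp: cbar_def max_def)
  have False
    if cont: "curve_cont (Cbnorm 2) (in_Cb 2) eps0 \<Omega>" and diff: "curve_diff_at0 (Cbnorm 2) (in_Cb 2) eps0 \<Omega>"
      and zero: "\<forall>p. \<Omega> 0 p = 0"
      and lim: "\<forall>\<mu>\<in>{0..eps0}. \<forall>u::real. ((\<lambda>v. \<Omega> \<mu> (\<chi> k. if k = 1 then u else v)) \<longlongrightarrow> 0) at_top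
                                \<and> ((\<lambda>v. \<Omega> \<mu> (\<chi> k. if k = 1 then u else v)) \<longlongrightarrow> 0) at_bot"
      and m_lim: "m \<longlonglongrightarrow> 0" and m: "\<forall>i. 0 < m i \<and> m i < eps0" and c: "\<forall>i. c i \<ge> cbar"
      and min: "\<forall>i. minimal_immersion (Mset r0) (gmet (m i) (e (m i))) (Fcat (c i) (\<Omega> (m i)))"
    for \<Omega> :: "real \<Rightarrow> real^2 \<Rightarrow> real" and m c :: "nat \<Rightarrow> real"
  proof -
    from graph_curve_linear_bound[OF assms(2) cont diff zero] obtain L d' where L: "0 \<le> L" "0 < d'"
      and \<Omega>_bound: "\<And>m \<alpha> p. 0 < m \<Longrightarrow> m < d' \<Longrightarrow> m \<le> eps0 \<Longrightarrow> sum \<alpha> UNIV \<le> 2 \<Longrightarrow> \<bar>dalpha2 \<alpha> (\<Omega> m) p\<bar> \<le> L * m"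
      by blast
    \<comment> \<open>Smallness in terms of \<open>L\<close>, known only now. It yields at once the
      bounds 1/108 and 1/2 of the pointwise estimate, \<mu> \<le> 1, and the absorption of all
      quadratic terms. One index below \<open>M\<close> already gives the contradiction.\<close>
    define M where "M = min (min d d') (1 / (108 * (K + 1) + 2 * (L\<^sup>2 + L + 1)))"
    have M: "0 < M" using K L by (simp add: M_def add_nonneg_pos add_pos_nonneg)
    from order_tendstoD(2)[OF m_lim M] obtain i where i: "m i < M"
      using eventually_happens'[OF sequentially_bot] by blast
    define \<mu> where "\<mu> = m i"
    have \<mu>: "0 < \<mu>" "\<mu> \<le> eps0" "\<mu> < d" "\<mu> < d'" using m i by (auto simp: \<mu>_def M_def less_imp_le)
    have "\<mu> * (108 * (K + 1) + 2 * (L\<^sup>2 + L + 1)) \<le> 1"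
    proof -
      have "0 < 108 * (K + 1) + 2 * (L\<^sup>2 + L + 1)" using K L by (simp add: add_nonneg_pos add_pos_nonneg)
      moreover have "\<mu> < 1 / (108 * (K + 1) + 2 * (L\<^sup>2 + L + 1))" using i by (simp add: \<mu>_def M_def)
      ultimately show ?thesis by (simp add: pos_less_divide_eq less_imp_le)
    qed
    then have sum1: "108 * (K * \<mu>) + 108 * \<mu> + 2 * (L\<^sup>2 * \<mu>) + 2 * (L * \<mu>) + 2 * \<mu> \<le> 1" by (simp add: algebra_simps)
    have nn: "0 \<le> K * \<mu>" "0 \<le> L\<^sup>2 * \<mu>" "0 \<le> L * \<mu>" using K L \<mu> by simp_all
    have small: "K * \<mu> \<le> 1 / 108" "L * \<mu> \<le> 1 / 2" "\<mu> \<le> 1" "L\<^sup>2 * \<mu> + L * \<mu> + \<mu> \<le> 1"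
      using sum1 nn \<mu>(1) by linarith+
    have in_E: "in_E r0 2 (e \<mu>)" using assms(3) \<mu> by (auto simp: curve_cont_def)
    have in_Cb: "in_Cb 2 (\<Omega> \<mu>)" using cont \<mu> by (auto simp: curve_cont_def)
    have e0: "\<bar>e \<mu> x $ i $ j\<bar> * norm x ^ 2 \<le> K * \<mu>" if "x \<in> Mset r0" for x i j
      using e_bound[OF \<mu>(1,3,2) that, of "\<lambda>_. 0" i j] by (simp add: dalpha3_def)
    have e1: "\<bar>pd (Mset r0) l (\<lambda>y. e \<mu> y $ i $ j) x\<bar> * norm x ^ 3 \<le> K * \<mu>" if "x \<in> Mset r0" for x i j l
      using e_bound[OF \<mu>(1,3,2) that, of "\<lambda>k. if k = l then 1 else 0" i j] exhaust_3[of l]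
      by (auto simp: dalpha3_def sum_3 power3_eq_cube)
    have \<Omega>: "\<bar>\<Omega> \<mu> p\<bar> \<le> L * \<mu>" "\<bar>pd UNIV 1 (\<Omega> \<mu>) p\<bar> \<le> L * \<mu>" "\<bar>pd UNIV 2 (\<Omega> \<mu>) p\<bar> \<le> L * \<mu>"
      "\<bar>pd UNIV 1 (pd UNIV 1 (\<Omega> \<mu>)) p\<bar> \<le> L * \<mu>" "\<bar>pd UNIV 1 (pd UNIV 2 (\<Omega> \<mu>)) p\<bar> \<le> L * \<mu>"
      "\<bar>pd UNIV 2 (pd UNIV 2 (\<Omega> \<mu>)) p\<bar> \<le> L * \<mu>" for p
      using \<Omega>_bound[OF \<mu>(1,4,2), of "\<lambda>k. 0" p] \<Omega>_bound[OF \<mu>(1,4,2), of "\<lambda>k. if k = 1 then 1 else 0" p]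
        \<Omega>_bound[OF \<mu>(1,4,2), of "\<lambda>k. if k = 1 then 0 else 1" p] \<Omega>_bound[OF \<mu>(1,4,2), of "\<lambda>k. if k = 1 then 2 else 0" p]
        \<Omega>_bound[OF \<mu>(1,4,2), of "\<lambda>k. 1" p] \<Omega>_bound[OF \<mu>(1,4,2), of "\<lambda>k. if k = 1 then 0 else 2" p]
      by (simp_all add: dalpha2_def sum_2 numeral_2_eq_2)
    have ci: "1 \<le> c i" "10 ^ 25 * (K + 1) < c i" using c cbar by (meson order_trans less_le_trans)+
    define B where "B = 10 ^ 21 * (K * \<mu> + (L * \<mu>)\<^sup>2 + \<mu> * (L * \<mu>) + \<mu>\<^sup>2) / c i"
    have C2: "Ck 2 UNIV (\<Omega> \<mu>)" using in_Cb by (simp add: in_Cb_def)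
    have "\<mu> \<le> 6912 * B"
    proof (rule mass_le_of_Jacobi_estimate[OF C2 _ \<Omega>(1)])
      show "\<Omega> \<mu> (p + (2 * pi) *\<^sub>R axis 1 1) = \<Omega> \<mu> p" for p using in_Cb by (simp add: in_Cb_def)
      show "((\<lambda>v. \<Omega> \<mu> (pt u v)) \<longlongrightarrow> 0) at_top" "((\<lambda>v. \<Omega> \<mu> (pt u v)) \<longlongrightarrow> 0) at_bot" for u
        using lim \<mu> unfolding pt_def by auto
      fix p
      have "\<bar>pd UNIV 1 (pd UNIV 1 (\<Omega> \<mu>)) p + pd UNIV 2 (pd UNIV 2 (\<Omega> \<mu>)) p + 2 / (cosh (p $ 2))\<^sup>2 * \<Omega> \<mu> p
          + 2 * \<mu> * Schwarzschild_source (p $ 2)\<bar>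
          \<le> 10 ^ 21 * (K * \<mu> + (L * \<mu>)\<^sup>2 + \<mu> * (L * \<mu>) + \<mu>\<^sup>2) / (c i * cosh (p $ 2))"
        by (rule minimal_graph_pointwise_estimate[OF assms(1) in_E e0 e1 small(1) _ small(3) ci(1) C2 small(2) \<Omega>])
          (use \<mu> min in \<open>auto simp: \<mu>_def\<close>)
      then show "\<bar>pd UNIV 1 (pd UNIV 1 (\<Omega> \<mu>)) p + pd UNIV 2 (pd UNIV 2 (\<Omega> \<mu>)) p + 2 / (cosh (p $ 2))\<^sup>2 * \<Omega> \<mu> p
          + 2 * \<mu> * Schwarzschild_source (p $ 2)\<bar> \<le> B / cosh (p $ 2)"
        by (simp add: B_def)
    qed (use \<mu> in simp)
    \<comment> \<open>After factoring out \<mu> the only term without a further \<mu> is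
      \<open>K\<close>, the linear contribution of the metric perturbation; this is the one that
      large \<open>c i\<close> has to beat.\<close>
    also have "6912 * B = \<mu> * (6912 * 10 ^ 21 * (K + (L\<^sup>2 * \<mu> + L * \<mu> + \<mu>)) / c i)"
      by (simp add: B_def power2_eq_square algebra_simps)
    also have "\<dots> < \<mu> * 1"
    proof (rule mult_strict_left_mono[OF _ \<mu>(1)])
      have "6912 * 10 ^ 21 * (K + (L\<^sup>2 * \<mu> + L * \<mu> + \<mu>)) \<le> 10 ^ 25 * (K + 1)"
        using small(4) K(1) nn \<mu>(1) by (intro mult_mono) auto
      also have "\<dots> < c i" by (rule ci)
      finally show "6912 * 10 ^ 21 * (K + (L\<^sup>2 * \<mu> + L * \<mu> + \<mu>)) / c i < 1" using ci(1) by simp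
    qed
    finally show False by simp
  qed
  with cbar(1) show ?thesis by (intro exI[of _ cbar]) blast
qed

end
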